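(* Let $s\geq 3$ and $\varphi\in H^s(\mathbb{R})$, and let $t_c\in(0,\infty]$ be the critical time of the Hopf equation $v_t=v\,v_x$, $v(0)=\varphi$, i.e. the supremum of the times up to which its solution exists in $H^s$ (classically). Let $0<T<t_c$. For every $\varepsilon\in\mathbb{R}$ let $u(\cdot;\varepsilon)\in C([0,T],H^s)\cap C^1([0,T],H^{s-3})$ be the unique solution of the KdV Cauchy problem $$u_t=u\,u_x+\varepsilon\,u_{xxx},\qquad u(0)=\varphi.$$ Then the map $\varepsilon\mapsto u(\cdot;\varepsilon)$ is continuous from $\mathbb{R}$ to $C([0,T],H^s)\cap C^1([0,T],H^{s-3})$.
   Context: $H^s=H^s(\mathbb{R})$ is the real Sobolev space of order $s$. For $\varepsilon=0$ the problem is the Hopf equation, whose solution exists in $H^s$ on $[0,t_c)$; for $\varepsilon\neq 0$ the KdV Cauchy problem is globally well-posed in $H^s$. $C([0,T],X)\cap C^1([0,T],X')$ is equipped with the norm $\sup_t\|u(t)\|_X+\sup_t\|u_t(t)\|_{X'}$. *)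

theory Defs
  imports "HOL-Analysis.Analysis"
begin

definition test_fun :: "(real \<Rightarrow> real) \<Rightarrow> bool" where
  "test_fun \<psi> \<longleftrightarrow>
     (\<forall>n x. ((deriv ^^ n) \<psi> has_real_derivative (deriv ^^ Suc n) \<psi> x) (at x)) \<and>
     (\<exists>R. \<forall>x. R < \<bar>x\<bar> \<longrightarrow> \<psi> x = 0)"

definition L2 :: "(real \<Rightarrow> real) \<Rightarrow> bool" where
  "L2 f \<longleftrightarrow> f \<in> borel_measurable lborel \<and> integrable lborel (\<lambda>x. (f x)\<^sup>2)"

definition fourier :: "(real \<Rightarrow> real) \<Rightarrow> real \<Rightarrow> complex" where
  "fourier \<psi> \<xi> = (LINT x|lborel. complex_of_real (\<psi> x) * exp (- \<i> * complex_of_real (x * \<xi>)))"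

(* g is the L^2 (Plancherel) Fourier transform of f, characterised by the Parseval
   identity against all test functions (which determines g a.e. by density). *)
definition fourier_L2 :: "(real \<Rightarrow> real) \<Rightarrow> (real \<Rightarrow> complex) \<Rightarrow> bool" where
  "fourier_L2 f g \<longleftrightarrow> L2 f \<and> g \<in> borel_measurable lborel \<and>
     integrable lborel (\<lambda>\<xi>. (cmod (g \<xi>))\<^sup>2) \<and>
     (\<forall>\<psi>. test_fun \<psi> \<longrightarrow>
        complex_of_real (LINT x|lborel. f x * \<psi> x)
          = (LINT \<xi>|lborel. g \<xi> * cnj (fourier \<psi> \<xi>)) / complex_of_real (2 * pi))"

definition in_Hs :: "real \<Rightarrow> (real \<Rightarrow> real) \<Rightarrow> bool" where
  "in_Hs s f \<longleftrightarrow> (\<exists>g. fourier_L2 f g \<and>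
      integrable lborel (\<lambda>\<xi>. (1 + \<xi>\<^sup>2) powr s * (cmod (g \<xi>))\<^sup>2))"

definition hs_norm :: "real \<Rightarrow> (real \<Rightarrow> real) \<Rightarrow> real" where
  "hs_norm s f = sqrt (LINT \<xi>|lborel. (1 + \<xi>\<^sup>2) powr s * (cmod ((SOME g. fourier_L2 f g) \<xi>))\<^sup>2)"

definition weak_deriv :: "nat \<Rightarrow> (real \<Rightarrow> real) \<Rightarrow> (real \<Rightarrow> real) \<Rightarrow> bool" where
  "weak_deriv n f h \<longleftrightarrow> L2 h \<and>
     (\<forall>\<psi>. test_fun \<psi> \<longrightarrow>
        (LINT x|lborel. f x * (deriv ^^ n) \<psi> x) = (-1) ^ n * (LINT x|lborel. h x * \<psi> x))"

definition cont_Hs :: "real \<Rightarrow> real \<Rightarrow> (real \<Rightarrow> real \<Rightarrow> real) \<Rightarrow> bool" where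
  "cont_Hs s T u \<longleftrightarrow> (\<forall>t\<in>{0..T}. in_Hs s (u t)) \<and>
     (\<forall>t\<in>{0..T}. \<forall>e>0. \<exists>d>0. \<forall>t'\<in>{0..T}. \<bar>t' - t\<bar> < d \<longrightarrow>
         hs_norm s (\<lambda>x. u t' x - u t x) < e)"

definition C1_Hs :: "real \<Rightarrow> real \<Rightarrow> (real \<Rightarrow> real \<Rightarrow> real) \<Rightarrow> (real \<Rightarrow> real \<Rightarrow> real) \<Rightarrow> bool" where
  "C1_Hs r T u du \<longleftrightarrow> cont_Hs r T u \<and> cont_Hs r T du \<and>
     (\<forall>t\<in>{0..T}. ((\<lambda>t'. hs_norm r (\<lambda>x. (u t' x - u t x) / (t' - t) - du t x))
                     \<longlongrightarrow> 0) (at t within {0..T}))"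

definition pde_sol :: "real \<Rightarrow> real \<Rightarrow> real \<Rightarrow> (real \<Rightarrow> real) \<Rightarrow> real \<Rightarrow>
    (real \<Rightarrow> real \<Rightarrow> real) \<Rightarrow> (real \<Rightarrow> real \<Rightarrow> real) \<Rightarrow> bool" where
  "pde_sol s r T \<phi> \<epsilon> u du \<longleftrightarrow> cont_Hs s T u \<and> C1_Hs r T u du \<and>
     (AE x in lborel. u 0 x = \<phi> x) \<and>
     (\<forall>t\<in>{0..T}. \<exists>w1 w3. weak_deriv 1 (u t) w1 \<and> weak_deriv 3 (u t) w3 \<and>
         (AE x in lborel. du t x = u t x * w1 x + \<epsilon> * w3 x))"

definition hopf_sol :: "real \<Rightarrow> real \<Rightarrow> (real \<Rightarrow> real) \<Rightarrow> (real \<Rightarrow> real \<Rightarrow> real) \<Rightarrow>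
    (real \<Rightarrow> real \<Rightarrow> real) \<Rightarrow> bool" where
  "hopf_sol s T \<phi> v dv \<longleftrightarrow> pde_sol s (s - 1) T \<phi> 0 v dv"

definition crit_time :: "real \<Rightarrow> (real \<Rightarrow> real) \<Rightarrow> ereal" where
  "crit_time s \<phi> = Sup {ereal T | T. 0 < T \<and> (\<exists>v dv. hopf_sol s T \<phi> v dv)}"

end

theory Submission
  imports Defs "HOL-Probability.Probability"
begin

text \<open>On the Fourier side, \<open>u\<^sub>t = u u\<^sub>x + \<epsilon> u\<^sub>x\<^sub>x\<^sub>x\<close> becomes an evolution equation for the transform of \<open>u\<close>
  whose dispersive part is skew, hence drops out of every energy identity whatever \<open>\<epsilon>\<close> is. A commutator
  estimate gives exponential growth bounds for the energies with weight \<open>(1 + \<xi>\<^sup>2)\<^sup>s (min 1 (\<bar>\<xi>\<bar> / R))\<^sup>2\<close>,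
  with rate controlled by the integral of \<open>\<bar>\<xi>\<bar> \<bar>u(\<xi>)\<bar>\<close> only. Since that energy of the initial datum tends
  to zero as \<open>R\<close> grows, the high frequencies are small uniformly in \<open>\<epsilon>\<close> and \<open>t\<close>. The low frequencies are
  controlled by the energy estimate for the difference of two solutions in \<open>L\<^sup>2\<close>, where the term
  \<open>(\<epsilon> - \<epsilon>\<^sub>0) u\<^sub>x\<^sub>x\<^sub>x\<close> is harmless because \<open>s \<ge> 3\<close>. Both estimates need a bound on the perturbed solution, which a
  continuity argument in time supplies: as long as the difference in \<open>H\<^sup>s\<close> is at most one, it is small.\<close>

section \<open>Smooth functions and test functions\<close>

text \<open>An \<open>H^s\<close> energy estimate for the difference of two solutions would put
  \<open>s + 3\<close> derivatives on the reference solution through the term with the third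
  derivative, and \<open>s + 1\<close> through the transport term. Hence two scales: in
  \<open>L^2\<close> three derivatives suffice, and \<open>H^s\<close> is recovered by adding tails
  whose smallness comes from the datum. The scale \<open>R\<close> is fixed first, the distance of
  the two parameters afterwards. A second obstacle is that the equation holds only in
  \<open>H^(s-3)\<close>, so an \<open>H^s\<close> energy cannot be differentiated directly. The
  weights are bounded first, and the bound is removed at the end because the estimates do not depend
  on it. Truncation destroys differentiability, so the commutator estimate rests on monotonicity and
  scaling of the weight alone. The transform is given only through Parseval's identity against test
  functions. Its uniqueness and the inversion formula both go back to Levy's theorem on
  characteristic functions. After that \<open>hs_norm\<close>, which is defined by choice, is an
  integral over any transform, and all estimates live on the Fourier side.\<close>

definition smooth :: "(real \<Rightarrow> real) \<Rightarrow> bool" where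
  "smooth f \<longleftrightarrow> (\<forall>n x. ((deriv ^^ n) f has_real_derivative (deriv ^^ Suc n) f x) (at x))"

text \<open>A class closed under differentiation consists of smooth functions. The later smoothness
  proofs exhibit such a class instead of a formula for the n-th derivative.\<close>

lemma smoothI:
  assumes "f \<in> P" and step: "\<And>f. f \<in> P \<Longrightarrow> \<exists>g\<in>P. \<forall>x. (f has_real_derivative g x) (at x)"
  shows "smooth f"
proof -
  have d: "deriv f \<in> P \<and> (\<forall>x. (f has_real_derivative deriv f x) (at x))" if f: "f \<in> P" for f
  proof -
    obtain g where g: "g \<in> P" "\<forall>x. (f has_real_derivative g x) (at x)"
      using step[OF f] by blast
    then have "deriv f = g" by (intro ext DERIV_imp_deriv) auto
    with g show ?thesis by simp
  qed
  have "(deriv ^^ n) f \<in> P" for n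
    by (induction n) (use assms(1) d in auto)
  with d show ?thesis unfolding smooth_def by simp
qed

lemma smooth_deriv: "smooth f \<Longrightarrow> smooth (deriv f)"
  unfolding smooth_def by (metis funpow_Suc_right o_apply)

lemma smooth_DERIV: "smooth f \<Longrightarrow> (f has_real_derivative deriv f x) (at x)"
  unfolding smooth_def by (metis funpow_0 funpow_simps_right(1) funpow.simps(2) id_apply o_apply)

lemma smooth_continuous: "smooth f \<Longrightarrow> continuous_on UNIV f"
  by (meson DERIV_isCont continuous_at_imp_continuous_on smooth_DERIV)

lemma smooth_affine:
  assumes "smooth f" shows "smooth (\<lambda>x. f (a * x + b))"
proof (rule smoothI[where P = "{\<lambda>x. c * (deriv ^^ n) f (a * x + b) | c n. True}"])
  show "(\<lambda>x. f (a * x + b)) \<in> {\<lambda>x. c * (deriv ^^ n) f (a * x + b) | c n. True}"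
    by (rule CollectI, rule exI[of _ 1], rule exI[of _ 0]) auto
next
  fix h assume "h \<in> {\<lambda>x. c * (deriv ^^ n) f (a * x + b) | c n. True}"
  then obtain c n where h: "h = (\<lambda>x. c * (deriv ^^ n) f (a * x + b))" by auto
  have D: "((deriv ^^ n) f has_real_derivative (deriv ^^ Suc n) f (a * x + b)) (at (a * x + b))" for x
    using assms unfolding smooth_def by blast
  have "(h has_real_derivative (c * a) * (deriv ^^ Suc n) f (a * x + b)) (at x)" for x
  proof -
    have "((\<lambda>x. a * x + b) has_real_derivative a) (at x)" by (auto intro!: derivative_eq_intros)
    from DERIV_cmult[OF DERIV_chain2[where f = "(deriv ^^ n) f" and g = "\<lambda>x. a * x + b", OF D[of x] this], of c]
    show ?thesis unfolding h by (simp add: mult_ac)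
  qed
  then show "\<exists>g\<in>{\<lambda>x. c * (deriv ^^ n) f (a * x + b) | c n. True}. \<forall>x. (h has_real_derivative g x) (at x)"
    by (intro bexI[of _ "\<lambda>x. (c * a) * (deriv ^^ Suc n) f (a * x + b)"]) blast+
qed

text \<open>Leibniz' rule without binomial coefficients: a list of index pairs encodes a sum of
  products of derivatives, and \<open>N\<close> differentiates it by replacing each pair with its
  two successors. The sums \<open>H L\<close> are closed under differentiation.\<close>

lemma smooth_mult:
  assumes f: "smooth f" and g: "smooth g" shows "smooth (\<lambda>x. f x * g x)"
proof -
  define H :: "(nat \<times> nat) list \<Rightarrow> real \<Rightarrow> real"
    where "H L = (\<lambda>x. \<Sum>(i,j)\<leftarrow>L. (deriv ^^ i) f x * (deriv ^^ j) g x)" for L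
  define N :: "(nat \<times> nat) list \<Rightarrow> (nat \<times> nat) list"
    where "N L = concat (map (\<lambda>(i,j). [(Suc i, j), (i, Suc j)]) L)" for L
  have fD: "((deriv ^^ i) f has_real_derivative (deriv ^^ Suc i) f x) (at x)" for i x
    using f unfolding smooth_def by blast
  have gD: "((deriv ^^ i) g has_real_derivative (deriv ^^ Suc i) g x) (at x)" for i x
    using g unfolding smooth_def by blast
  have "(H L has_real_derivative H (N L) x) (at x)" for L x
  proof (induction L)
    case (Cons p L)
    obtain i j where p: "p = (i,j)" by (cases p)
    have 1: "H (p # L) = (\<lambda>x. (deriv ^^ i) f x * (deriv ^^ j) g x + H L x)"
      by (simp add: H_def p)
    have 2: "H (N (p # L)) x = ((deriv ^^ Suc i) f x * (deriv ^^ j) g x + (deriv ^^ i) f x * (deriv ^^ Suc j) g x) + H (N L) x"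
      by (simp add: H_def N_def p)
    show ?case unfolding 1 2
      by (rule DERIV_add[OF _ Cons.IH]) (use DERIV_mult[OF fD[of i x] gD[of j x]] in \<open>simp add: algebra_simps\<close>)
  qed (simp add: H_def N_def)
  then show ?thesis
    by (intro smoothI[where P = "range H"]) (auto simp: H_def intro!: image_eqI[of _ _ "[(0,0)]"])
qed

lemma smooth_cos: "smooth (\<lambda>x. cos (y * x))" and smooth_sin: "smooth (\<lambda>x. sin (y * x))"
proof -
  define P where "P = {\<lambda>x. a * cos (y * x) + b * sin (y * x) | a b. True}"
  have P: "\<exists>g\<in>P. \<forall>x. (f has_real_derivative g x) (at x)" if "f \<in> P" for f
  proof -
    from that obtain a b where f: "f = (\<lambda>x. a * cos (y * x) + b * sin (y * x))" unfolding P_def by auto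
    have "\<forall>x. (f has_real_derivative (b * y) * cos (y * x) + (- a * y) * sin (y * x)) (at x)"
      unfolding f by (auto intro!: derivative_eq_intros)
    moreover have "(\<lambda>x. (b * y) * cos (y * x) + (- a * y) * sin (y * x)) \<in> P" unfolding P_def by blast
    ultimately show ?thesis by (intro bexI)
  qed
  have "(\<lambda>x. cos (y * x)) \<in> P" unfolding P_def
    by (rule CollectI, rule exI[of _ 1], rule exI[of _ 0]) auto
  then show "smooth (\<lambda>x. cos (y * x))" using P by (rule smoothI)
  have "(\<lambda>x. sin (y * x)) \<in> P" unfolding P_def
    by (rule CollectI, rule exI[of _ 0], rule exI[of _ 1]) auto
  then show "smooth (\<lambda>x. sin (y * x))" using P by (rule smoothI)
qed

section \<open>A smooth bump function and the stability of test functions\<close>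

definition flat_exp :: "real poly \<Rightarrow> real \<Rightarrow> real" where
  "flat_exp p x = (if 0 < x then poly p (1 / x) * exp (- (1 / x)) else 0)"

lemma poly_exp_tendsto_0: "((\<lambda>y. poly p y * exp (- y)) \<longlongrightarrow> 0) (at_top :: real filter)"
proof -
  have "((\<lambda>y. \<Sum>i\<le>degree p. coeff p i * (y ^ i / exp y)) \<longlongrightarrow> (\<Sum>i\<le>degree p. coeff p i * 0)) (at_top :: real filter)"
    by (intro tendsto_intros tendsto_power_div_exp_0)
  then show ?thesis
    by (simp add: poly_altdef sum_distrib_right sum_divide_distrib exp_minus field_simps)
qed

text \<open>With \<open>y = 1 / x\<close>, the derivative of \<open>p(y) exp(-y)\<close> with
  respect to \<open>x\<close> is \<open>y^2 (p - p')(y) exp(-y)\<close>; the factor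
  \<open>[:0,0,1:]\<close> is \<open>y^2\<close>. Admitting every polynomial makes the family closed
  under differentiation.\<close>

lemma flat_exp_DERIV:
  "(flat_exp p has_real_derivative flat_exp ([:0,0,1:] * (p - pderiv p)) x) (at x)"
proof -
  consider "x > 0" | "x < 0" | "x = 0" by linarith
  then show ?thesis
  proof cases
    case 1
    have "((\<lambda>x. poly p (1 / x) * exp (- (1 / x))) has_real_derivative flat_exp ([:0,0,1:] * (p - pderiv p)) x) (at x)"
      unfolding flat_exp_def using 1
      by (auto intro!: derivative_eq_intros DERIV_chain2[OF poly_DERIV] simp: field_simps power2_eq_square)
    then show ?thesis
      by (rule has_field_derivative_transform_within_open[where S = "{0<..}"]) (use 1 in \<open>auto simp: flat_exp_def\<close>)
  next
    case 2
    have "((\<lambda>x. 0) has_real_derivative flat_exp ([:0,0,1:] * (p - pderiv p)) x) (at x)"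
      unfolding flat_exp_def using 2 by auto
    then show ?thesis
      by (rule has_field_derivative_transform_within_open[where S = "{..<0}"]) (use 2 in \<open>auto simp: flat_exp_def\<close>)
  next
    case 3
    have "((\<lambda>h. flat_exp p h / h) \<longlongrightarrow> 0) (at_right 0)"
    proof -
      \<comment> \<open>The difference quotient at 0 carries one more factor \<open>1 / h\<close>,
        that is, the polynomial \<open>y * p(y)\<close>, which is \<open>pCons 0 p\<close>.\<close>
      have "((\<lambda>h. poly (pCons 0 p) (inverse h) * exp (- (inverse h))) \<longlongrightarrow> 0) (at_right (0::real))"
        by (rule filterlim_compose[OF poly_exp_tendsto_0 filterlim_inverse_at_top_right])
      then show ?thesis
        by (rule Lim_transform_eventually)
           (auto simp: eventually_at flat_exp_def divide_simps intro!: exI[of _ 1])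
    qed
    moreover have "((\<lambda>h. flat_exp p h / h) \<longlongrightarrow> 0) (at_left 0)"
      by (rule Lim_transform_eventually[where f = "\<lambda>_. 0"])
         (auto simp: eventually_at flat_exp_def intro!: exI[of _ 1])
    ultimately have "((\<lambda>h. flat_exp p h / h) \<longlongrightarrow> 0) (at 0)"
      by (simp add: filterlim_split_at)
    then show ?thesis using 3 by (simp add: DERIV_def flat_exp_def)
  qed
qed

lemma smooth_flat_exp: "smooth (flat_exp p)"
  by (rule smoothI[where P = "range flat_exp"]) (auto intro: flat_exp_DERIV)

definition bump :: "real \<Rightarrow> real" where
  "bump x = flat_exp 1 (x + 1) * flat_exp 1 (1 - x)"

lemma smooth_bump: "smooth bump"
  unfolding bump_def[abs_def]
  using smooth_mult[OF smooth_affine[OF smooth_flat_exp, of 1 1 1] smooth_affine[OF smooth_flat_exp, of 1 "-1" 1]]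
  by simp

lemma bump_pos: "\<bar>x\<bar> < 1 \<Longrightarrow> 0 < bump x" and bump_nonneg: "0 \<le> bump x"
  and bump_eq_0: "1 \<le> \<bar>x\<bar> \<Longrightarrow> bump x = 0"
  by (auto simp: bump_def flat_exp_def)

lemma test_fun_iff: "test_fun \<psi> \<longleftrightarrow> smooth \<psi> \<and> (\<exists>R. \<forall>x. R < \<bar>x\<bar> \<longrightarrow> \<psi> x = 0)"
  by (simp add: test_fun_def smooth_def)

lemma test_fun_mult_smooth: "test_fun \<psi> \<Longrightarrow> smooth f \<Longrightarrow> test_fun (\<lambda>x. \<psi> x * f x)"
  unfolding test_fun_iff by (auto intro: smooth_mult)

lemma test_fun_affine:
  assumes "test_fun \<psi>" "a \<noteq> 0" shows "test_fun (\<lambda>x. \<psi> (a * x + b))"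
proof -
  obtain R where R: "\<And>x. R < \<bar>x\<bar> \<Longrightarrow> \<psi> x = 0" using assms unfolding test_fun_iff by blast
  have "\<psi> (a * x + b) = 0" if "(R + \<bar>b\<bar>) / \<bar>a\<bar> < \<bar>x\<bar>" for x
  proof (rule R)
    have "R + \<bar>b\<bar> < \<bar>a * x\<bar>" using that assms(2) by (simp add: field_simps abs_mult)
    then show "R < \<bar>a * x + b\<bar>" by linarith
  qed
  then show ?thesis using assms unfolding test_fun_iff by (blast intro: smooth_affine)
qed

lemma test_fun_bump: "test_fun bump"
  unfolding test_fun_iff using smooth_bump by (auto intro!: exI[of _ 1] bump_eq_0)

lemma test_fun_deriv:
  assumes "test_fun \<psi>" shows "test_fun (deriv \<psi>)"
proof -
  obtain R where R: "\<And>x. R < \<bar>x\<bar> \<Longrightarrow> \<psi> x = 0" using assms unfolding test_fun_iff by blast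
  have "deriv \<psi> x = 0" if "R < \<bar>x\<bar>" for x
  proof (rule DERIV_imp_deriv)
    have "((\<lambda>_. 0) has_real_derivative 0) (at x)" by simp
    then show "(\<psi> has_real_derivative 0) (at x)"
      by (rule has_field_derivative_transform_within_open[where S = "{x. R < \<bar>x\<bar>}"])
         (use that R in \<open>auto intro!: open_Collect_less continuous_intros\<close>)
  qed
  then show ?thesis using assms smooth_deriv unfolding test_fun_iff by blast
qed

lemma test_fun_deriv_pow: "test_fun \<psi> \<Longrightarrow> test_fun ((deriv ^^ n) \<psi>)"
  by (induction n) (auto intro: test_fun_deriv)

section \<open>Uniqueness from Fourier integrals\<close>

text \<open>The positive and negative parts of \<open>k\<close>, normalised to mass one, are densities with the same
  characteristic function, so Levy's uniqueness theorem applies.\<close>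

lemma AE_0_if_trig_integrals_0:
  fixes k :: "real \<Rightarrow> real"
  assumes k: "integrable lborel k"
    and c0: "\<And>y. (LINT x|lborel. k x * cos (y * x)) = 0"
    and s0: "\<And>y. (LINT x|lborel. k x * sin (y * x)) = 0"
  shows "AE x in lborel. k x = 0"
proof -
  define p where "p = (\<lambda>x. max 0 (k x))"
  define q where "q = (\<lambda>x. max 0 (- k x))"
  have [measurable]: "k \<in> borel_measurable borel" using k by auto
  have p: "integrable lborel p" "\<And>x. 0 \<le> p x" and q: "integrable lborel q" "\<And>x. 0 \<le> q x"
    using k by (auto simp: p_def q_def intro!: integrable_max)
  then have [measurable]: "p \<in> borel_measurable borel" "q \<in> borel_measurable borel" by auto
  have pq: "k x = p x - q x" for x by (simp add: p_def q_def)
  define c where "c = (LINT x|lborel. p x)"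
  \<comment> \<open>At frequency 0 the cosine integral is the total mass, so one constant normalises
    both parts.\<close>
  have c: "c = (LINT x|lborel. q x)" using c0[of 0] p q by (simp add: pq c_def)
  show ?thesis
  proof (cases "c = 0")
    case True
    then have "AE x in lborel. p x = 0" "AE x in lborel. q x = 0"
      using integral_nonneg_eq_0_iff_AE[OF p(1)] integral_nonneg_eq_0_iff_AE[OF q(1)] p q c c_def by auto
    then show ?thesis by eventually_elim (simp add: pq)
  next
    case False
    have "0 \<le> c" unfolding c_def by (rule integral_nonneg_AE) (use p in auto)
    then have cp: "0 < c" using False by simp
    have rd: "real_distribution (density lborel (\<lambda>x. ennreal (r x / c)))"
      if r: "integrable lborel r" "\<And>x. 0 \<le> r x" "(LINT x|lborel. r x) = c" for r :: "real \<Rightarrow> real"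
    proof -
      have [measurable]: "r \<in> borel_measurable borel" using r by auto
      have "emeasure (density lborel (\<lambda>x. ennreal (r x / c))) UNIV = ennreal (LINT x|lborel. r x / c)"
        by (subst emeasure_density) (use r cp in \<open>auto simp: nn_integral_eq_integral\<close>)
      also have "\<dots> = 1" using r cp by simp
      finally show ?thesis
        unfolding real_distribution_def real_distribution_axioms_def
        by (auto intro!: prob_spaceI)
    qed
    let ?P = "density lborel (\<lambda>x. ennreal (p x / c))" and ?Q = "density lborel (\<lambda>x. ennreal (q x / c))"
    have ch: "char (density lborel (\<lambda>x. ennreal (r x / c))) t
        = complex_of_real ((LINT x|lborel. r x * cos (t * x)) / c) + \<i> * complex_of_real ((LINT x|lborel. r x * sin (t * x)) / c)"
      if r: "integrable lborel r" "\<And>x. 0 \<le> r x" for r t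
    proof -
      have [measurable]: "r \<in> borel_measurable borel" using r by auto
      have i: "integrable lborel (\<lambda>x. r x * cos (t * x))" "integrable lborel (\<lambda>x. r x * sin (t * x))"
        by (auto intro!: Bochner_Integration.integrable_bound[OF r(1)] simp: abs_mult mult_left_le)
      have ii: "complex_integrable lborel (\<lambda>x. complex_of_real (r x * cos (t * x) / c))"
          "complex_integrable lborel (\<lambda>x. \<i> * complex_of_real (r x * sin (t * x) / c))"
        by (intro integrable_mult_right integrable_of_real integrable_divide i)+
      have "char (density lborel (\<lambda>x. ennreal (r x / c))) t = (LINT x|lborel. (r x / c) *\<^sub>R iexp (t * x))"
        unfolding char_def by (rule integral_density) (use r cp in auto)
      also have "\<dots> = (LINT x|lborel. complex_of_real (r x * cos (t * x) / c) + \<i> * complex_of_real (r x * sin (t * x) / c))"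
        by (intro Bochner_Integration.integral_cong refl) (simp add: complex_eq_iff Re_exp Im_exp)
      also have "\<dots> = (LINT x|lborel. complex_of_real (r x * cos (t * x) / c)) + (LINT x|lborel. \<i> * complex_of_real (r x * sin (t * x) / c))"
        by (rule Bochner_Integration.integral_add[OF ii])
      also have "\<dots> = complex_of_real (LINT x|lborel. r x * cos (t * x) / c) + \<i> * complex_of_real (LINT x|lborel. r x * sin (t * x) / c)"
        by (simp only: integral_mult_right_zero integral_complex_of_real)
      finally show ?thesis by simp
    qed
    have "char ?P = char ?Q"
    proof
      fix t
      have i: "integrable lborel (\<lambda>x. r x * cos (t * x))" "integrable lborel (\<lambda>x. r x * sin (t * x))"
        if "integrable lborel r" for r :: "real \<Rightarrow> real"
        using that by (auto intro!: Bochner_Integration.integrable_bound[OF that] simp: abs_mult mult_left_le)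
      have "(LINT x|lborel. p x * cos (t * x)) = (LINT x|lborel. q x * cos (t * x))"
        using c0[of t] i[OF p(1)] i[OF q(1)] by (simp add: pq left_diff_distrib)
      moreover have "(LINT x|lborel. p x * sin (t * x)) = (LINT x|lborel. q x * sin (t * x))"
        using s0[of t] i[OF p(1)] i[OF q(1)] by (simp add: pq left_diff_distrib)
      ultimately show "char ?P t = char ?Q t" using ch[OF p] ch[OF q] by simp
    qed
    then have "?P = ?Q"
      using p q c c_def by (intro Levy_uniqueness rd) auto
    then have "AE x in lborel. ennreal (p x / c) = ennreal (q x / c)"
      by (intro sigma_finite_measure.density_unique[OF sigma_finite_lborel]) auto
    then show ?thesis
      by eventually_elim (use p q cp in \<open>simp add: pq\<close>)
  qed
qed

lemma integrable_dominated:
  fixes f :: "'a \<Rightarrow> 'b::{banach, second_countable_topology}" and g :: "'a \<Rightarrow> real"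
  assumes "integrable M g" "f \<in> borel_measurable M" "\<And>x. norm (f x) \<le> g x"
  shows "integrable M f"
  by (rule Bochner_Integration.integrable_bound[OF assms(1,2)])
     (use assms(3) in \<open>auto intro!: AE_I2 order_trans[OF _ abs_ge_self]\<close>)

lemma integrable_mult_bounded:
  fixes f g :: "real \<Rightarrow> 'a::{banach, second_countable_topology, real_normed_algebra}"
  assumes "integrable lborel f" "g \<in> borel_measurable borel" "\<And>x. norm (g x) \<le> B"
  shows "integrable lborel (\<lambda>x. f x * g x)" "integrable lborel (\<lambda>x. g x * f x)"
proof -
  have [measurable]: "f \<in> borel_measurable borel" using assms by auto
  have B: "norm (f x) * norm (g x) \<le> norm (f x) * B" for x
    by (intro mult_left_mono assms) auto
  have i: "integrable lborel (\<lambda>x. norm (f x) * B)" using assms by auto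
  have n: "norm (f x * g x) \<le> norm (norm (f x) * B)" "norm (g x * f x) \<le> norm (norm (f x) * B)" for x
    using B[of x] norm_mult_ineq[of "f x" "g x"] norm_mult_ineq[of "g x" "f x"]
    by (smt (verit) mult.commute norm_ge_zero real_norm_def)+
  show "integrable lborel (\<lambda>x. f x * g x)" "integrable lborel (\<lambda>x. g x * f x)"
    by (rule Bochner_Integration.integrable_bound[OF i]; use assms n in \<open>simp\<close>)+
qed

text \<open>One frequency only yields combinations of the integrals of the real and the imaginary
  part. Comparing the frequencies \<open>y\<close> and \<open>- y\<close> separates them and reduces
  the claim to the real case.\<close>

lemma AE_0_if_fourier_integrals_0:
  fixes k :: "real \<Rightarrow> complex"
  assumes k: "integrable lborel k"
    and 0: "\<And>y. (LINT x|lborel. k x * iexp (y * x)) = 0"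
  shows "AE x in lborel. k x = 0"
proof -
  have [measurable]: "k \<in> borel_measurable borel" using k by auto
  have i: "integrable lborel (\<lambda>x. Re (k x))" "integrable lborel (\<lambda>x. Im (k x))" using k by auto
  have ic: "integrable lborel (\<lambda>x. r x * cos (y * x))" "integrable lborel (\<lambda>x. r x * sin (y * x))"
    if "integrable lborel r" for r :: "real \<Rightarrow> real" and y
    using that by (auto intro!: Bochner_Integration.integrable_bound[OF that] simp: abs_mult mult_left_le)
  have ik: "integrable lborel (\<lambda>x. k x * iexp (y * x))" for y
    by (rule integrable_mult_bounded[OF k, of _ 1]) auto
  have a: "(LINT x|lborel. Re (k x) * cos (y * x)) - (LINT x|lborel. Im (k x) * sin (y * x)) = 0" for y
  proof -
    have "(LINT x|lborel. Re (k x) * cos (y * x)) - (LINT x|lborel. Im (k x) * sin (y * x))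
       = (LINT x|lborel. Re (k x * iexp (y * x)))"
      by (subst Bochner_Integration.integral_diff[symmetric]) (use ic i in \<open>auto simp: Re_exp Im_exp\<close>)
    also have "\<dots> = Re (LINT x|lborel. k x * iexp (y * x))" by (rule integral_Re[OF ik])
    finally show ?thesis using 0 by simp
  qed
  have b: "(LINT x|lborel. Re (k x) * sin (y * x)) + (LINT x|lborel. Im (k x) * cos (y * x)) = 0" for y
  proof -
    have "(LINT x|lborel. Re (k x) * sin (y * x)) + (LINT x|lborel. Im (k x) * cos (y * x))
       = (LINT x|lborel. Im (k x * iexp (y * x)))"
      by (subst Bochner_Integration.integral_add[symmetric]) (use ic i in \<open>auto simp: Re_exp Im_exp\<close>)
    also have "\<dots> = Im (LINT x|lborel. k x * iexp (y * x))" by (rule integral_Im[OF ik])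
    finally show ?thesis using 0 by simp
  qed
  have "AE x in lborel. Re (k x) = 0"
    by (rule AE_0_if_trig_integrals_0[OF i(1)]) (use a b a[of "- y" for y] b[of "- y" for y] in \<open>simp; smt (verit)\<close>)+
  moreover have "AE x in lborel. Im (k x) = 0"
    by (rule AE_0_if_trig_integrals_0[OF i(2)]) (use a b a[of "- y" for y] b[of "- y" for y] in \<open>simp; smt (verit)\<close>)+
  ultimately show ?thesis by eventually_elim (simp add: complex_eq_iff)
qed

lemma test_fun_continuous: "test_fun \<psi> \<Longrightarrow> continuous_on UNIV \<psi>"
  by (simp add: test_fun_iff smooth_continuous)

lemma test_fun_measurable[measurable_dest]: "test_fun \<psi> \<Longrightarrow> \<psi> \<in> borel_measurable borel"
  by (simp add: test_fun_continuous borel_measurable_continuous_onI)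

lemma test_fun_bounded:
  assumes "test_fun \<psi>" obtains B R where "\<And>x. \<bar>\<psi> x\<bar> \<le> B" "\<And>x. R < \<bar>x\<bar> \<Longrightarrow> \<psi> x = 0" "0 < R" "0 < B"
proof -
  obtain R where R: "\<And>x. R < \<bar>x\<bar> \<Longrightarrow> \<psi> x = 0" using assms unfolding test_fun_iff by blast
  have "bounded (\<psi> ` {-R..R})"
    by (intro compact_imp_bounded compact_continuous_image)
       (use test_fun_continuous[OF assms] in \<open>auto intro: continuous_on_subset\<close>)
  then obtain B where B: "\<And>x. x \<in> {-R..R} \<Longrightarrow> \<bar>\<psi> x\<bar> \<le> B" by (metis bounded_iff image_eqI real_norm_def)
  show ?thesis
  proof (rule that[of "max 1 B" "max R 1"])
    show "\<bar>\<psi> x\<bar> \<le> max 1 B" for x using B[of x] R[of x] by (cases "R < \<bar>x\<bar>") (force simp: le_max_iff_disj)+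
  qed (use R in auto)
qed

lemma test_fun_integrable: assumes "test_fun \<psi>" shows "integrable lborel \<psi>"
proof -
  obtain B R where "\<And>x. \<bar>\<psi> x\<bar> \<le> B" "\<And>x. R < \<bar>x\<bar> \<Longrightarrow> \<psi> x = 0" using test_fun_bounded[OF assms] by metis
  then show ?thesis
    by (intro integrableI_bounded_set[where A = "{-R..R}" and B = B]) (use assms in \<open>auto intro!: AE_I2 simp: emeasure_lborel_Icc_eq\<close>)
qed

text \<open>The function \<open>f\<close> is made integrable by a dilated bump. A bump times a
  cosine or a sine is again a test function, so all trigonometric integrals of the product vanish.
  The bumps are positive on intervals that exhaust the line.\<close>

lemma fundamental_lemma:
  assumes [measurable]: "f \<in> borel_measurable borel"
    and i: "\<And>\<psi>. test_fun \<psi> \<Longrightarrow> integrable lborel (\<lambda>x. f x * \<psi> x)"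
    and 0: "\<And>\<psi>. test_fun \<psi> \<Longrightarrow> (LINT x|lborel. f x * \<psi> x) = 0"
  shows "AE x in lborel. f x = (0::real)"
proof -
  have "AE x in lborel. f x * bump (x / real (Suc n)) = 0" for n
  proof -
    have t: "test_fun (\<lambda>x. bump (x / real (Suc n)))"
      using test_fun_affine[OF test_fun_bump, of "1 / real (Suc n)" 0] by simp
    show ?thesis
      by (rule AE_0_if_trig_integrals_0[OF i[OF t]])
         (use 0[OF test_fun_mult_smooth[OF t smooth_cos]] 0[OF test_fun_mult_smooth[OF t smooth_sin]] in \<open>simp_all add: mult.assoc\<close>)
  qed
  then have "AE x in lborel. \<forall>n. f x * bump (x / real (Suc n)) = 0" unfolding AE_all_countable by blast
  then show ?thesis
  proof eventually_elim
    case (elim x)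
    obtain n where "\<bar>x\<bar> < real n" using reals_Archimedean2 by blast
    then have "0 < bump (x / real (Suc n))" by (intro bump_pos) simp
    with elim show ?case by (metis less_irrefl mult_eq_0_iff)
  qed
qed

section \<open>Square integrable complex functions\<close>

definition L2c :: "(real \<Rightarrow> complex) \<Rightarrow> bool" where
  "L2c g \<longleftrightarrow> g \<in> borel_measurable borel \<and> integrable lborel (\<lambda>x. (cmod (g x))\<^sup>2)"

lemma L2cD[measurable_dest]: "L2c g \<Longrightarrow> g \<in> borel_measurable borel" by (simp add: L2c_def)

lemma mult_le_square_add: "a * b \<le> a\<^sup>2 + b\<^sup>2" for a b :: real
  using sum_squares_bound[of a b] zero_le_power2[of a] zero_le_power2[of b] by linarith

lemma L2c_mult_integrable:
  assumes "L2c f" "L2c g" shows "integrable lborel (\<lambda>x. f x * g x)"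
proof (rule integrable_dominated)
  show "integrable lborel (\<lambda>x. (cmod (f x))\<^sup>2 + (cmod (g x))\<^sup>2)" using assms by (auto simp: L2c_def)
  show "(\<lambda>x. f x * g x) \<in> borel_measurable lborel" using assms by (auto simp: L2c_def)
qed (simp add: norm_mult mult_le_square_add)

lemma L2_mult_integrable:
  assumes "L2 f" "L2 g" shows "integrable lborel (\<lambda>x. f x * g x)"
proof (rule integrable_dominated)
  show "integrable lborel (\<lambda>x. (f x)\<^sup>2 + (g x)\<^sup>2)" using assms by (auto simp: L2_def)
  show "(\<lambda>x. f x * g x) \<in> borel_measurable lborel" using assms by (auto simp: L2_def)
  show "norm (f x * g x) \<le> (f x)\<^sup>2 + (g x)\<^sup>2" for x
    using mult_le_square_add[of "\<bar>f x\<bar>" "\<bar>g x\<bar>"] by (simp add: abs_mult)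
qed

lemma L2c_bound:
  assumes "L2c f" "g \<in> borel_measurable borel" "\<And>x. cmod (g x) \<le> B * cmod (f x)" shows "L2c g"
  unfolding L2c_def
proof (rule conjI[OF assms(2)], rule integrable_dominated)
  show "integrable lborel (\<lambda>x. B\<^sup>2 * (cmod (f x))\<^sup>2)" using assms by (auto simp: L2c_def)
  show "norm ((cmod (g x))\<^sup>2) \<le> B\<^sup>2 * (cmod (f x))\<^sup>2" for x
    using power_mono[OF assms(3), of x 2] by (simp add: power_mult_distrib)
qed (use assms in auto)

lemma L2c_cmult: "L2c f \<Longrightarrow> L2c (\<lambda>x. c * f x)"
  by (rule L2c_bound[of f _ "cmod c"]) (auto simp: norm_mult L2c_def)

lemma borel_measurable_cnj[measurable]: "cnj \<in> borel_measurable borel"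
  by (intro borel_measurable_continuous_onI continuous_intros)

lemma L2c_cnj: "L2c f \<Longrightarrow> L2c (\<lambda>x. cnj (f x))"
  by (rule L2c_bound[of f _ 1]) (auto simp: L2c_def)

lemma norm_add_square_le: "(norm (a + b))\<^sup>2 \<le> 2 * (norm a)\<^sup>2 + 2 * (norm b)\<^sup>2"
  for a b :: "'a::real_normed_vector"
proof -
  have "(norm (a + b))\<^sup>2 \<le> (norm a + norm b)\<^sup>2" by (intro power_mono norm_triangle_ineq) auto
  also have "\<dots> \<le> 2 * (norm a)\<^sup>2 + 2 * (norm b)\<^sup>2"
    using sum_squares_bound[of "norm a" "norm b"] by (simp add: power2_sum)
  finally show ?thesis .
qed

lemma norm_diff_square_le: "(norm (a - b))\<^sup>2 \<le> 2 * (norm a)\<^sup>2 + 2 * (norm b)\<^sup>2"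
  for a b :: "'a::real_normed_vector"
  using norm_add_square_le[of a "- b"] by simp

lemma L2c_add: assumes "L2c f" "L2c g" shows "L2c (\<lambda>x. f x + g x)"
  unfolding L2c_def
proof (rule conjI, use assms in measurable, rule integrable_dominated)
  show "integrable lborel (\<lambda>x. 2 * (cmod (f x))\<^sup>2 + 2 * (cmod (g x))\<^sup>2)" using assms by (auto simp: L2c_def)
qed (use assms norm_add_square_le in auto)

lemma L2c_diff: assumes "L2c f" "L2c g" shows "L2c (\<lambda>x. f x - g x)"
  using L2c_add[OF assms(1) L2c_cmult[OF assms(2), of "-1"]] by simp

lemma integrable_inverse_1_plus_square': "integrable lborel (\<lambda>x::real. 1 / (1 + x\<^sup>2))"
  using integrable_inverse_1_plus_square by (simp add: set_integrable_def inverse_eq_divide)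

section \<open>The Fourier transform of square integrable functions\<close>

text \<open>The conjugate of \<open>fourier\<close>, which is the factor that Parseval's identity
  pairs with the transform. Working with it directly keeps conjugations out of the pairings.\<close>

definition cfourier :: "(real \<Rightarrow> real) \<Rightarrow> real \<Rightarrow> complex" where
  "cfourier \<psi> \<xi> = (LINT x|lborel. complex_of_real (\<psi> x) * iexp (x * \<xi>))"

lemma cnj_fourier: "cnj (fourier \<psi> \<xi>) = cfourier \<psi> \<xi>"
  unfolding fourier_def cfourier_def Bochner_Integration.integral_cnj[symmetric]
  by (intro Bochner_Integration.integral_cong refl) (simp add: exp_cnj)

lemma cfourier_measurable[measurable (raw)]:
  "test_fun \<psi> \<Longrightarrow> cfourier \<psi> \<in> borel_measurable borel"
  using test_fun_measurable unfolding cfourier_def[abs_def] by measurable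

lemma cfourier_integrand: "test_fun \<psi> \<Longrightarrow> integrable lborel (\<lambda>x. complex_of_real (\<psi> x) * iexp (x * \<xi>))"
  by (rule integrable_mult_bounded(1)[where B = 1]) (auto intro: test_fun_integrable)

lemma cfourier_uminus: "cfourier \<psi> (- \<xi>) = cnj (cfourier \<psi> \<xi>)"
  unfolding cfourier_def Bochner_Integration.integral_cnj[symmetric]
  by (intro Bochner_Integration.integral_cong refl) (simp add: exp_cnj)

lemma norm_cfourier_le:
  assumes "test_fun \<psi>" shows "cmod (cfourier \<psi> \<xi>) \<le> (LINT x|lborel. \<bar>\<psi> x\<bar>)"
proof -
  have "cmod (cfourier \<psi> \<xi>) \<le> (LINT x|lborel. cmod (complex_of_real (\<psi> x) * iexp (x * \<xi>)))"
    unfolding cfourier_def by (rule integral_norm_bound)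
  then show ?thesis by (simp add: norm_mult)
qed

text \<open>Integration by parts, obtained from the fundamental theorem of calculus for the product
  of \<open>\<psi>\<close> and the character on an interval beyond both supports.\<close>

lemma cfourier_deriv:
  assumes t: "test_fun \<psi>" shows "cfourier (deriv \<psi>) \<xi> = - \<i> * \<xi> * cfourier \<psi> \<xi>"
proof -
  have t': "test_fun (deriv \<psi>)" by (rule test_fun_deriv[OF t])
  obtain R1 where R1: "\<And>x. R1 < \<bar>x\<bar> \<Longrightarrow> \<psi> x = 0" "0 < R1" using test_fun_bounded[OF t] by metis
  obtain R2 where R2: "\<And>x. R2 < \<bar>x\<bar> \<Longrightarrow> deriv \<psi> x = 0" "0 < R2" using test_fun_bounded[OF t'] by metis
  \<comment> \<open>The supports are described by strict inequalities; the extra 1 makes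
    \<open>\<psi>\<close> vanish at the endpoints themselves.\<close>
  define R where "R = max R1 R2 + 1"
  define D where "D x = complex_of_real (deriv \<psi> x) * iexp (x * \<xi>) + \<i> * \<xi> * (complex_of_real (\<psi> x) * iexp (x * \<xi>))" for x
  have D0: "D x = 0" if "R < \<bar>x\<bar>" for x using R1(1)[of x] R2(1)[of x] that by (simp add: D_def R_def)
  have c: "continuous_on {- R..R} D" unfolding D_def
    by (intro continuous_intros continuous_on_subset[OF test_fun_continuous[OF t]] continuous_on_subset[OF test_fun_continuous[OF t']]) auto
  have d: "((\<lambda>x. complex_of_real (\<psi> x) * iexp (x * \<xi>)) has_vector_derivative D x) (at x within {- R..R})" for x
  proof -
    have *: "(\<psi> has_real_derivative deriv \<psi> x) (at x within {- R..R})"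
      using t smooth_DERIV has_field_derivative_at_within unfolding test_fun_iff by blast
    have "((\<lambda>x. complex_of_real (\<psi> x)) has_vector_derivative complex_of_real (deriv \<psi> x)) (at x within {- R..R})"
      by (rule has_vector_derivative_of_real) (use * in \<open>simp add: has_real_derivative_iff_has_vector_derivative\<close>)
    moreover have "((\<lambda>x. iexp (x * \<xi>)) has_vector_derivative (\<i> * \<xi>) * iexp (x * \<xi>)) (at x within {- R..R})"
      by (auto intro!: derivative_eq_intros simp: has_vector_derivative_complex_iff Re_exp Im_exp)
    ultimately show ?thesis
      unfolding D_def by (rule has_vector_derivative_mult[THEN has_vector_derivative_eq_rhs]) (simp add: algebra_simps)
  qed
  have "(LINT x|lborel. indicator {- R..R} x *\<^sub>R D x) = complex_of_real (\<psi> R) * iexp (R * \<xi>) - complex_of_real (\<psi> (- R)) * iexp (- R * \<xi>)"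
    by (rule integral_FTC_Icc[OF _ _ c]) (use d R1 R2 in \<open>auto simp: R_def\<close>)
  also have "\<dots> = 0" using R1 by (simp add: R_def)
  also have "(LINT x|lborel. indicator {- R..R} x *\<^sub>R D x) = (LINT x|lborel. D x)"
    by (intro Bochner_Integration.integral_cong refl) (use D0 in \<open>auto simp: indicator_def abs_if\<close>)
  also have "\<dots> = cfourier (deriv \<psi>) \<xi> + \<i> * \<xi> * cfourier \<psi> \<xi>"
    unfolding D_def cfourier_def integral_mult_right_zero[symmetric]
    by (rule Bochner_Integration.integral_add) (intro integrable_mult_right cfourier_integrand t t')+
  finally show ?thesis by (simp add: eq_neg_iff_add_eq_0)
qed

lemma cfourier_deriv_pow:
  assumes "test_fun \<psi>" shows "cfourier ((deriv ^^ n) \<psi>) \<xi> = (- \<i> * \<xi>) ^ n * cfourier \<psi> \<xi>"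
  by (induction n) (use assms in \<open>simp_all add: cfourier_deriv test_fun_deriv_pow\<close>)

text \<open>The second derivative of \<open>\<psi>\<close> has a bounded transform, which controls
  \<open>\<xi>^2\<close> times that of \<open>\<psi>\<close>. This decay makes
  \<open>cfourier \<psi>\<close> square integrable.\<close>

lemma cfourier_decay:
  assumes t: "test_fun \<psi>" obtains B where "\<And>\<xi>. cmod (cfourier \<psi> \<xi>) \<le> B / (1 + \<xi>\<^sup>2)"
proof
  fix \<xi>
  have "\<xi>\<^sup>2 * cmod (cfourier \<psi> \<xi>) = cmod (cfourier ((deriv ^^ 2) \<psi>) \<xi>)"
    unfolding cfourier_deriv_pow[OF t] by (simp add: norm_mult norm_power)
  also have "\<dots> \<le> (LINT x|lborel. \<bar>(deriv ^^ 2) \<psi> x\<bar>)"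
    by (rule norm_cfourier_le[OF test_fun_deriv_pow[OF t]])
  finally have "(1 + \<xi>\<^sup>2) * cmod (cfourier \<psi> \<xi>) \<le> (LINT x|lborel. \<bar>\<psi> x\<bar>) + (LINT x|lborel. \<bar>(deriv ^^ 2) \<psi> x\<bar>)"
    using norm_cfourier_le[OF t, of \<xi>] by (simp add: algebra_simps)
  then show "cmod (cfourier \<psi> \<xi>) \<le> ((LINT x|lborel. \<bar>\<psi> x\<bar>) + (LINT x|lborel. \<bar>(deriv ^^ 2) \<psi> x\<bar>)) / (1 + \<xi>\<^sup>2)"
    by (simp add: pos_le_divide_eq add_pos_nonneg mult.commute)
qed

lemma L2c_cfourier: assumes t: "test_fun \<psi>" shows "L2c (cfourier \<psi>)"
proof -
  obtain B where B: "\<And>\<xi>. cmod (cfourier \<psi> \<xi>) \<le> B / (1 + \<xi>\<^sup>2)" using cfourier_decay[OF t] by blast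
  have b: "(cmod (cfourier \<psi> \<xi>))\<^sup>2 \<le> B\<^sup>2 * (1 / (1 + \<xi>\<^sup>2))" for \<xi>
  proof -
    have "(cmod (cfourier \<psi> \<xi>))\<^sup>2 \<le> (B / (1 + \<xi>\<^sup>2))\<^sup>2" by (intro power_mono B) auto
    also have "\<dots> = B\<^sup>2 * ((1 / (1 + \<xi>\<^sup>2)) * (1 / (1 + \<xi>\<^sup>2)))" by (simp add: power2_eq_square)
    also have "\<dots> \<le> B\<^sup>2 * ((1 / (1 + \<xi>\<^sup>2)) * 1)"
      by (intro mult_left_mono) (auto simp: divide_le_eq_1 add_pos_nonneg)
    finally show ?thesis by simp
  qed
  have "integrable lborel (\<lambda>\<xi>. (cmod (cfourier \<psi> \<xi>))\<^sup>2)"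
    by (rule Bochner_Integration.integrable_bound[OF integrable_mult_right[OF integrable_inverse_1_plus_square', of "B\<^sup>2"]])
       (use b t in auto)
  with t show ?thesis by (simp add: L2c_def cfourier_measurable)
qed

lemma cfourier_translate: "cfourier (\<lambda>x. \<psi> (x - y)) \<xi> = iexp (y * \<xi>) * cfourier \<psi> \<xi>"
proof -
  have "cfourier (\<lambda>x. \<psi> (x - y)) \<xi> = (LINT x|lborel. complex_of_real (\<psi> x) * iexp ((y + x) * \<xi>))"
    unfolding cfourier_def by (subst lborel_integral_real_affine[where c = 1 and t = y]) auto
  also have "\<dots> = (LINT x|lborel. iexp (y * \<xi>) * (complex_of_real (\<psi> x) * iexp (x * \<xi>)))"
    by (intro Bochner_Integration.integral_cong refl) (simp add: exp_add[symmetric] algebra_simps)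
  finally show ?thesis by (simp add: cfourier_def)
qed

lemma cfourier_dilate: "0 < c \<Longrightarrow> cfourier (\<lambda>x. \<psi> (c * x)) \<xi> = cfourier \<psi> (\<xi> / c) / c"
  unfolding cfourier_def
  by (subst lborel_integral_real_affine[where c = "1 / c" and t = 0])
     (auto simp: scaleR_conv_of_real divide_simps mult_ac)

text \<open>For \<open>\<bar>x\<bar> < 1\<close> and \<open>\<bar>\<xi>\<bar> \<le> 1\<close> the
  phase stays below 1, hence below half of pi, so the cosine is positive on the support of the bump
  and the real part of the transform cannot vanish.\<close>

lemma cfourier_bump_nonzero: assumes "\<bar>\<xi>\<bar> \<le> 1" shows "cfourier bump \<xi> \<noteq> 0"
proof
  assume "cfourier bump \<xi> = 0"
  have [measurable]: "bump \<in> borel_measurable borel" by (rule test_fun_measurable[OF test_fun_bump])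
  have i: "integrable lborel (\<lambda>x. bump x * cos (x * \<xi>))"
    by (rule integrable_mult_bounded[OF test_fun_integrable[OF test_fun_bump], of _ 1]) auto
  have pos: "0 < bump x * cos (x * \<xi>)" if "\<bar>x\<bar> < 1" for x
  proof -
    have "\<bar>x * \<xi>\<bar> \<le> 1 * 1" unfolding abs_mult by (rule mult_mono) (use that assms in auto)
    then have "0 < cos (x * \<xi>)" using pi_gt3 by (intro cos_gt_zero_pi) auto
    then show ?thesis using bump_pos[OF that] by simp
  qed
  have nn: "0 \<le> bump x * cos (x * \<xi>)" for x
    using pos[of x] bump_eq_0[of x] by (cases "\<bar>x\<bar> < 1") auto
  have "(LINT x|lborel. bump x * cos (x * \<xi>)) = (LINT x|lborel. Re (complex_of_real (bump x) * iexp (x * \<xi>)))"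
    by (intro Bochner_Integration.integral_cong refl) (simp add: Re_exp)
  also have "\<dots> = Re (cfourier bump \<xi>)"
    unfolding cfourier_def by (rule integral_Re[OF cfourier_integrand[OF test_fun_bump]])
  finally have "(LINT x|lborel. bump x * cos (x * \<xi>)) = 0" using \<open>cfourier bump \<xi> = 0\<close> by simp
  then have "AE x in lborel. bump x * cos (x * \<xi>) = 0"
    using integral_nonneg_eq_0_iff_AE[OF i] nn by simp
  then have "AE x in lborel. x \<notin> {-1<..<1::real}"
  proof eventually_elim
    case (elim x)
    then show ?case using pos[of x] by (metis abs_less_iff greaterThanLessThan_iff less_irrefl minus_less_iff)
  qed
  then have "{-1<..<1::real} \<in> null_sets lborel" by (simp add: AE_iff_null_sets)
  then show False by (simp add: null_sets_def)
qed

text \<open>Translating \<open>\<psi>\<close> multiplies its transform by a character, so the integrable function \<open>h * cfourier \<psi>\<close>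
  has vanishing Fourier integrals. At any given frequency, the transform of a suitable dilate of the bump is non-zero.\<close>

lemma AE_0_if_orthogonal_cfourier:
  assumes h: "L2c h" and 0: "\<And>\<psi>. test_fun \<psi> \<Longrightarrow> (LINT \<xi>|lborel. h \<xi> * cfourier \<psi> \<xi>) = 0"
  shows "AE \<xi> in lborel. h \<xi> = 0"
proof -
  have "AE \<xi> in lborel. h \<xi> * cfourier (\<lambda>x. bump (real (Suc n) * x)) \<xi> = 0" for n
  proof -
    define \<psi> where "\<psi> = (\<lambda>x. bump (real (Suc n) * x))"
    have t: "test_fun \<psi>" using test_fun_affine[OF test_fun_bump, of "real (Suc n)" 0] by (simp add: \<psi>_def)
    have "AE \<xi> in lborel. h \<xi> * cfourier \<psi> \<xi> = 0"
    proof (rule AE_0_if_fourier_integrals_0[OF L2c_mult_integrable[OF h L2c_cfourier[OF t]]])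
      fix y
      have "test_fun (\<lambda>x. \<psi> (x - y))" using test_fun_affine[OF t, of 1 "- y"] by simp
      from 0[OF this] show "(LINT \<xi>|lborel. h \<xi> * cfourier \<psi> \<xi> * iexp (y * \<xi>)) = 0"
        by (simp add: cfourier_translate mult_ac)
    qed
    then show ?thesis by (simp add: \<psi>_def)
  qed
  then have "AE \<xi> in lborel. \<forall>n. h \<xi> * cfourier (\<lambda>x. bump (real (Suc n) * x)) \<xi> = 0"
    unfolding AE_all_countable by blast
  then show ?thesis
  proof eventually_elim
    case (elim \<xi>)
    obtain n where "\<bar>\<xi>\<bar> < real n" using reals_Archimedean2 by blast
    then have "cfourier bump (\<xi> / real (Suc n)) \<noteq> 0" by (intro cfourier_bump_nonzero) simp
    then have "cfourier (\<lambda>x. bump (real (Suc n) * x)) \<xi> \<noteq> 0"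
      by (subst cfourier_dilate) (simp_all del: of_nat_Suc)
    with elim show ?case by (metis mult_eq_0_iff)
  qed
qed

lemma fourier_L2_iff: "fourier_L2 f g \<longleftrightarrow> L2 f \<and> L2c g \<and>
   (\<forall>\<psi>. test_fun \<psi> \<longrightarrow> complex_of_real (LINT x|lborel. f x * \<psi> x)
      = (LINT \<xi>|lborel. g \<xi> * cfourier \<psi> \<xi>) / complex_of_real (2 * pi))"
  by (simp add: fourier_L2_def L2c_def cnj_fourier)

lemma test_fun_L2: assumes "test_fun \<psi>" shows "L2 \<psi>"
proof -
  obtain B where "\<And>x. \<bar>\<psi> x\<bar> \<le> B" using test_fun_bounded[OF assms] by metis
  then have "integrable lborel (\<lambda>x. \<psi> x * \<psi> x)"
    by (intro integrable_mult_bounded[where B = B] test_fun_integrable[OF assms])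
       (use assms in \<open>auto dest: test_fun_measurable\<close>)
  then show ?thesis using assms by (simp add: L2_def power2_eq_square test_fun_measurable)
qed

lemma fourier_L2_unique:
  assumes "fourier_L2 f g" "fourier_L2 f g'" shows "AE \<xi> in lborel. g \<xi> = g' \<xi>"
proof -
  have g: "L2c g" "L2c g'" using assms by (auto simp: fourier_L2_iff)
  have "AE \<xi> in lborel. g \<xi> - g' \<xi> = 0"
  proof (rule AE_0_if_orthogonal_cfourier[OF L2c_diff[OF g]])
    fix \<psi> assume t: "test_fun \<psi>"
    have "(LINT \<xi>|lborel. g \<xi> * cfourier \<psi> \<xi>) = (LINT \<xi>|lborel. g' \<xi> * cfourier \<psi> \<xi>)"
      using assms t by (simp add: fourier_L2_iff)
    then show "(LINT \<xi>|lborel. (g \<xi> - g' \<xi>) * cfourier \<psi> \<xi>) = 0"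
      unfolding left_diff_distrib
      by (subst Bochner_Integration.integral_diff) (auto intro!: L2c_mult_integrable g L2c_cfourier t)
  qed
  then show ?thesis by simp
qed

text \<open>Needed because solutions attain their initial datum only almost everywhere.\<close>

lemma fourier_L2_cong:
  assumes "fourier_L2 f g" "L2 f'" "L2c g'" "AE x in lborel. f x = f' x" "AE \<xi> in lborel. g \<xi> = g' \<xi>"
  shows "fourier_L2 f' g'"
  unfolding fourier_L2_iff
proof (intro conjI assms allI impI)
  fix \<psi> assume t: "test_fun \<psi>"
  have [measurable]: "f \<in> borel_measurable borel" "f' \<in> borel_measurable borel" "g \<in> borel_measurable borel"
    "g' \<in> borel_measurable borel" "\<psi> \<in> borel_measurable borel" "cfourier \<psi> \<in> borel_measurable borel"
    using assms t by (auto simp: fourier_L2_iff L2_def L2c_def test_fun_measurable cfourier_measurable)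
  have "(LINT x|lborel. f x * \<psi> x) = (LINT x|lborel. f' x * \<psi> x)"
    by (rule integral_cong_AE) (use assms(4) in \<open>auto elim!: eventually_mono\<close>)
  moreover have "(LINT \<xi>|lborel. g \<xi> * cfourier \<psi> \<xi>) = (LINT \<xi>|lborel. g' \<xi> * cfourier \<psi> \<xi>)"
    by (rule integral_cong_AE) (use assms(5) in \<open>auto elim!: eventually_mono\<close>)
  ultimately show "complex_of_real (LINT x|lborel. f' x * \<psi> x) = (LINT \<xi>|lborel. g' \<xi> * cfourier \<psi> \<xi>) / complex_of_real (2 * pi)"
    using assms(1) t unfolding fourier_L2_iff by metis
qed

lemma L2_add_cmult: assumes "L2 f" "L2 g" shows "L2 (\<lambda>x. f x + c * g x)"
  unfolding L2_def
proof (rule conjI)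
  show m: "(\<lambda>x. f x + c * g x) \<in> borel_measurable lborel" using assms by (auto simp: L2_def)
  have "integrable lborel (\<lambda>x. 2 * (f x)\<^sup>2 + 2 * (c\<^sup>2 * (g x)\<^sup>2))" using assms by (auto simp: L2_def)
  then show "integrable lborel (\<lambda>x. (f x + c * g x)\<^sup>2)"
  proof (rule integrable_dominated)
    show "norm ((f x + c * g x)\<^sup>2) \<le> 2 * (f x)\<^sup>2 + 2 * (c\<^sup>2 * (g x)\<^sup>2)" for x
      using norm_add_square_le[of "f x" "c * g x"] by (simp add: power_mult_distrib)
  qed (use m in auto)
qed

lemma fourier_L2_add_cmult:
  assumes "fourier_L2 f1 g1" "fourier_L2 f2 g2"
  shows "fourier_L2 (\<lambda>x. f1 x + c * f2 x) (\<lambda>\<xi>. g1 \<xi> + complex_of_real c * g2 \<xi>)"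
  unfolding fourier_L2_iff
proof (intro conjI allI impI)
  have f: "L2 f1" "L2 f2" and g: "L2c g1" "L2c g2" using assms by (auto simp: fourier_L2_iff)
  show "L2 (\<lambda>x. f1 x + c * f2 x)" by (rule L2_add_cmult[OF f])
  show "L2c (\<lambda>\<xi>. g1 \<xi> + complex_of_real c * g2 \<xi>)" by (intro L2c_add L2c_cmult g)
  fix \<psi> assume t: "test_fun \<psi>"
  have 1: "(LINT x|lborel. (f1 x + c * f2 x) * \<psi> x) = (LINT x|lborel. f1 x * \<psi> x) + c * (LINT x|lborel. f2 x * \<psi> x)"
    unfolding distrib_right mult.assoc integral_mult_right_zero[symmetric]
    by (rule Bochner_Integration.integral_add) (intro integrable_mult_right L2_mult_integrable f test_fun_L2 t)+
  have 2: "(LINT \<xi>|lborel. (g1 \<xi> + complex_of_real c * g2 \<xi>) * cfourier \<psi> \<xi>)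
     = (LINT \<xi>|lborel. g1 \<xi> * cfourier \<psi> \<xi>) + complex_of_real c * (LINT \<xi>|lborel. g2 \<xi> * cfourier \<psi> \<xi>)"
    unfolding distrib_right mult.assoc integral_mult_right_zero[symmetric]
    by (rule Bochner_Integration.integral_add) (intro integrable_mult_right L2c_mult_integrable g L2c_cfourier t)+
  show "complex_of_real (LINT x|lborel. (f1 x + c * f2 x) * \<psi> x) =
         (LINT \<xi>|lborel. (g1 \<xi> + complex_of_real c * g2 \<xi>) * cfourier \<psi> \<xi>) / complex_of_real (2 * pi)"
    unfolding 2 using assms t by (simp add: 1 fourier_L2_iff add_divide_distrib)
qed

lemma fourier_L2_diff:
  "fourier_L2 f1 g1 \<Longrightarrow> fourier_L2 f2 g2 \<Longrightarrow> fourier_L2 (\<lambda>x. f1 x - f2 x) (\<lambda>\<xi>. g1 \<xi> - g2 \<xi>)"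
  using fourier_L2_add_cmult[of f1 g1 f2 g2 "-1"] by simp

lemma fourier_L2_cmult:
  assumes "fourier_L2 f g" shows "fourier_L2 (\<lambda>x. c * f x) (\<lambda>\<xi>. complex_of_real c * g \<xi>)"
  using fourier_L2_add_cmult[OF fourier_L2_diff[OF assms assms] assms, of c] by simp

text \<open>Since \<open>f\<close> is real, the reflected conjugate of a transform is a transform as
  well. The average of the two is Hermitian at every frequency, not merely at almost every
  one.\<close>

lemma fourier_L2_hermitian:
  assumes "fourier_L2 f g" shows "fourier_L2 f (\<lambda>\<xi>. (g \<xi> + cnj (g (- \<xi>))) / 2)"
proof -
  have g: "L2c g" and f: "L2 f" using assms by (auto simp: fourier_L2_iff)
  have gm: "L2c (\<lambda>\<xi>. cnj (g (- \<xi>)))"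
    using L2c_cnj[of "\<lambda>\<xi>. g (- \<xi>)"] g measurable_compose[OF borel_measurable_uminus[OF measurable_ident_sets[OF refl]], of g borel] lborel_integrable_real_affine[of "\<lambda>\<xi>. (cmod (g \<xi>))\<^sup>2" "-1" 0]
    by (simp add: L2c_def)
  have "fourier_L2 f (\<lambda>\<xi>. cnj (g (- \<xi>)))"
    unfolding fourier_L2_iff
  proof (intro conjI f gm allI impI)
    fix \<psi> assume t: "test_fun \<psi>"
    have "(LINT \<xi>|lborel. cnj (g (- \<xi>)) * cfourier \<psi> \<xi>) = (LINT \<xi>|lborel. cnj (g (- \<xi>) * cfourier \<psi> (- \<xi>)))"
      by (intro Bochner_Integration.integral_cong refl) (simp add: cfourier_uminus)
    also have "\<dots> = cnj (LINT \<xi>|lborel. g (- \<xi>) * cfourier \<psi> (- \<xi>))" by (rule Bochner_Integration.integral_cnj)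
    also have "(LINT \<xi>|lborel. g (- \<xi>) * cfourier \<psi> (- \<xi>)) = (LINT \<xi>|lborel. g \<xi> * cfourier \<psi> \<xi>)"
      by (subst (2) lborel_integral_real_affine[where c = "-1" and t = 0]) auto
    also have "\<dots> = complex_of_real (2 * pi) * complex_of_real (LINT x|lborel. f x * \<psi> x)"
      using assms t by (simp add: fourier_L2_iff)
    finally show "complex_of_real (LINT x|lborel. f x * \<psi> x)
      = (LINT \<xi>|lborel. cnj (g (- \<xi>)) * cfourier \<psi> \<xi>) / complex_of_real (2 * pi)" by simp
  qed
  from fourier_L2_add_cmult[OF assms fourier_L2_diff[OF this assms], of "1/2"]
  have *: "fourier_L2 (\<lambda>x. f x + 1/2 * (f x - f x)) (\<lambda>\<xi>. g \<xi> + complex_of_real (1/2) * (cnj (g (- \<xi>)) - g \<xi>))" .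
  have **: "(\<lambda>\<xi>. g \<xi> + complex_of_real (1/2) * (cnj (g (- \<xi>)) - g \<xi>)) = (\<lambda>\<xi>. (g \<xi> + cnj (g (- \<xi>))) / 2)"
    by (auto simp: field_simps)
  show ?thesis using * unfolding ** by simp
qed

text \<open>On the test function the derivatives produce the n-th power of
  \<open>- \<i> * \<xi>\<close>, and the sign in the definition of the weak derivative turns it into
  the power of \<open>\<i> * \<xi>\<close>.\<close>

lemma fourier_L2_weak_deriv:
  assumes f: "fourier_L2 f g" and w: "weak_deriv n f h" and L: "L2c (\<lambda>\<xi>. (\<i> * complex_of_real \<xi>) ^ n * g \<xi>)"
  shows "fourier_L2 h (\<lambda>\<xi>. (\<i> * complex_of_real \<xi>) ^ n * g \<xi>)"
  unfolding fourier_L2_iff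
proof (intro conjI L allI impI)
  show "L2 h" using w by (simp add: weak_deriv_def)
  fix \<psi> assume t: "test_fun \<psi>"
  have "complex_of_real (LINT x|lborel. h x * \<psi> x) = (-1) ^ n * complex_of_real (LINT x|lborel. f x * (deriv ^^ n) \<psi> x)"
  proof -
    have "(LINT x|lborel. f x * (deriv ^^ n) \<psi> x) = (-1) ^ n * (LINT x|lborel. h x * \<psi> x)"
      using w t by (simp add: weak_deriv_def)
    then have "(LINT x|lborel. h x * \<psi> x) = (-1) ^ n * (LINT x|lborel. f x * (deriv ^^ n) \<psi> x)"
      by (simp add: power_mult_distrib[symmetric] flip: mult.assoc)
    then show ?thesis by simp
  qed
  also have "\<dots> = (LINT \<xi>|lborel. (-1) ^ n * (g \<xi> * cfourier ((deriv ^^ n) \<psi>) \<xi>)) / complex_of_real (2 * pi)"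
    using f test_fun_deriv_pow[OF t, of n] by (simp add: fourier_L2_iff)
  also have "(\<lambda>\<xi>. (-1) ^ n * (g \<xi> * cfourier ((deriv ^^ n) \<psi>) \<xi>)) = (\<lambda>\<xi>. (\<i> * complex_of_real \<xi>) ^ n * g \<xi> * cfourier \<psi> \<xi>)"
  proof
    fix \<xi>
    have "(-1) ^ n * (- \<i> * complex_of_real \<xi>) ^ n = (\<i> * complex_of_real \<xi>) ^ n"
      by (simp flip: power_mult_distrib)
    then show "(-1) ^ n * (g \<xi> * cfourier ((deriv ^^ n) \<psi>) \<xi>) = (\<i> * complex_of_real \<xi>) ^ n * g \<xi> * cfourier \<psi> \<xi>"
      unfolding cfourier_deriv_pow[OF t] by (metis (no_types, opaque_lifting) mult.assoc mult.commute)
  qed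
  finally show "complex_of_real (LINT x|lborel. h x * \<psi> x)
     = (LINT \<xi>|lborel. (\<i> * complex_of_real \<xi>) ^ n * g \<xi> * cfourier \<psi> \<xi>) / complex_of_real (2 * pi)" .
qed

text \<open>This removes the choice operator from \<open>hs_norm\<close>: two transforms of one
  function agree almost everywhere, so any convenient one may be used.\<close>

lemma hs_norm_eq:
  assumes "fourier_L2 f g"
  shows "hs_norm s f = sqrt (LINT \<xi>|lborel. (1 + \<xi>\<^sup>2) powr s * (cmod (g \<xi>))\<^sup>2)"
proof -
  define g' where "g' = (SOME g. fourier_L2 f g)"
  have g': "fourier_L2 f g'" unfolding g'_def by (rule someI[of _ g]) (rule assms)
  have [measurable]: "g \<in> borel_measurable borel" "g' \<in> borel_measurable borel"
    using assms g' by (auto simp: fourier_L2_iff L2c_def)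
  have "(LINT \<xi>|lborel. (1 + \<xi>\<^sup>2) powr s * (cmod (g' \<xi>))\<^sup>2) = (LINT \<xi>|lborel. (1 + \<xi>\<^sup>2) powr s * (cmod (g \<xi>))\<^sup>2)"
    by (rule integral_cong_AE) (use fourier_L2_unique[OF g' assms] in \<open>auto elim!: eventually_mono\<close>)
  then show ?thesis by (simp add: hs_norm_def g'_def)
qed

lemma in_Hs_integrable:
  assumes "fourier_L2 f g" "in_Hs s f"
  shows "integrable lborel (\<lambda>\<xi>. (1 + \<xi>\<^sup>2) powr s * (cmod (g \<xi>))\<^sup>2)"
proof -
  obtain g' where g': "fourier_L2 f g'" and i: "integrable lborel (\<lambda>\<xi>. (1 + \<xi>\<^sup>2) powr s * (cmod (g' \<xi>))\<^sup>2)"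
    using assms(2) unfolding in_Hs_def by blast
  have [measurable]: "g \<in> borel_measurable borel" "g' \<in> borel_measurable borel"
    using assms g' by (auto simp: fourier_L2_iff L2c_def)
  show ?thesis
    by (rule integrable_cong_AE_imp[OF i]) (use fourier_L2_unique[OF g' assms(1)] in \<open>auto elim!: eventually_mono\<close>)
qed

section \<open>Convolution and the equation on the Fourier side\<close>

text \<open>This lemma and the two similar ones below treat functions of two among the three
  variables \<open>x\<close>, \<open>y\<close> and \<open>x - y\<close>. Each pair is a change of
  variables with unit Jacobian, so the double integral always factorises.\<close>

lemma pair_integrable_prod:
  fixes f g :: "real \<Rightarrow> 'a::{real_normed_field, banach, second_countable_topology}"
  assumes f: "integrable lborel f" and g: "integrable lborel g"
  shows "integrable (lborel \<Otimes>\<^sub>M lborel) (\<lambda>(x, y). f x * g y)"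
    and "integral\<^sup>L (lborel \<Otimes>\<^sub>M lborel) (\<lambda>(x, y). f x * g y) = (LINT x|lborel. f x) * (LINT y|lborel. g y)"
proof -
  have [measurable]: "f \<in> borel_measurable borel" "g \<in> borel_measurable borel" using f g by auto
  show *: "integrable (lborel \<Otimes>\<^sub>M lborel) (\<lambda>(x, y). f x * g y)"
  proof (rule lborel_pair.Fubini_integrable)
    show "integrable lborel (\<lambda>x. LINT y|lborel. norm (case (x, y) of (x, y) \<Rightarrow> f x * g y))"
      using f by (simp add: norm_mult)
  qed (use g in auto)
  show "integral\<^sup>L (lborel \<Otimes>\<^sub>M lborel) (\<lambda>(x, y). f x * g y) = (LINT x|lborel. f x) * (LINT y|lborel. g y)"
    using lborel_pair.integral_fst'[OF *] by simp
qed

lemma integrable_shift: "integrable lborel f \<Longrightarrow> integrable lborel (\<lambda>x. f (x - t))"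
  and integrable_reflect: "integrable lborel f \<Longrightarrow> integrable lborel (\<lambda>x. f (t - x))"
  for f :: "real \<Rightarrow> 'a::{banach, second_countable_topology}"
  using lborel_integrable_real_affine[of f 1 "- t"] lborel_integrable_real_affine[of f "- 1" t] by simp_all

lemma integral_shift: "(LINT x|lborel. f (x - t)) = (LINT x|lborel. f x)"
  and integral_reflect: "(LINT x|lborel. f (t - x)) = (LINT x|lborel. f x)"
  for f :: "real \<Rightarrow> 'a::{banach, second_countable_topology}"
  using lborel_integral_real_affine[of 1 f "- t"] lborel_integral_real_affine[of "- 1" f t] by simp_all

lemma pair_integrable_conv:
  fixes f g :: "real \<Rightarrow> 'a::{real_normed_field, banach, second_countable_topology}"
  assumes f: "integrable lborel f" and g: "integrable lborel g"
  shows "integrable (lborel \<Otimes>\<^sub>M lborel) (\<lambda>(x, y). f (x - y) * g y)"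
    and "integral\<^sup>L (lborel \<Otimes>\<^sub>M lborel) (\<lambda>(x, y). f (x - y) * g y) = (LINT x|lborel. f x) * (LINT y|lborel. g y)"
proof -
  have [measurable]: "f \<in> borel_measurable borel" "g \<in> borel_measurable borel" using f g by auto
  have *: "integrable (lborel \<Otimes>\<^sub>M lborel) (\<lambda>(y, x). f (x - y) * g y)"
  proof (rule lborel_pair.Fubini_integrable)
    show "integrable lborel (\<lambda>y. LINT x|lborel. norm (case (y, x) of (y, x) \<Rightarrow> f (x - y) * g y))"
      using g by (simp add: norm_mult integral_shift[of "\<lambda>x. norm (f x)"])
  qed (use f in \<open>auto intro!: integrable_shift\<close>)
  show "integrable (lborel \<Otimes>\<^sub>M lborel) (\<lambda>(x, y). f (x - y) * g y)"
    using lborel_pair.integrable_product_swap[OF *] by simp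
  have "integral\<^sup>L (lborel \<Otimes>\<^sub>M lborel) (\<lambda>(x, y). f (x - y) * g y) = integral\<^sup>L (lborel \<Otimes>\<^sub>M lborel) (\<lambda>(y, x). f (x - y) * g y)"
    using lborel_pair.integral_product_swap[of "\<lambda>(y, x). f (x - y) * g y"] by simp
  also have "\<dots> = (LINT x|lborel. f x) * (LINT y|lborel. g y)"
    using lborel_pair.integral_fst'[OF *] by (simp add: integral_shift)
  finally show "integral\<^sup>L (lborel \<Otimes>\<^sub>M lborel) (\<lambda>(x, y). f (x - y) * g y) = (LINT x|lborel. f x) * (LINT y|lborel. g y)" .
qed

lemma pair_integrable_reflect:
  fixes f g :: "real \<Rightarrow> 'a::{real_normed_field, banach, second_countable_topology}"
  assumes f: "integrable lborel f" and g: "integrable lborel g"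
  shows "integrable (lborel \<Otimes>\<^sub>M lborel) (\<lambda>(x, y). f (x - y) * g x)"
    and "integral\<^sup>L (lborel \<Otimes>\<^sub>M lborel) (\<lambda>(x, y). f (x - y) * g x) = (LINT x|lborel. f x) * (LINT y|lborel. g y)"
proof -
  have [measurable]: "f \<in> borel_measurable borel" "g \<in> borel_measurable borel" using f g by auto
  show *: "integrable (lborel \<Otimes>\<^sub>M lborel) (\<lambda>(x, y). f (x - y) * g x)"
  proof (rule lborel_pair.Fubini_integrable)
    show "integrable lborel (\<lambda>x. LINT y|lborel. norm (case (x, y) of (x, y) \<Rightarrow> f (x - y) * g x))"
      using g by (simp add: norm_mult integral_reflect[of "\<lambda>x. norm (f x)"])
  qed (use f in \<open>auto intro!: integrable_reflect\<close>)
  show "integral\<^sup>L (lborel \<Otimes>\<^sub>M lborel) (\<lambda>(x, y). f (x - y) * g x) = (LINT x|lborel. f x) * (LINT y|lborel. g y)"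
    using lborel_pair.integral_fst'[OF *] by (simp add: integral_reflect)
qed

definition conv :: "(real \<Rightarrow> complex) \<Rightarrow> (real \<Rightarrow> complex) \<Rightarrow> real \<Rightarrow> complex" where
  "conv a b \<xi> = (LINT \<eta>|lborel. a (\<xi> - \<eta>) * b \<eta>)"

lemma conv_measurable[measurable (raw)]:
  assumes [measurable]: "a \<in> borel_measurable borel" "b \<in> borel_measurable borel"
  shows "conv a b \<in> borel_measurable borel"
  unfolding conv_def[abs_def] by measurable

lemma conv_commute: "conv a b = conv b a"
proof
  fix \<xi>
  show "conv a b \<xi> = conv b a \<xi>"
    unfolding conv_def using integral_reflect[of "\<lambda>\<eta>. b (\<xi> - \<eta>) * a \<eta>" \<xi>] by (simp add: mult.commute)
qed

lemma conv_integrable: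
  assumes "integrable lborel a" "integrable lborel b" shows "integrable lborel (conv a b)"
  using lborel_pair.integrable_fst'[OF pair_integrable_conv(1)[OF assms]] by (simp add: conv_def[abs_def])

lemma L2c_reflect: assumes "L2c f" shows "L2c (\<lambda>x. f (t - x))"
proof -
  have [measurable]: "f \<in> borel_measurable borel" using assms by (simp add: L2c_def)
  show ?thesis using assms integrable_reflect[of "\<lambda>x. (cmod (f x))\<^sup>2" t] by (simp add: L2c_def)
qed

lemma conv_integrand: "L2c a \<Longrightarrow> L2c b \<Longrightarrow> integrable lborel (\<lambda>\<eta>. a (\<xi> - \<eta>) * b \<eta>)"
  by (rule L2c_mult_integrable[OF L2c_reflect])

lemma conv_diff_right: "L2c a \<Longrightarrow> L2c b \<Longrightarrow> L2c c \<Longrightarrow> conv a (\<lambda>\<eta>. b \<eta> - c \<eta>) \<xi> = conv a b \<xi> - conv a c \<xi>"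
  unfolding conv_def right_diff_distrib
  by (rule Bochner_Integration.integral_diff) (auto intro: conv_integrand)

lemma conv_diff_left: "L2c a \<Longrightarrow> L2c b \<Longrightarrow> L2c c \<Longrightarrow> conv (\<lambda>\<eta>. a \<eta> - b \<eta>) c \<xi> = conv a c \<xi> - conv b c \<xi>"
  using conv_diff_right[of c a b \<xi>] by (simp add: conv_commute[of _ c])

lemma integral_Cauchy_Schwarz:
  fixes f g :: "'a \<Rightarrow> real"
  assumes [measurable]: "f \<in> borel_measurable M" "g \<in> borel_measurable M"
    and f: "integrable M (\<lambda>x. (f x)\<^sup>2)" and g: "integrable M (\<lambda>x. (g x)\<^sup>2)"
  shows "integrable M (\<lambda>x. f x * g x)"
    and "(LINT x|M. f x * g x)\<^sup>2 \<le> (LINT x|M. (f x)\<^sup>2) * (LINT x|M. (g x)\<^sup>2)"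
proof -
  show fg: "integrable M (\<lambda>x. f x * g x)"
  proof (rule integrable_dominated)
    show "integrable M (\<lambda>x. (f x)\<^sup>2 + (g x)\<^sup>2)" using f g by auto
    show "norm (f x * g x) \<le> (f x)\<^sup>2 + (g x)\<^sup>2" for x
      using mult_le_square_add[of "\<bar>f x\<bar>" "\<bar>g x\<bar>"] by (simp add: abs_mult)
  qed simp
  define P where "P = (LINT x|M. f x * g x)"
  define F where "F = (LINT x|M. (f x)\<^sup>2)"
  define G where "G = (LINT x|M. (g x)\<^sup>2)"
  have q: "0 \<le> F - 2 * t * P + t\<^sup>2 * G" for t
  proof -
    have "0 \<le> (LINT x|M. (f x - t * g x)\<^sup>2)" by simp
    also have "\<dots> = (LINT x|M. (f x)\<^sup>2 - 2 * t * (f x * g x) + t\<^sup>2 * (g x)\<^sup>2)"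
      by (intro Bochner_Integration.integral_cong refl) (simp add: power2_eq_square algebra_simps)
    also have "\<dots> = F - 2 * t * P + t\<^sup>2 * G"
      using f g fg by (simp add: F_def P_def G_def)
    finally show ?thesis .
  qed
  have G0: "0 \<le> G" unfolding G_def by simp
  show "P\<^sup>2 \<le> F * G"
  proof (cases "G = 0")
    case True
    then have "AE x in M. (g x)\<^sup>2 = 0" using integral_nonneg_eq_0_iff_AE[OF g] unfolding G_def by simp
    then have "P = (LINT x|M. 0)" unfolding P_def by (intro integral_cong_AE) auto
    then show ?thesis using True by simp
  next
    case False
    \<comment> \<open>The nonnegative quadratic in \<open>t\<close> is evaluated at its
      minimiser.\<close>
    with q[of "P / G"] G0 show ?thesis by (simp add: field_simps power2_eq_square)
  qed
qed

text \<open>Young's inequality for \<open>L^1\<close> against \<open>L^2\<close>. Splitting the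
  modulus of \<open>a\<close> into two square roots, Cauchy-Schwarz in the inner variable leaves one
  full factor of \<open>a\<close> with the square of \<open>b\<close>, and Fubini integrates
  it.\<close>

lemma L2c_conv:
  assumes a: "integrable lborel a" and b: "L2c b"
  shows "L2c (conv a b)"
    and "(LINT \<xi>|lborel. (cmod (conv a b \<xi>))\<^sup>2) \<le> (LINT \<xi>|lborel. cmod (a \<xi>))\<^sup>2 * (LINT \<xi>|lborel. (cmod (b \<xi>))\<^sup>2)"
proof -
  have [measurable]: "a \<in> borel_measurable borel" "b \<in> borel_measurable borel" using a b by (auto simp: L2c_def)
  define A where "A = (LINT \<xi>|lborel. cmod (a \<xi>))"
  have A0: "0 \<le> A" unfolding A_def by simp
  have ia: "integrable lborel (\<lambda>\<xi>. cmod (a \<xi>))" and ib: "integrable lborel (\<lambda>\<xi>. (cmod (b \<xi>))\<^sup>2)" using a b by (auto simp: L2c_def)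
  note p = pair_integrable_conv[OF ia ib]
  have bd: "AE \<xi> in lborel. (cmod (conv a b \<xi>))\<^sup>2 \<le> A * (LINT \<eta>|lborel. cmod (a (\<xi> - \<eta>)) * (cmod (b \<eta>))\<^sup>2)"
    using lborel_pair.AE_integrable_fst'[OF p(1)]
  proof eventually_elim
    case (elim \<xi>)
    then have i: "integrable lborel (\<lambda>\<eta>. cmod (a (\<xi> - \<eta>)) * (cmod (b \<eta>))\<^sup>2)" by simp
    have "cmod (conv a b \<xi>) \<le> (LINT \<eta>|lborel. sqrt (cmod (a (\<xi> - \<eta>))) * (sqrt (cmod (a (\<xi> - \<eta>))) * cmod (b \<eta>)))"
      unfolding conv_def by (rule order_trans[OF integral_norm_bound]) (simp add: norm_mult flip: mult.assoc)
    then have "(cmod (conv a b \<xi>))\<^sup>2 \<le> (LINT \<eta>|lborel. sqrt (cmod (a (\<xi> - \<eta>))) * (sqrt (cmod (a (\<xi> - \<eta>))) * cmod (b \<eta>)))\<^sup>2"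
      by (intro power_mono) auto
    also have "\<dots> \<le> (LINT \<eta>|lborel. (sqrt (cmod (a (\<xi> - \<eta>))))\<^sup>2) * (LINT \<eta>|lborel. (sqrt (cmod (a (\<xi> - \<eta>))) * cmod (b \<eta>))\<^sup>2)"
      by (rule integral_Cauchy_Schwarz) (use i integrable_reflect[OF ia] in \<open>auto simp: power_mult_distrib\<close>)
    also have "\<dots> = A * (LINT \<eta>|lborel. cmod (a (\<xi> - \<eta>)) * (cmod (b \<eta>))\<^sup>2)"
      by (simp add: power_mult_distrib A_def integral_reflect[of "\<lambda>x. cmod (a x)"])
    finally show ?case .
  qed
  have i2: "integrable lborel (\<lambda>\<xi>. A * (LINT \<eta>|lborel. cmod (a (\<xi> - \<eta>)) * (cmod (b \<eta>))\<^sup>2))"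
    using lborel_pair.integrable_fst'[OF p(1)] by simp
  have ic: "integrable lborel (\<lambda>\<xi>. (cmod (conv a b \<xi>))\<^sup>2)"
    by (rule Bochner_Integration.integrable_bound[OF i2]) (use bd in \<open>auto elim!: eventually_mono\<close>)
  then show "L2c (conv a b)" by (simp add: L2c_def)
  have "(LINT \<xi>|lborel. (cmod (conv a b \<xi>))\<^sup>2) \<le> (LINT \<xi>|lborel. A * (LINT \<eta>|lborel. cmod (a (\<xi> - \<eta>)) * (cmod (b \<eta>))\<^sup>2))"
    by (rule integral_mono_AE[OF ic i2 bd])
  also have "\<dots> = A * (A * (LINT \<xi>|lborel. (cmod (b \<xi>))\<^sup>2))"
    using lborel_pair.integral_fst'[OF p(1)] p(2) by (simp add: A_def)
  finally show "(LINT \<xi>|lborel. (cmod (conv a b \<xi>))\<^sup>2) \<le> (LINT \<xi>|lborel. cmod (a \<xi>))\<^sup>2 * (LINT \<xi>|lborel. (cmod (b \<xi>))\<^sup>2)"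
    by (simp add: A_def power2_eq_square mult.assoc)
qed

section \<open>Inverse transforms and the transform of the equation\<close>

definition inv_fourier :: "(real \<Rightarrow> complex) \<Rightarrow> real \<Rightarrow> complex" where
  "inv_fourier g x = (LINT \<xi>|lborel. g \<xi> * iexp (x * \<xi>)) / complex_of_real (2 * pi)"

lemma inv_fourier_measurable[measurable (raw)]:
  assumes [measurable]: "g \<in> borel_measurable borel" shows "inv_fourier g \<in> borel_measurable borel"
  unfolding inv_fourier_def[abs_def] by measurable

lemma inv_fourier_bounded: "cmod (inv_fourier g x) \<le> (LINT \<xi>|lborel. cmod (g \<xi>)) / (2 * pi)"
proof -
  have "cmod (LINT \<xi>|lborel. g \<xi> * iexp (x * \<xi>)) \<le> (LINT \<xi>|lborel. cmod (g \<xi>))"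
    by (rule order_trans[OF integral_norm_bound]) (simp add: norm_mult)
  then show ?thesis by (simp add: inv_fourier_def norm_divide divide_right_mono)
qed

lemma inv_fourier_parseval:
  assumes g: "integrable lborel g" and t: "test_fun \<psi>"
  shows "(LINT x|lborel. inv_fourier g x * complex_of_real (\<psi> x)) = (LINT \<xi>|lborel. g \<xi> * cfourier \<psi> \<xi>) / complex_of_real (2 * pi)"
proof -
  have [measurable]: "g \<in> borel_measurable borel" "\<psi> \<in> borel_measurable borel" using g t by (auto intro: test_fun_measurable)
  have "integrable lborel (\<lambda>x. complex_of_real (\<psi> x))" by (simp add: test_fun_integrable t)
  note p = pair_integrable_prod(1)[OF this g]
  have "integrable (lborel \<Otimes>\<^sub>M lborel) (\<lambda>(x, \<xi>). (complex_of_real (\<psi> x) * g \<xi>) * iexp (x * \<xi>))"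
    by (rule Bochner_Integration.integrable_bound[OF p]) (auto simp: norm_mult)
  then have "(LINT \<xi>|lborel. LINT x|lborel. (complex_of_real (\<psi> x) * g \<xi>) * iexp (x * \<xi>))
     = (LINT x|lborel. LINT \<xi>|lborel. (complex_of_real (\<psi> x) * g \<xi>) * iexp (x * \<xi>))"
    by (rule lborel_pair.Fubini_integral)
  moreover have "(LINT x|lborel. (complex_of_real (\<psi> x) * g \<xi>) * iexp (x * \<xi>)) = g \<xi> * cfourier \<psi> \<xi>" for \<xi>
    unfolding cfourier_def integral_mult_right_zero[symmetric]
    by (intro Bochner_Integration.integral_cong refl) (simp add: mult_ac)
  moreover have "(LINT \<xi>|lborel. (complex_of_real (\<psi> x) * g \<xi>) * iexp (x * \<xi>)) = complex_of_real (2 * pi) * (inv_fourier g x * complex_of_real (\<psi> x))" for x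
  proof -
    have "(LINT \<xi>|lborel. (complex_of_real (\<psi> x) * g \<xi>) * iexp (x * \<xi>)) = complex_of_real (\<psi> x) * (LINT \<xi>|lborel. g \<xi> * iexp (x * \<xi>))"
      by (simp only: mult.assoc integral_mult_right_zero)
    then show ?thesis by (simp add: inv_fourier_def)
  qed
  ultimately have "(LINT \<xi>|lborel. g \<xi> * cfourier \<psi> \<xi>) = complex_of_real (2 * pi) * (LINT x|lborel. inv_fourier g x * complex_of_real (\<psi> x))"
    by (simp only: integral_mult_right_zero)
  then show ?thesis by simp
qed

text \<open>The convolution theorem on the inverse side, where integrability makes Fubini
  applicable. Of the two factors \<open>1 / (2 * pi)\<close> one belongs to the inverse transform on
  the right, and the other stays with the convolution.\<close>

lemma inv_fourier_mult:
  assumes a: "integrable lborel a" and b: "integrable lborel b"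
  shows "inv_fourier a x * inv_fourier b x = inv_fourier (\<lambda>\<xi>. conv a b \<xi> / complex_of_real (2 * pi)) x"
proof -
  have ab: "integrable lborel (\<lambda>\<xi>. a \<xi> * iexp (x * \<xi>))" "integrable lborel (\<lambda>\<xi>. b \<xi> * iexp (x * \<xi>))"
    by (rule integrable_mult_bounded[where B = 1]; use a b in simp)+
  have e: "iexp (x * (\<xi> - \<eta>)) * iexp (x * \<eta>) = iexp (x * \<xi>)" for \<xi> \<eta>
    by (simp add: exp_add[symmetric] algebra_simps)
  have "(LINT \<xi>|lborel. a \<xi> * iexp (x * \<xi>)) * (LINT \<xi>|lborel. b \<xi> * iexp (x * \<xi>))
     = (LINT \<xi>|lborel. LINT \<eta>|lborel. (a (\<xi> - \<eta>) * iexp (x * (\<xi> - \<eta>))) * (b \<eta> * iexp (x * \<eta>)))"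
    using lborel_pair.integral_fst'[OF pair_integrable_conv(1)[OF ab]] pair_integrable_conv(2)[OF ab] by simp
  also have "\<dots> = (LINT \<xi>|lborel. LINT \<eta>|lborel. (a (\<xi> - \<eta>) * b \<eta>) * iexp (x * \<xi>))"
  proof (intro Bochner_Integration.integral_cong refl)
    fix \<xi> \<eta>
    have "(a (\<xi> - \<eta>) * iexp (x * (\<xi> - \<eta>))) * (b \<eta> * iexp (x * \<eta>)) = (a (\<xi> - \<eta>) * b \<eta>) * (iexp (x * (\<xi> - \<eta>)) * iexp (x * \<eta>))"
      by (simp only: mult_ac)
    then show "(a (\<xi> - \<eta>) * iexp (x * (\<xi> - \<eta>))) * (b \<eta> * iexp (x * \<eta>)) = (a (\<xi> - \<eta>) * b \<eta>) * iexp (x * \<xi>)"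
      unfolding e .
  qed
  also have "\<dots> = (LINT \<xi>|lborel. conv a b \<xi> * iexp (x * \<xi>))"
    by (simp add: conv_def)
  finally show ?thesis by (simp add: inv_fourier_def)
qed

text \<open>Both sides have the same pairing with every test function: Parseval defines it on the
  left, Fubini computes it on the right. The real and imaginary parts then go to
  \<open>fundamental_lemma\<close>.\<close>

lemma fourier_L2_inversion:
  assumes f: "fourier_L2 f g" and g: "integrable lborel g"
  shows "AE x in lborel. complex_of_real (f x) = inv_fourier g x"
proof -
  have [measurable]: "g \<in> borel_measurable borel" "f \<in> borel_measurable borel"
    using g f by (auto simp: fourier_L2_def L2_def)
  have L: "L2 f" using f by (simp add: fourier_L2_def)
  have i: "integrable lborel (\<lambda>x. inv_fourier g x * complex_of_real (\<psi> x))" if "test_fun \<psi>" for \<psi>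
    by (rule integrable_mult_bounded(2)[OF _ _ inv_fourier_bounded]) (use that test_fun_integrable in auto)
  have eq: "(LINT x|lborel. inv_fourier g x * complex_of_real (\<psi> x)) = complex_of_real (LINT x|lborel. f x * \<psi> x)" if "test_fun \<psi>" for \<psi>
    using f that by (simp add: inv_fourier_parseval[OF g that] fourier_L2_iff)
  have re: "integrable lborel (\<lambda>x. Re (inv_fourier g x) * \<psi> x)"
    "(LINT x|lborel. Re (inv_fourier g x) * \<psi> x) = (LINT x|lborel. f x * \<psi> x)" if t: "test_fun \<psi>" for \<psi>
    using integrable_Re[OF i[OF t]] integral_Re[OF i[OF t]] by (simp_all add: eq[OF t])
  have im: "integrable lborel (\<lambda>x. Im (inv_fourier g x) * \<psi> x)"
    "(LINT x|lborel. Im (inv_fourier g x) * \<psi> x) = 0" if t: "test_fun \<psi>" for \<psi>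
    using integrable_Im[OF i[OF t]] integral_Im[OF i[OF t]] by (simp_all add: eq[OF t])
  have fi: "integrable lborel (\<lambda>x. f x * \<psi> x)" if t: "test_fun \<psi>" for \<psi>
    by (rule L2_mult_integrable[OF L test_fun_L2[OF t]])
  have "AE x in lborel. f x - Re (inv_fourier g x) = 0"
    by (rule fundamental_lemma) (auto simp: left_diff_distrib re fi)
  moreover have "AE x in lborel. Im (inv_fourier g x) = 0"
    by (rule fundamental_lemma) (auto simp: im)
  ultimately show ?thesis by eventually_elim (simp add: complex_eq_iff)
qed

text \<open>The factors are replaced almost everywhere by inverse transforms, whose product is again
  one. The result is stated as a pairing, the form in which the terms of the equation are added up
  in \<open>kdv_fourier\<close>.\<close>

lemma fourier_product:
  assumes f: "fourier_L2 f1 g1" "fourier_L2 f2 g2" and g: "integrable lborel g1" "integrable lborel g2" and t: "test_fun \<psi>"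
  shows "complex_of_real (LINT x|lborel. f1 x * f2 x * \<psi> x)
     = (LINT \<xi>|lborel. (conv g1 g2 \<xi> / complex_of_real (2 * pi)) * cfourier \<psi> \<xi>) / complex_of_real (2 * pi)"
proof -
  have [measurable]: "g1 \<in> borel_measurable borel" "f1 \<in> borel_measurable borel" "g2 \<in> borel_measurable borel" "f2 \<in> borel_measurable borel" "\<psi> \<in> borel_measurable borel"
    using g f t by (auto simp: fourier_L2_def L2_def test_fun_measurable)
  have "complex_of_real (LINT x|lborel. f1 x * f2 x * \<psi> x) = (LINT x|lborel. complex_of_real (f1 x * f2 x * \<psi> x))"
    by (rule integral_complex_of_real[symmetric])
  also have "\<dots> = (LINT x|lborel. inv_fourier (\<lambda>\<xi>. conv g1 g2 \<xi> / complex_of_real (2 * pi)) x * complex_of_real (\<psi> x))"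
  proof (rule integral_cong_AE)
    show "AE x in lborel. complex_of_real (f1 x * f2 x * \<psi> x)
        = inv_fourier (\<lambda>\<xi>. conv g1 g2 \<xi> / complex_of_real (2 * pi)) x * complex_of_real (\<psi> x)"
      using fourier_L2_inversion[OF f(1) g(1)] fourier_L2_inversion[OF f(2) g(2)]
    proof eventually_elim
      case (elim x)
      show ?case unfolding inv_fourier_mult[OF g, symmetric] elim[symmetric] by simp
    qed
  qed measurable
  also have "\<dots> = (LINT \<xi>|lborel. (conv g1 g2 \<xi> / complex_of_real (2 * pi)) * cfourier \<psi> \<xi>) / complex_of_real (2 * pi)"
    by (rule inv_fourier_parseval[OF _ t]) (simp add: conv_integrable g)
  finally show ?thesis .
qed

lemma kdv_fourier:
  assumes u: "fourier_L2 u g" and g: "integrable lborel g" "integrable lborel (\<lambda>\<xi>. \<i> * complex_of_real \<xi> * g \<xi>)"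
    and L: "L2c (\<lambda>\<xi>. \<i> * complex_of_real \<xi> * g \<xi>)" "L2c (\<lambda>\<xi>. (\<i> * complex_of_real \<xi>) ^ 3 * g \<xi>)"
    and w: "weak_deriv 1 u w1" "weak_deriv 3 u w3"
    and v: "L2 v" "AE x in lborel. v x = u x * w1 x + \<epsilon> * w3 x"
  shows "fourier_L2 v (\<lambda>\<xi>. conv g (\<lambda>\<eta>. \<i> * complex_of_real \<eta> * g \<eta>) \<xi> / complex_of_real (2 * pi)
      + complex_of_real \<epsilon> * ((\<i> * complex_of_real \<xi>) ^ 3 * g \<xi>))"
  unfolding fourier_L2_iff
proof (intro conjI v allI impI)
  let ?N = "\<lambda>\<xi>. conv g (\<lambda>\<eta>. \<i> * complex_of_real \<eta> * g \<eta>) \<xi> / complex_of_real (2 * pi)"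
  have N: "L2c ?N" using L2c_cmult[OF L2c_conv(1)[OF g(1) L(1)], of "1 / complex_of_real (2 * pi)"] by simp
  then show "L2c (\<lambda>\<xi>. ?N \<xi> + complex_of_real \<epsilon> * ((\<i> * complex_of_real \<xi>) ^ 3 * g \<xi>))"
    by (intro L2c_add L2c_cmult L)
  fix \<psi> assume t: "test_fun \<psi>"
  have w1: "fourier_L2 w1 (\<lambda>\<xi>. \<i> * complex_of_real \<xi> * g \<xi>)"
    using fourier_L2_weak_deriv[OF u w(1)] L(1) by simp
  have w3: "fourier_L2 w3 (\<lambda>\<xi>. (\<i> * complex_of_real \<xi>) ^ 3 * g \<xi>)"
    by (rule fourier_L2_weak_deriv[OF u w(2) L(2)])
  have L2s: "L2 u" "L2 w1" "L2 w3" using u w1 w3 by (auto simp: fourier_L2_def)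
  have [measurable]: "u \<in> borel_measurable borel" "w1 \<in> borel_measurable borel" "w3 \<in> borel_measurable borel"
     "v \<in> borel_measurable borel" "\<psi> \<in> borel_measurable borel" using L2s v t by (auto simp: L2_def test_fun_measurable)
  obtain B where B: "\<And>x. \<bar>\<psi> x\<bar> \<le> B" using test_fun_bounded[OF t] by metis
  have i1: "integrable lborel (\<lambda>x. u x * w1 x * \<psi> x)"
    by (rule integrable_mult_bounded(1)[OF L2_mult_integrable[OF L2s(1,2)]]) (use B in auto)
  have i3: "integrable lborel (\<lambda>x. w3 x * \<psi> x)" by (rule L2_mult_integrable[OF L2s(3) test_fun_L2[OF t]])
  have "(LINT x|lborel. v x * \<psi> x) = (LINT x|lborel. u x * w1 x * \<psi> x + \<epsilon> * (w3 x * \<psi> x))"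
    by (rule integral_cong_AE) (use v(2) in \<open>auto simp: algebra_simps elim!: eventually_mono\<close>)
  also have "\<dots> = (LINT x|lborel. u x * w1 x * \<psi> x) + \<epsilon> * (LINT x|lborel. w3 x * \<psi> x)"
    using i1 i3 by simp
  finally have "complex_of_real (LINT x|lborel. v x * \<psi> x) =
     complex_of_real (LINT x|lborel. u x * w1 x * \<psi> x) + complex_of_real \<epsilon> * complex_of_real (LINT x|lborel. w3 x * \<psi> x)"
    by simp
  also have "\<dots> = (LINT \<xi>|lborel. ?N \<xi> * cfourier \<psi> \<xi>) / complex_of_real (2 * pi)
     + complex_of_real \<epsilon> * ((LINT \<xi>|lborel. (\<i> * complex_of_real \<xi>) ^ 3 * g \<xi> * cfourier \<psi> \<xi>) / complex_of_real (2 * pi))"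
    using w3 t unfolding fourier_product[OF u w1 g t] by (simp add: fourier_L2_iff)
  also have "\<dots> = ((LINT \<xi>|lborel. ?N \<xi> * cfourier \<psi> \<xi>)
     + complex_of_real \<epsilon> * (LINT \<xi>|lborel. (\<i> * complex_of_real \<xi>) ^ 3 * g \<xi> * cfourier \<psi> \<xi>)) / complex_of_real (2 * pi)"
    by (simp add: add_divide_distrib)
  also have "(LINT \<xi>|lborel. ?N \<xi> * cfourier \<psi> \<xi>) + complex_of_real \<epsilon> * (LINT \<xi>|lborel. (\<i> * complex_of_real \<xi>) ^ 3 * g \<xi> * cfourier \<psi> \<xi>)
     = (LINT \<xi>|lborel. (?N \<xi> + complex_of_real \<epsilon> * ((\<i> * complex_of_real \<xi>) ^ 3 * g \<xi>)) * cfourier \<psi> \<xi>)"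
    unfolding distrib_right mult.assoc[of "complex_of_real \<epsilon>"] integral_mult_right_zero[symmetric]
    by (rule Bochner_Integration.integral_add[symmetric]) (intro integrable_mult_right L2c_mult_integrable N L L2c_cfourier t)+
  finally show "complex_of_real (LINT x|lborel. v x * \<psi> x) =
     (LINT \<xi>|lborel. (?N \<xi> + complex_of_real \<epsilon> * ((\<i> * complex_of_real \<xi>) ^ 3 * g \<xi>)) * cfourier \<psi> \<xi>) / complex_of_real (2 * pi)" .
qed

section \<open>Trilinear estimates\<close>

lemma mult3_le: "0 \<le> x \<Longrightarrow> x * y * z \<le> x * (y\<^sup>2 + z\<^sup>2) / 2" for x y z :: real
  using mult_left_mono[OF sum_squares_bound[of y z], of x] by (simp add: algebra_simps)

lemma average_bound:
  fixes f g h :: "'a \<Rightarrow> real"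
  assumes f: "integrable M f" and g: "integrable M g" and h: "h \<in> borel_measurable M"
    and le: "\<And>z. 0 \<le> h z \<and> h z \<le> (f z + g z) / 2"
  shows "integrable M h" "integral\<^sup>L M h \<le> (integral\<^sup>L M f + integral\<^sup>L M g) / 2"
proof -
  have i: "integrable M (\<lambda>z. (f z + g z) / 2)" using f g by simp
  show h: "integrable M h" by (rule integrable_dominated[OF i h]) (use le in auto)
  have "integral\<^sup>L M h \<le> integral\<^sup>L M (\<lambda>z. (f z + g z) / 2)" by (rule integral_mono[OF h i]) (use le in auto)
  then show "integral\<^sup>L M h \<le> (integral\<^sup>L M f + integral\<^sup>L M g) / 2" using f g by simp
qed

text \<open>One factor is integrated, and the product of the other two is split by
  \<open>2 y z \<le> y^2 + z^2\<close>; each resulting double integral factorises. The three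
  variants differ only in which factor is the integrable one.\<close>

lemma trilinear_bound_1:
  fixes \<alpha> \<beta> \<gamma> :: "real \<Rightarrow> real"
  assumes \<alpha>: "integrable lborel \<alpha>" and \<beta>: "integrable lborel (\<lambda>x. (\<beta> x)\<^sup>2)" and \<gamma>: "integrable lborel (\<lambda>x. (\<gamma> x)\<^sup>2)"
    and [measurable]: "\<beta> \<in> borel_measurable borel" "\<gamma> \<in> borel_measurable borel"
    and nn: "\<And>x. 0 \<le> \<alpha> x" "\<And>x. 0 \<le> \<beta> x" "\<And>x. 0 \<le> \<gamma> x"
  shows "integrable (lborel \<Otimes>\<^sub>M lborel) (\<lambda>(x, y). \<alpha> (x - y) * \<beta> y * \<gamma> x)" (is "integrable _ ?T")
    and "integral\<^sup>L (lborel \<Otimes>\<^sub>M lborel) (\<lambda>(x, y). \<alpha> (x - y) * \<beta> y * \<gamma> x)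
      \<le> (LINT x|lborel. \<alpha> x) * ((LINT x|lborel. (\<beta> x)\<^sup>2) + (LINT x|lborel. (\<gamma> x)\<^sup>2)) / 2"
proof -
  have [measurable]: "\<alpha> \<in> borel_measurable borel" using \<alpha> by auto
  note 1 = pair_integrable_conv[OF \<alpha> \<beta>] and 2 = pair_integrable_reflect[OF \<alpha> \<gamma>]
  have "0 \<le> ?T z \<and> ?T z \<le> ((\<lambda>(x, y). \<alpha> (x - y) * (\<beta> y)\<^sup>2) z + (\<lambda>(x, y). \<alpha> (x - y) * (\<gamma> x)\<^sup>2) z) / 2" for z
    using mult3_le[OF nn(1), of "fst z - snd z" "\<beta> (snd z)" "\<gamma> (fst z)"] nn by (cases z) (simp add: distrib_left mult_ac)
  note average_bound[OF 1(1) 2(1) _ this]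
  then show "integrable (lborel \<Otimes>\<^sub>M lborel) ?T" "integral\<^sup>L (lborel \<Otimes>\<^sub>M lborel) ?T
      \<le> (LINT x|lborel. \<alpha> x) * ((LINT x|lborel. (\<beta> x)\<^sup>2) + (LINT x|lborel. (\<gamma> x)\<^sup>2)) / 2"
    unfolding 1(2) 2(2) by (simp_all add: distrib_left mult.commute)
qed

lemma trilinear_bound_2:
  fixes \<alpha> \<beta> \<gamma> :: "real \<Rightarrow> real"
  assumes \<beta>: "integrable lborel \<beta>" and \<alpha>: "integrable lborel (\<lambda>x. (\<alpha> x)\<^sup>2)" and \<gamma>: "integrable lborel (\<lambda>x. (\<gamma> x)\<^sup>2)"
    and [measurable]: "\<alpha> \<in> borel_measurable borel" "\<gamma> \<in> borel_measurable borel"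
    and nn: "\<And>x. 0 \<le> \<alpha> x" "\<And>x. 0 \<le> \<beta> x" "\<And>x. 0 \<le> \<gamma> x"
  shows "integrable (lborel \<Otimes>\<^sub>M lborel) (\<lambda>(x, y). \<alpha> (x - y) * \<beta> y * \<gamma> x)" (is "integrable _ ?T")
    and "integral\<^sup>L (lborel \<Otimes>\<^sub>M lborel) (\<lambda>(x, y). \<alpha> (x - y) * \<beta> y * \<gamma> x)
      \<le> (LINT x|lborel. \<beta> x) * ((LINT x|lborel. (\<alpha> x)\<^sup>2) + (LINT x|lborel. (\<gamma> x)\<^sup>2)) / 2"
proof -
  have [measurable]: "\<beta> \<in> borel_measurable borel" using \<beta> by auto
  note 1 = pair_integrable_conv[OF \<alpha> \<beta>] and 2 = pair_integrable_prod[OF \<gamma> \<beta>]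
  have "0 \<le> ?T z \<and> ?T z \<le> ((\<lambda>(x, y). (\<alpha> (x - y))\<^sup>2 * \<beta> y) z + (\<lambda>(x, y). (\<gamma> x)\<^sup>2 * \<beta> y) z) / 2" for z
    using mult3_le[OF nn(2), of "snd z" "\<alpha> (fst z - snd z)" "\<gamma> (fst z)"] nn by (cases z) (simp add: distrib_left mult_ac)
  note average_bound[OF 1(1) 2(1) _ this]
  then show "integrable (lborel \<Otimes>\<^sub>M lborel) ?T" "integral\<^sup>L (lborel \<Otimes>\<^sub>M lborel) ?T
      \<le> (LINT x|lborel. \<beta> x) * ((LINT x|lborel. (\<alpha> x)\<^sup>2) + (LINT x|lborel. (\<gamma> x)\<^sup>2)) / 2"
    unfolding 1(2) 2(2) by (simp_all add: distrib_left mult.commute)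
qed

lemma trilinear_bound_3:
  fixes \<alpha> \<beta> \<gamma> :: "real \<Rightarrow> real"
  assumes \<gamma>: "integrable lborel \<gamma>" and \<alpha>: "integrable lborel (\<lambda>x. (\<alpha> x)\<^sup>2)" and \<beta>: "integrable lborel (\<lambda>x. (\<beta> x)\<^sup>2)"
    and [measurable]: "\<alpha> \<in> borel_measurable borel" "\<beta> \<in> borel_measurable borel"
    and nn: "\<And>x. 0 \<le> \<alpha> x" "\<And>x. 0 \<le> \<beta> x" "\<And>x. 0 \<le> \<gamma> x"
  shows "integrable (lborel \<Otimes>\<^sub>M lborel) (\<lambda>(x, y). \<alpha> (x - y) * \<beta> y * \<gamma> x)" (is "integrable _ ?T")
    and "integral\<^sup>L (lborel \<Otimes>\<^sub>M lborel) (\<lambda>(x, y). \<alpha> (x - y) * \<beta> y * \<gamma> x)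
      \<le> (LINT x|lborel. \<gamma> x) * ((LINT x|lborel. (\<alpha> x)\<^sup>2) + (LINT x|lborel. (\<beta> x)\<^sup>2)) / 2"
proof -
  have [measurable]: "\<gamma> \<in> borel_measurable borel" using \<gamma> by auto
  note 1 = pair_integrable_reflect[OF \<alpha> \<gamma>] and 2 = pair_integrable_prod[OF \<gamma> \<beta>]
  have "0 \<le> ?T z \<and> ?T z \<le> ((\<lambda>(x, y). (\<alpha> (x - y))\<^sup>2 * \<gamma> x) z + (\<lambda>(x, y). \<gamma> x * (\<beta> y)\<^sup>2) z) / 2" for z
    using mult3_le[OF nn(3), of "fst z" "\<alpha> (fst z - snd z)" "\<beta> (snd z)"] nn by (cases z) (simp add: distrib_left mult_ac)
  note average_bound[OF 1(1) 2(1) _ this]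
  then show "integrable (lborel \<Otimes>\<^sub>M lborel) ?T" "integral\<^sup>L (lborel \<Otimes>\<^sub>M lborel) ?T
      \<le> (LINT x|lborel. \<gamma> x) * ((LINT x|lborel. (\<alpha> x)\<^sup>2) + (LINT x|lborel. (\<beta> x)\<^sup>2)) / 2"
    unfolding 1(2) 2(2) by (simp_all add: distrib_left mult.commute)
qed

text \<open>The growth condition alone yields a commutator estimate whose constant depends only on \<open>n\<close>. It is
  stable under truncation by a constant, so the energy estimates are uniform over truncated weights.\<close>

definition slow_weight :: "nat \<Rightarrow> (real \<Rightarrow> real) \<Rightarrow> bool" where
  "slow_weight n F \<longleftrightarrow> (\<forall>x\<ge>0. 0 \<le> F x) \<and> (\<forall>x\<ge>0. \<forall>y\<ge>x. F x \<le> F y) \<and> (\<forall>x\<ge>0. \<forall>l\<ge>1. F (l * x) \<le> l ^ n * F x)"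

text \<open>A Lipschitz bound on the range of the ratio of two comparable frequencies. It replaces a
  bound on the derivative of the weight.\<close>

lemma power_minus_one_le: "1 \<le> l \<Longrightarrow> l \<le> 2 \<Longrightarrow> l ^ n - 1 \<le> real n * 2 ^ n * (l - 1)" for l :: real
proof (induction n)
  case (Suc n)
  have "l ^ Suc n - 1 = l * (l ^ n - 1) + (l - 1)" by (simp add: algebra_simps)
  also have "l * (l ^ n - 1) \<le> 2 * (real n * 2 ^ n * (l - 1))"
    using Suc by (intro mult_mono) auto
  also have "2 * (real n * 2 ^ n * (l - 1)) + (l - 1) \<le> real (Suc n) * 2 ^ Suc n * (l - 1)"
  proof -
    have "(1::real) \<le> 2 ^ Suc n" by (rule one_le_power) simp
    then have "1 * (l - 1) \<le> 2 ^ Suc n * (l - 1)" using Suc.prems by (intro mult_right_mono) auto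
    then show ?thesis by (simp add: algebra_simps)
  qed
  finally show ?case by simp
qed simp

text \<open>The two summands serve the two regimes of the commutator estimate: \<open>3 ^ n\<close>
  when both frequencies are at most three times their difference, the other one when they are
  comparable up to a factor 2.\<close>

definition comm_const :: "nat \<Rightarrow> real" where "comm_const n = 3 ^ n + real n * 2 ^ n * 2"

lemma comm_const_ge: "1 \<le> comm_const n" "3 ^ n \<le> comm_const n" "real n * 2 ^ n * 2 \<le> comm_const n"
  using one_le_power[of "3::real" n] by (simp_all add: comm_const_def add_increasing2)

text \<open>If \<open>\<bar>\<eta>\<bar> \<le> 2 * \<bar>\<xi> - \<eta>\<bar>\<close>, both weights
  are at most \<open>3 ^ n\<close> times the weight at the difference, and nothing has to cancel.
  Otherwise \<open>\<bar>\<xi>\<bar>\<close> and \<open>\<bar>\<eta>\<bar>\<close> differ by a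
  factor of at most 2, and the growth condition with their ratio \<open>l\<close> acts as a
  Lipschitz bound, since \<open>l - 1\<close> is of the size of the difference over the
  frequency.\<close>

lemma slow_weight_commutator:
  assumes F: "slow_weight n F"
  shows "\<bar>\<eta>\<bar> * \<bar>F \<bar>\<xi>\<bar> - F \<bar>\<eta>\<bar>\<bar> \<le> comm_const n * (\<bar>\<xi> - \<eta>\<bar> * F \<bar>\<eta>\<bar> + \<bar>\<eta>\<bar> * F \<bar>\<xi> - \<eta>\<bar>)"
proof -
  have nn: "0 \<le> F \<bar>x\<bar>" for x using F by (simp add: slow_weight_def)
  have mono: "F x \<le> F y" if "0 \<le> x" "x \<le> y" for x y using F that by (simp add: slow_weight_def)
  have grow: "F (l * x) \<le> l ^ n * F x" if "0 \<le> x" "1 \<le> l" for x l using F that by (simp add: slow_weight_def)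
  have step: "F (l * x) - F x \<le> real n * 2 ^ n * (l - 1) * F x" if "0 \<le> x" "1 \<le> l" "l \<le> 2" for x l
  proof -
    have "F (l * x) - F x \<le> (l ^ n - 1) * F x" using grow[OF that(1,2)] by (simp add: algebra_simps)
    also have "\<dots> \<le> real n * 2 ^ n * (l - 1) * F x"
      by (rule mult_right_mono[OF power_minus_one_le]) (use that nn[of x] in auto)
    finally show ?thesis .
  qed
  have tri: "\<bar>\<xi>\<bar> \<le> \<bar>\<xi> - \<eta>\<bar> + \<bar>\<eta>\<bar>" "\<bar>\<eta>\<bar> \<le> \<bar>\<xi> - \<eta>\<bar> + \<bar>\<xi>\<bar>" by arith+
  show ?thesis
  proof (cases "\<bar>\<eta>\<bar> \<le> 2 * \<bar>\<xi> - \<eta>\<bar>")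
    case True
    have 3: "F \<bar>x\<bar> \<le> 3 ^ n * F \<bar>\<xi> - \<eta>\<bar>" if "\<bar>x\<bar> \<le> 3 * \<bar>\<xi> - \<eta>\<bar>" for x
      using mono[OF _ that] grow[of "\<bar>\<xi> - \<eta>\<bar>" 3] by simp
    have "F \<bar>\<xi>\<bar> \<le> 3 ^ n * F \<bar>\<xi> - \<eta>\<bar>" "F \<bar>\<eta>\<bar> \<le> 3 ^ n * F \<bar>\<xi> - \<eta>\<bar>"
      by (rule 3; use True tri in linarith)+
    then have "\<bar>F \<bar>\<xi>\<bar> - F \<bar>\<eta>\<bar>\<bar> \<le> 3 ^ n * F \<bar>\<xi> - \<eta>\<bar>"
      using nn[of \<xi>] nn[of \<eta>] by (simp add: abs_le_iff)
    also have "\<dots> \<le> comm_const n * F \<bar>\<xi> - \<eta>\<bar>" by (rule mult_right_mono[OF comm_const_ge(2) nn])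
    finally have "\<bar>\<eta>\<bar> * \<bar>F \<bar>\<xi>\<bar> - F \<bar>\<eta>\<bar>\<bar> \<le> \<bar>\<eta>\<bar> * (comm_const n * F \<bar>\<xi> - \<eta>\<bar>)" by (rule mult_left_mono) simp
    moreover have "0 \<le> comm_const n * (\<bar>\<xi> - \<eta>\<bar> * F \<bar>\<eta>\<bar>)"
      using comm_const_ge(1)[of n] nn[of \<eta>] by simp
    ultimately show ?thesis by (simp add: distrib_left mult_ac)
  next
    case False
    then have z: "2 * \<bar>\<xi> - \<eta>\<bar> < \<bar>\<eta>\<bar>" "0 < \<bar>\<eta>\<bar>" by auto
    have "\<bar>\<eta>\<bar> * \<bar>F \<bar>\<xi>\<bar> - F \<bar>\<eta>\<bar>\<bar> \<le> real n * 2 ^ n * 2 * (\<bar>\<xi> - \<eta>\<bar> * F \<bar>\<eta>\<bar>)"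
    proof (cases "\<bar>\<eta>\<bar> \<le> \<bar>\<xi>\<bar>")
      case True
      define l where "l = \<bar>\<xi>\<bar> / \<bar>\<eta>\<bar>"
      have l: "1 \<le> l" "l \<le> 2" "l * \<bar>\<eta>\<bar> = \<bar>\<xi>\<bar>" using True z tri by (simp_all add: l_def divide_simps)
      have "\<bar>F \<bar>\<xi>\<bar> - F \<bar>\<eta>\<bar>\<bar> \<le> real n * 2 ^ n * (l - 1) * F \<bar>\<eta>\<bar>"
        using step[of "\<bar>\<eta>\<bar>" l] mono[of "\<bar>\<eta>\<bar>" "\<bar>\<xi>\<bar>"] l True by simp
      then have "\<bar>\<eta>\<bar> * \<bar>F \<bar>\<xi>\<bar> - F \<bar>\<eta>\<bar>\<bar> \<le> \<bar>\<eta>\<bar> * (real n * 2 ^ n * (l - 1) * F \<bar>\<eta>\<bar>)" by (rule mult_left_mono) simp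
      also have "\<dots> = real n * 2 ^ n * ((\<bar>\<xi>\<bar> - \<bar>\<eta>\<bar>) * F \<bar>\<eta>\<bar>)" using l(3) by (simp add: algebra_simps)
      also have "\<dots> \<le> real n * 2 ^ n * ((2 * \<bar>\<xi> - \<eta>\<bar>) * F \<bar>\<eta>\<bar>)"
        using tri by (intro mult_left_mono mult_right_mono nn) simp_all
      finally show ?thesis by (simp add: mult_ac)
    next
      case False
      define l where "l = \<bar>\<eta>\<bar> / \<bar>\<xi>\<bar>"
      have x: "\<bar>\<eta>\<bar> < 2 * \<bar>\<xi>\<bar>" using z tri by linarith
      have l: "1 \<le> l" "l \<le> 2" "l * \<bar>\<xi>\<bar> = \<bar>\<eta>\<bar>" using False z x by (auto simp: l_def field_simps)
      have l1: "\<bar>\<eta>\<bar> * (l - 1) \<le> 2 * \<bar>\<xi> - \<eta>\<bar>"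
      proof -
        have "\<bar>\<eta>\<bar> * (l - 1) = l * (\<bar>\<eta>\<bar> - \<bar>\<xi>\<bar>)" using l(3) by (simp add: algebra_simps)
        also have "\<dots> \<le> 2 * \<bar>\<xi> - \<eta>\<bar>" using l False by (intro mult_mono) auto
        finally show ?thesis .
      qed
      have "\<bar>F \<bar>\<xi>\<bar> - F \<bar>\<eta>\<bar>\<bar> \<le> real n * 2 ^ n * (l - 1) * F \<bar>\<xi>\<bar>"
        using step[of "\<bar>\<xi>\<bar>" l] mono[of "\<bar>\<xi>\<bar>" "\<bar>\<eta>\<bar>"] l False by simp
      \<comment> \<open>Here the growth condition was based at the smaller frequency
        \<open>\<xi>\<close>; monotonicity moves the bound to \<open>\<eta>\<close>.\<close>
      also have "\<dots> \<le> real n * 2 ^ n * (l - 1) * F \<bar>\<eta>\<bar>"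
        using mono[of "\<bar>\<xi>\<bar>" "\<bar>\<eta>\<bar>"] l False by (intro mult_left_mono) auto
      finally have "\<bar>\<eta>\<bar> * \<bar>F \<bar>\<xi>\<bar> - F \<bar>\<eta>\<bar>\<bar> \<le> \<bar>\<eta>\<bar> * (real n * 2 ^ n * (l - 1) * F \<bar>\<eta>\<bar>)" by (rule mult_left_mono) simp
      also have "\<dots> = real n * 2 ^ n * ((\<bar>\<eta>\<bar> * (l - 1)) * F \<bar>\<eta>\<bar>)" by (simp add: mult_ac)
      also have "\<dots> \<le> real n * 2 ^ n * ((2 * \<bar>\<xi> - \<eta>\<bar>) * F \<bar>\<eta>\<bar>)"
        by (intro mult_left_mono mult_right_mono nn l1) auto
      finally show ?thesis by (simp add: mult_ac)
    qed
    also have "\<dots> \<le> comm_const n * (\<bar>\<xi> - \<eta>\<bar> * F \<bar>\<eta>\<bar>)"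
      by (rule mult_right_mono[OF comm_const_ge(3)]) (simp add: nn)
    also have "\<dots> \<le> comm_const n * (\<bar>\<xi> - \<eta>\<bar> * F \<bar>\<eta>\<bar> + \<bar>\<eta>\<bar> * F \<bar>\<xi> - \<eta>\<bar>)"
      using comm_const_ge(1)[of n] nn by (intro mult_left_mono) auto
    finally show ?thesis .
  qed
qed

text \<open>With \<open>p\<close> and \<open>q\<close> for the weights at \<open>\<xi>\<close> and
  \<open>\<eta>\<close>, the symbol equals
  \<open>p q (\<eta> - \<xi>) + p \<eta> (p - q) + q \<xi> (p - q)\<close>, and the commutator
  estimate is used twice with exchanged frequencies. Each of the three resulting terms carries one
  factor of frequency and two weights at different places, as in the trilinear bounds.\<close>

lemma slow_weight_symbol:
  assumes F: "slow_weight n F"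
  shows "\<bar>(F \<bar>\<xi>\<bar>)\<^sup>2 * \<eta> - (F \<bar>\<eta>\<bar>)\<^sup>2 * \<xi>\<bar> \<le> 3 * comm_const n *
    (\<bar>\<xi> - \<eta>\<bar> * F \<bar>\<eta>\<bar> * F \<bar>\<xi>\<bar> + F \<bar>\<xi> - \<eta>\<bar> * \<bar>\<eta>\<bar> * F \<bar>\<xi>\<bar> + F \<bar>\<xi> - \<eta>\<bar> * F \<bar>\<eta>\<bar> * \<bar>\<xi>\<bar>)"
proof -
  define C where "C = comm_const n"
  define p where "p = F \<bar>\<xi>\<bar>"
  define q where "q = F \<bar>\<eta>\<bar>"
  define r where "r = F \<bar>\<xi> - \<eta>\<bar>"
  have nn: "0 \<le> p" "0 \<le> q" "0 \<le> r" using F by (auto simp: slow_weight_def p_def q_def r_def)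
  have C: "1 \<le> C" unfolding C_def by (rule comm_const_ge)
  have 1: "\<bar>\<eta>\<bar> * \<bar>p - q\<bar> \<le> C * (\<bar>\<xi> - \<eta>\<bar> * q + \<bar>\<eta>\<bar> * r)"
    using slow_weight_commutator[OF F, of \<eta> \<xi>] by (simp add: p_def q_def r_def C_def)
  have 2: "\<bar>\<xi>\<bar> * \<bar>p - q\<bar> \<le> C * (\<bar>\<xi> - \<eta>\<bar> * p + \<bar>\<xi>\<bar> * r)"
    using slow_weight_commutator[OF F, of \<xi> \<eta>] by (simp add: p_def q_def r_def C_def abs_minus_commute)
  have "p\<^sup>2 * \<eta> - q\<^sup>2 * \<xi> = p * q * (\<eta> - \<xi>) + p * (\<eta> * (p - q)) + q * (\<xi> * (p - q))"
    by (simp add: power2_eq_square algebra_simps)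
  also have "\<bar>\<dots>\<bar> \<le> \<bar>p * q * (\<eta> - \<xi>)\<bar> + \<bar>p * (\<eta> * (p - q))\<bar> + \<bar>q * (\<xi> * (p - q))\<bar>" by linarith
  also have "\<bar>p * q * (\<eta> - \<xi>)\<bar> = p * q * \<bar>\<xi> - \<eta>\<bar>" using nn by (simp add: abs_mult abs_minus_commute)
  also have "\<bar>p * (\<eta> * (p - q))\<bar> = p * (\<bar>\<eta>\<bar> * \<bar>p - q\<bar>)" using nn by (simp add: abs_mult)
  also have "\<bar>q * (\<xi> * (p - q))\<bar> = q * (\<bar>\<xi>\<bar> * \<bar>p - q\<bar>)" using nn by (simp add: abs_mult)
  also have "p * (\<bar>\<eta>\<bar> * \<bar>p - q\<bar>) \<le> p * (C * (\<bar>\<xi> - \<eta>\<bar> * q + \<bar>\<eta>\<bar> * r))" by (rule mult_left_mono[OF 1 nn(1)])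
  also have "q * (\<bar>\<xi>\<bar> * \<bar>p - q\<bar>) \<le> q * (C * (\<bar>\<xi> - \<eta>\<bar> * p + \<bar>\<xi>\<bar> * r))" by (rule mult_left_mono[OF 2 nn(2)])
  also have "p * q * \<bar>\<xi> - \<eta>\<bar> \<le> C * (p * q * \<bar>\<xi> - \<eta>\<bar>)"
    using mult_right_mono[OF C, of "p * q * \<bar>\<xi> - \<eta>\<bar>"] nn by simp
  finally have "\<bar>p\<^sup>2 * \<eta> - q\<^sup>2 * \<xi>\<bar> \<le> 3 * (C * (p * q * \<bar>\<xi> - \<eta>\<bar>)) + C * (r * \<bar>\<eta>\<bar> * p) + C * (r * q * \<bar>\<xi>\<bar>)"
    by (simp add: algebra_simps)
  moreover have "0 \<le> C * (r * \<bar>\<eta>\<bar> * p)" "0 \<le> C * (r * q * \<bar>\<xi>\<bar>)" using nn C by auto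
  ultimately show ?thesis unfolding p_def[symmetric] q_def[symmetric] r_def[symmetric] C_def[symmetric]
    by (simp add: algebra_simps)
qed

text \<open>Swapping the two frequencies in the conjugate of the trilinear form, and using that the transform of a
  real function is Hermitian, moves the derivative onto the symbol \<open>(m \<xi>)\<^sup>2 * \<eta> - (m \<eta>)\<^sup>2 * \<xi>\<close>.\<close>

lemma transport_energy:
  fixes m :: "real \<Rightarrow> real"
  assumes herm: "\<And>\<xi>. a (- \<xi>) = cnj (a \<xi>)" and a: "integrable lborel a"
    and b: "L2c b" "L2c (\<lambda>\<eta>. \<i> * complex_of_real \<eta> * b \<eta>)"
    and [measurable]: "m \<in> borel_measurable borel" and m: "\<And>\<xi>. \<bar>m \<xi>\<bar> \<le> M"
    and H: "integrable (lborel \<Otimes>\<^sub>M lborel) (\<lambda>(\<xi>, \<eta>). H \<xi> \<eta>)"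
      "\<And>\<xi> \<eta>. \<bar>(m \<xi>)\<^sup>2 * \<eta> - (m \<eta>)\<^sup>2 * \<xi>\<bar> * (cmod (a (\<xi> - \<eta>)) * cmod (b \<eta>) * cmod (b \<xi>)) \<le> H \<xi> \<eta>"
  shows "2 * Re (LINT \<xi>|lborel. complex_of_real ((m \<xi>)\<^sup>2) * conv a (\<lambda>\<eta>. \<i> * complex_of_real \<eta> * b \<eta>) \<xi> * cnj (b \<xi>))
     \<le> integral\<^sup>L (lborel \<Otimes>\<^sub>M lborel) (\<lambda>(\<xi>, \<eta>). H \<xi> \<eta>)"
proof -
  have [measurable]: "a \<in> borel_measurable borel" "b \<in> borel_measurable borel" using a b by (auto simp: L2c_def)
  define Q where "Q \<xi> \<eta> = complex_of_real ((m \<xi>)\<^sup>2) * (a (\<xi> - \<eta>) * (\<i> * complex_of_real \<eta> * b \<eta>)) * cnj (b \<xi>)" for \<xi> \<eta>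
  have [measurable]: "(\<lambda>(\<xi>, \<eta>). Q \<xi> \<eta>) \<in> borel_measurable (lborel \<Otimes>\<^sub>M lborel)" unfolding Q_def by measurable
  have T: "integrable (lborel \<Otimes>\<^sub>M lborel) (\<lambda>(\<xi>, \<eta>). cmod (a (\<xi> - \<eta>)) * cmod (\<i> * complex_of_real \<eta> * b \<eta>) * cmod (b \<xi>))"
    by (rule trilinear_bound_1) (use a b in \<open>auto simp: L2c_def\<close>)
  have iQ: "integrable (lborel \<Otimes>\<^sub>M lborel) (\<lambda>(\<xi>, \<eta>). Q \<xi> \<eta>)"
  proof (rule integrable_dominated[OF integrable_mult_right[OF T, of "M\<^sup>2"]])
    fix z :: "real \<times> real"
    obtain \<xi> \<eta> where z: "z = (\<xi>, \<eta>)" by (cases z)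
    have "(m \<xi>)\<^sup>2 \<le> M\<^sup>2" using m[of \<xi>] by (metis abs_ge_zero power2_abs power_mono)
    then have "(m \<xi>)\<^sup>2 * (cmod (a (\<xi> - \<eta>)) * cmod (\<i> * complex_of_real \<eta> * b \<eta>) * cmod (b \<xi>))
       \<le> M\<^sup>2 * (cmod (a (\<xi> - \<eta>)) * cmod (\<i> * complex_of_real \<eta> * b \<eta>) * cmod (b \<xi>))"
      by (rule mult_right_mono) simp
    then show "norm ((\<lambda>(\<xi>, \<eta>). Q \<xi> \<eta>) z)
       \<le> M\<^sup>2 * (\<lambda>(\<xi>, \<eta>). cmod (a (\<xi> - \<eta>)) * cmod (\<i> * complex_of_real \<eta> * b \<eta>) * cmod (b \<xi>)) z"
      by (simp add: z Q_def norm_mult norm_power mult_ac)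
  qed measurable
  have iQs: "integrable (lborel \<Otimes>\<^sub>M lborel) (\<lambda>(\<xi>, \<eta>). cnj (Q \<eta> \<xi>))"
    using integrable_cnj[OF lborel_pair.integrable_product_swap[OF iQ]] by (simp add: case_prod_unfold)
  define J where "J = integral\<^sup>L (lborel \<Otimes>\<^sub>M lborel) (\<lambda>(\<xi>, \<eta>). Q \<xi> \<eta>)"
  have J1: "(LINT \<xi>|lborel. complex_of_real ((m \<xi>)\<^sup>2) * conv a (\<lambda>\<eta>. \<i> * complex_of_real \<eta> * b \<eta>) \<xi> * cnj (b \<xi>)) = J"
    unfolding J_def lborel_pair.integral_fst'[OF iQ, symmetric] by (simp add: Q_def conv_def)
  have J2: "integral\<^sup>L (lborel \<Otimes>\<^sub>M lborel) (\<lambda>(\<xi>, \<eta>). cnj (Q \<eta> \<xi>)) = cnj J"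
    using lborel_pair.integral_product_swap[of "\<lambda>(\<xi>, \<eta>). Q \<xi> \<eta>"]
    unfolding J_def Bochner_Integration.integral_cnj[symmetric] by (simp add: case_prod_unfold)
  have sum: "Q \<xi> \<eta> + cnj (Q \<eta> \<xi>) = \<i> * complex_of_real ((m \<xi>)\<^sup>2 * \<eta> - (m \<eta>)\<^sup>2 * \<xi>) * (a (\<xi> - \<eta>) * b \<eta> * cnj (b \<xi>))" for \<xi> \<eta>
    using herm[of "\<eta> - \<xi>"] by (simp add: Q_def algebra_simps)
  have le: "norm ((\<lambda>(\<xi>, \<eta>). Q \<xi> \<eta>) z + (\<lambda>(\<xi>, \<eta>). cnj (Q \<eta> \<xi>)) z) \<le> (\<lambda>(\<xi>, \<eta>). H \<xi> \<eta>) z" for z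
    using H(2)[of "fst z" "snd z"] unfolding case_prod_unfold sum by (simp add: norm_mult mult_ac del: of_real_diff of_real_mult)
  have "2 * Re J = Re (J + cnj J)" by simp
  also have "\<dots> = Re (integral\<^sup>L (lborel \<Otimes>\<^sub>M lborel) (\<lambda>z. (\<lambda>(\<xi>, \<eta>). Q \<xi> \<eta>) z + (\<lambda>(\<xi>, \<eta>). cnj (Q \<eta> \<xi>)) z))"
    by (subst Bochner_Integration.integral_add[OF iQ iQs]) (simp add: J2 J_def)
  also have "\<dots> \<le> cmod (integral\<^sup>L (lborel \<Otimes>\<^sub>M lborel) (\<lambda>z. (\<lambda>(\<xi>, \<eta>). Q \<xi> \<eta>) z + (\<lambda>(\<xi>, \<eta>). cnj (Q \<eta> \<xi>)) z))"
    by (rule complex_Re_le_cmod)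
  also have "\<dots> \<le> integral\<^sup>L (lborel \<Otimes>\<^sub>M lborel) (\<lambda>(\<xi>, \<eta>). H \<xi> \<eta>)"
    by (rule order_trans[OF integral_norm_bound integral_mono[OF _ H(1)]])
       (rule integrable_norm[OF Bochner_Integration.integrable_add[OF iQ iQs]], rule le)
  finally show ?thesis unfolding J1 .
qed

text \<open>In each of the three symbol terms the factor without a weight is put into
  \<open>L^1\<close> and the two weighted ones into \<open>L^2\<close>. The constant 9 is the 3 of
  the symbol bound times the three terms. The bound \<open>M\<close> serves integrability only and
  does not enter the constant, which makes the estimate uniform in the truncation.\<close>

lemma weighted_transport_energy:
  assumes F: "slow_weight n F" and [measurable]: "F \<in> borel_measurable borel" and FM: "\<And>x. 0 \<le> x \<Longrightarrow> F x \<le> M"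
    and herm: "\<And>\<xi>. g (- \<xi>) = cnj (g \<xi>)" and g: "integrable lborel g" "L2c g"
    and ig: "integrable lborel (\<lambda>\<eta>. \<i> * complex_of_real \<eta> * g \<eta>)" "L2c (\<lambda>\<eta>. \<i> * complex_of_real \<eta> * g \<eta>)"
  shows "2 * Re (LINT \<xi>|lborel. complex_of_real ((F \<bar>\<xi>\<bar>)\<^sup>2) * conv g (\<lambda>\<eta>. \<i> * complex_of_real \<eta> * g \<eta>) \<xi> * cnj (g \<xi>))
     \<le> 9 * comm_const n * (LINT \<xi>|lborel. \<bar>\<xi>\<bar> * cmod (g \<xi>)) * (LINT \<xi>|lborel. (F \<bar>\<xi>\<bar>)\<^sup>2 * (cmod (g \<xi>))\<^sup>2)"
proof -
  have [measurable]: "g \<in> borel_measurable borel" using g by auto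
  have nn: "0 \<le> F \<bar>x\<bar>" for x using F by (simp add: slow_weight_def)
  define \<alpha> where "\<alpha> \<xi> = \<bar>\<xi>\<bar> * cmod (g \<xi>)" for \<xi>
  define \<beta> where "\<beta> \<xi> = F \<bar>\<xi>\<bar> * cmod (g \<xi>)" for \<xi>
  have [measurable]: "\<alpha> \<in> borel_measurable borel" "\<beta> \<in> borel_measurable borel" unfolding \<alpha>_def[abs_def] \<beta>_def[abs_def] by measurable
  have i\<alpha>: "integrable lborel \<alpha>" using integrable_norm[OF ig(1)] by (simp add: \<alpha>_def[abs_def] norm_mult)
  have i\<beta>: "integrable lborel (\<lambda>\<xi>. (\<beta> \<xi>)\<^sup>2)"
  proof (rule integrable_dominated)
    show "integrable lborel (\<lambda>\<xi>. M\<^sup>2 * (cmod (g \<xi>))\<^sup>2)" using g(2) by (simp add: L2c_def)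
    fix \<xi>
    have "(F \<bar>\<xi>\<bar>)\<^sup>2 \<le> M\<^sup>2" using FM[of "\<bar>\<xi>\<bar>"] nn by (intro power_mono) auto
    then show "norm ((\<beta> \<xi>)\<^sup>2) \<le> M\<^sup>2 * (cmod (g \<xi>))\<^sup>2"
      by (simp add: \<beta>_def power_mult_distrib mult_right_mono)
  qed measurable
  have pos: "0 \<le> \<alpha> \<xi>" "0 \<le> \<beta> \<xi>" for \<xi> by (simp_all add: \<alpha>_def \<beta>_def nn)
  note t1 = trilinear_bound_1[of \<alpha> \<beta> \<beta>, OF i\<alpha> i\<beta> i\<beta>]
   and t2 = trilinear_bound_2[of \<alpha> \<beta> \<beta>, OF i\<alpha> i\<beta> i\<beta>]
   and t3 = trilinear_bound_3[of \<alpha> \<beta> \<beta>, OF i\<alpha> i\<beta> i\<beta>]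
  note T1 = t1(1)[OF _ _ pos(1) pos(2) pos(2), simplified] and T2 = t2(1)[OF _ _ pos(2) pos(1) pos(2), simplified] and T3 = t3(1)[OF _ _ pos(2) pos(2) pos(1), simplified]
  note B1 = t1(2)[OF _ _ pos(1) pos(2) pos(2), simplified] and B2 = t2(2)[OF _ _ pos(2) pos(1) pos(2), simplified] and B3 = t3(2)[OF _ _ pos(2) pos(2) pos(1), simplified]
  let ?T1 = "\<lambda>(x, y). \<alpha> (x - y) * \<beta> y * \<beta> x" and ?T2 = "\<lambda>(x, y). \<beta> (x - y) * \<alpha> y * \<beta> x" and ?T3 = "\<lambda>(x, y). \<beta> (x - y) * \<beta> y * \<alpha> x"
  let ?H = "\<lambda>x y. 3 * comm_const n * (?T1 (x, y) + ?T2 (x, y) + ?T3 (x, y))"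
  have eqH: "(\<lambda>(x, y). ?H x y) = (\<lambda>z. 3 * comm_const n * (?T1 z + ?T2 z + ?T3 z))" by auto
  have iH: "integrable (lborel \<Otimes>\<^sub>M lborel) (\<lambda>(x, y). ?H x y)"
    unfolding eqH using T1 T2 T3 by (intro integrable_mult_right Bochner_Integration.integrable_add) auto
  have "2 * Re (LINT \<xi>|lborel. complex_of_real ((F \<bar>\<xi>\<bar>)\<^sup>2) * conv g (\<lambda>\<eta>. \<i> * complex_of_real \<eta> * g \<eta>) \<xi> * cnj (g \<xi>))
     \<le> integral\<^sup>L (lborel \<Otimes>\<^sub>M lborel) (\<lambda>(x, y). ?H x y)"
  proof (rule transport_energy[OF herm g(1) g(2) ig(2), of "\<lambda>\<xi>. F \<bar>\<xi>\<bar>" M])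
    show "\<bar>F \<bar>\<xi>\<bar>\<bar> \<le> M" for \<xi> using FM[of "\<bar>\<xi>\<bar>"] nn by simp
    show "integrable (lborel \<Otimes>\<^sub>M lborel) (\<lambda>(x, y). ?H x y)" by (rule iH)
    fix \<xi> \<eta>
    have "\<bar>(F \<bar>\<xi>\<bar>)\<^sup>2 * \<eta> - (F \<bar>\<eta>\<bar>)\<^sup>2 * \<xi>\<bar> * (cmod (g (\<xi> - \<eta>)) * cmod (g \<eta>) * cmod (g \<xi>))
      \<le> 3 * comm_const n * (\<bar>\<xi> - \<eta>\<bar> * F \<bar>\<eta>\<bar> * F \<bar>\<xi>\<bar> + F \<bar>\<xi> - \<eta>\<bar> * \<bar>\<eta>\<bar> * F \<bar>\<xi>\<bar> + F \<bar>\<xi> - \<eta>\<bar> * F \<bar>\<eta>\<bar> * \<bar>\<xi>\<bar>)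
         * (cmod (g (\<xi> - \<eta>)) * cmod (g \<eta>) * cmod (g \<xi>))"
      by (rule mult_right_mono[OF slow_weight_symbol[OF F]]) simp
    also have "\<dots> = ?H \<xi> \<eta>" by (simp add: \<alpha>_def \<beta>_def algebra_simps)
    finally show "\<bar>(F \<bar>\<xi>\<bar>)\<^sup>2 * \<eta> - (F \<bar>\<eta>\<bar>)\<^sup>2 * \<xi>\<bar> * (cmod (g (\<xi> - \<eta>)) * cmod (g \<eta>) * cmod (g \<xi>)) \<le> ?H \<xi> \<eta>" .
  qed measurable
  also have "\<dots> = 3 * comm_const n * (integral\<^sup>L (lborel \<Otimes>\<^sub>M lborel) ?T1 + integral\<^sup>L (lborel \<Otimes>\<^sub>M lborel) ?T2 + integral\<^sup>L (lborel \<Otimes>\<^sub>M lborel) ?T3)"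
    unfolding eqH using T1 T2 T3 by simp
  also have "\<dots> \<le> 3 * comm_const n * (3 * ((LINT x|lborel. \<alpha> x) * (LINT x|lborel. (\<beta> x)\<^sup>2)))"
    using B1 B2 B3 comm_const_ge(1)[of n] by (intro mult_left_mono) (auto simp: mult_2[symmetric])
  finally show ?thesis by (simp add: \<alpha>_def \<beta>_def power_mult_distrib mult_ac)
qed

text \<open>For the weight 1 the symbol is \<open>\<eta> - \<xi>\<close>: symmetrisation moves the
  whole derivative from \<open>b\<close> to \<open>a\<close>.\<close>

lemma difference_transport_energy:
  assumes herm: "\<And>\<xi>. a (- \<xi>) = cnj (a \<xi>)" and a: "integrable lborel a" "integrable lborel (\<lambda>\<eta>. \<i> * complex_of_real \<eta> * a \<eta>)"
    and b: "L2c b" "L2c (\<lambda>\<eta>. \<i> * complex_of_real \<eta> * b \<eta>)"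
  shows "2 * Re (LINT \<xi>|lborel. conv a (\<lambda>\<eta>. \<i> * complex_of_real \<eta> * b \<eta>) \<xi> * cnj (b \<xi>))
     \<le> (LINT \<xi>|lborel. \<bar>\<xi>\<bar> * cmod (a \<xi>)) * (LINT \<xi>|lborel. (cmod (b \<xi>))\<^sup>2)"
proof -
  have [measurable]: "a \<in> borel_measurable borel" "b \<in> borel_measurable borel" using a b by (auto simp: L2c_def)
  define \<alpha> where "\<alpha> \<xi> = \<bar>\<xi>\<bar> * cmod (a \<xi>)" for \<xi>
  have i\<alpha>: "integrable lborel \<alpha>" using integrable_norm[OF a(2)] by (simp add: \<alpha>_def[abs_def] norm_mult)
  have ib: "integrable lborel (\<lambda>\<xi>. (cmod (b \<xi>))\<^sup>2)" using b by (simp add: L2c_def)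
  note t1 = trilinear_bound_1[of \<alpha> "\<lambda>\<xi>. cmod (b \<xi>)" "\<lambda>\<xi>. cmod (b \<xi>)", OF i\<alpha> ib ib]
  have n: "0 \<le> \<alpha> \<xi>" for \<xi> by (simp add: \<alpha>_def)
  have "2 * Re (LINT \<xi>|lborel. complex_of_real (1\<^sup>2) * conv a (\<lambda>\<eta>. \<i> * complex_of_real \<eta> * b \<eta>) \<xi> * cnj (b \<xi>))
    \<le> integral\<^sup>L (lborel \<Otimes>\<^sub>M lborel) (\<lambda>(x, y). \<alpha> (x - y) * cmod (b y) * cmod (b x))"
    by (rule transport_energy[OF herm a(1) b, of "\<lambda>_. 1" 1])
       (use t1(1) n in \<open>auto simp: \<alpha>_def abs_minus_commute\<close>)
  also have "\<dots> \<le> (LINT \<xi>|lborel. \<bar>\<xi>\<bar> * cmod (a \<xi>)) * (LINT \<xi>|lborel. (cmod (b \<xi>))\<^sup>2)"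
    using t1(2) n by (simp add: \<alpha>_def[abs_def])
  finally show ?thesis by simp
qed

text \<open>The other nonlinear term of the difference equation. There the derivative already sits
  on the reference solution, so no cancellation is used.\<close>

lemma conv_pairing_bound:
  assumes w: "L2c w" and b: "integrable lborel b"
  shows "\<bar>Re (LINT \<xi>|lborel. conv w b \<xi> * cnj (w \<xi>))\<bar> \<le> (LINT \<xi>|lborel. cmod (b \<xi>)) * (LINT \<xi>|lborel. (cmod (w \<xi>))\<^sup>2)"
proof -
  have [measurable]: "w \<in> borel_measurable borel" "b \<in> borel_measurable borel" using w b by (auto simp: L2c_def)
  have iw: "integrable lborel (\<lambda>\<xi>. (cmod (w \<xi>))\<^sup>2)" and ib: "integrable lborel (\<lambda>\<xi>. cmod (b \<xi>))" using w b by (auto simp: L2c_def)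
  note t2 = trilinear_bound_2[of "\<lambda>\<xi>. cmod (b \<xi>)" "\<lambda>\<xi>. cmod (w \<xi>)" "\<lambda>\<xi>. cmod (w \<xi>)", OF ib iw iw]
  have i: "integrable (lborel \<Otimes>\<^sub>M lborel) (\<lambda>(x, y). w (x - y) * b y * cnj (w x))"
    by (rule Bochner_Integration.integrable_bound[OF t2(1)]) (auto simp: norm_mult)
  have "(LINT \<xi>|lborel. conv w b \<xi> * cnj (w \<xi>)) = integral\<^sup>L (lborel \<Otimes>\<^sub>M lborel) (\<lambda>(x, y). w (x - y) * b y * cnj (w x))"
    unfolding lborel_pair.integral_fst'[OF i, symmetric] by (simp add: conv_def)
  also have "cmod \<dots> \<le> integral\<^sup>L (lborel \<Otimes>\<^sub>M lborel) (\<lambda>(x, y). cmod (w (x - y)) * cmod (b y) * cmod (w x))"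
    by (rule order_trans[OF integral_norm_bound]) (simp add: norm_mult case_prod_unfold)
  also have "\<dots> \<le> (LINT \<xi>|lborel. cmod (b \<xi>)) * (LINT \<xi>|lborel. (cmod (w \<xi>))\<^sup>2)"
    using t2(2) by simp
  finally show ?thesis using abs_Re_le_cmod order_trans by blast
qed

section \<open>Sobolev norms and time derivatives of energies\<close>

definition Hs :: "real \<Rightarrow> (real \<Rightarrow> complex) \<Rightarrow> bool" where
  "Hs s G \<longleftrightarrow> G \<in> borel_measurable borel \<and> integrable lborel (\<lambda>\<xi>. (1 + \<xi>\<^sup>2) powr s * (cmod (G \<xi>))\<^sup>2)"

definition Hs_sq :: "real \<Rightarrow> (real \<Rightarrow> complex) \<Rightarrow> real" where
  "Hs_sq s G = (LINT \<xi>|lborel. (1 + \<xi>\<^sup>2) powr s * (cmod (G \<xi>))\<^sup>2)"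

lemma Hs_sq_nonneg: "0 \<le> Hs_sq s G" by (simp add: Hs_sq_def)

lemma one_plus_square_powr_mono: "r \<le> s \<Longrightarrow> (1 + \<xi>\<^sup>2) powr r \<le> (1 + \<xi>\<^sup>2) powr s" for \<xi> :: real
  by (intro powr_mono) auto

lemma one_plus_square_power_le: "real n \<le> s \<Longrightarrow> (1 + \<xi>\<^sup>2) ^ n \<le> (1 + \<xi>\<^sup>2) powr s" for \<xi> :: real
  using one_plus_square_powr_mono[of "real n" s \<xi>] by (simp add: powr_realpow add_pos_nonneg)

lemma Hs_multiplier:
  assumes G: "Hs s G" and [measurable]: "h \<in> borel_measurable borel" and h: "\<And>\<xi>. (cmod (h \<xi>))\<^sup>2 \<le> (1 + \<xi>\<^sup>2) powr s"
  shows "L2c (\<lambda>\<xi>. h \<xi> * G \<xi>)" and "(LINT \<xi>|lborel. (cmod (h \<xi> * G \<xi>))\<^sup>2) \<le> Hs_sq s G"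
proof -
  have [measurable]: "G \<in> borel_measurable borel" and i: "integrable lborel (\<lambda>\<xi>. (1 + \<xi>\<^sup>2) powr s * (cmod (G \<xi>))\<^sup>2)"
    using G by (auto simp: Hs_def)
  have le: "(cmod (h \<xi> * G \<xi>))\<^sup>2 \<le> (1 + \<xi>\<^sup>2) powr s * (cmod (G \<xi>))\<^sup>2" for \<xi>
    using mult_right_mono[OF h[of \<xi>], of "(cmod (G \<xi>))\<^sup>2"] by (simp add: norm_mult power_mult_distrib)
  have i2: "integrable lborel (\<lambda>\<xi>. (cmod (h \<xi> * G \<xi>))\<^sup>2)"
    by (rule Bochner_Integration.integrable_bound[OF i]) (use le in auto)
  then show "L2c (\<lambda>\<xi>. h \<xi> * G \<xi>)" by (simp add: L2c_def)
  show "(LINT \<xi>|lborel. (cmod (h \<xi> * G \<xi>))\<^sup>2) \<le> Hs_sq s G"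
    unfolding Hs_sq_def by (rule integral_mono[OF i2 i le])
qed

lemma Hs_L2c: assumes "Hs s G" "0 \<le> s" shows "L2c G" and "(LINT \<xi>|lborel. (cmod (G \<xi>))\<^sup>2) \<le> Hs_sq s G"
  using Hs_multiplier[OF assms(1), of "\<lambda>_. 1"] one_plus_square_power_le[of 0 s] assms(2) by auto

lemma power_abs_le_one_plus_square: "n \<le> k \<Longrightarrow> (\<bar>\<xi>\<bar> ^ n)\<^sup>2 \<le> (1 + \<xi>\<^sup>2) ^ k" for \<xi> :: real
proof -
  assume n: "n \<le> k"
  have "(\<bar>\<xi>\<bar> ^ n)\<^sup>2 = (\<xi>\<^sup>2) ^ n" by (metis mult.commute power2_abs power_mult)
  also have "\<dots> \<le> (1 + \<xi>\<^sup>2) ^ n" by (rule power_mono) auto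
  also have "\<dots> \<le> (1 + \<xi>\<^sup>2) ^ k" using n by (intro power_increasing) auto
  finally show ?thesis .
qed

lemma Hs_deriv_L2c:
  assumes "Hs s G" "real n \<le> s" shows "L2c (\<lambda>\<xi>. (\<i> * complex_of_real \<xi>) ^ n * G \<xi>)"
    and "(LINT \<xi>|lborel. (cmod ((\<i> * complex_of_real \<xi>) ^ n * G \<xi>))\<^sup>2) \<le> Hs_sq s G"
proof -
  have "(cmod ((\<i> * complex_of_real \<xi>) ^ n))\<^sup>2 \<le> (1 + \<xi>\<^sup>2) powr s" for \<xi>
    using order_trans[OF power_abs_le_one_plus_square[of n n \<xi>] one_plus_square_power_le[OF assms(2)]]
    by (simp add: norm_power norm_mult)
  then show "L2c (\<lambda>\<xi>. (\<i> * complex_of_real \<xi>) ^ n * G \<xi>)" "(LINT \<xi>|lborel. (cmod ((\<i> * complex_of_real \<xi>) ^ n * G \<xi>))\<^sup>2) \<le> Hs_sq s G"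
    by (intro Hs_multiplier[OF assms(1)]; simp)+
qed

text \<open>The price of passing from weighted \<open>L^2\<close> to \<open>L^1\<close>: one factor
  \<open>1 + \<xi>^2\<close> of the Sobolev weight is spent on integrability.\<close>

definition cauchy_mass :: real where "cauchy_mass = (LINT x|lborel. 1 / (1 + x\<^sup>2))"

lemma cauchy_mass_nonneg: "0 \<le> cauchy_mass"
  unfolding cauchy_mass_def by (intro integral_nonneg_AE AE_I2) auto

text \<open>Instead of Cauchy-Schwarz, the arithmetic-geometric inequality with a free parameter
  \<open>\<theta>\<close>. The value 1 gives a crude bound; choosing \<open>\<theta>\<close> as a
  bound for the norm makes the estimate linear in that bound.\<close>

lemma Hs_integrable_multiplier:
  assumes G: "Hs s G" and s: "2 \<le> s" and [measurable]: "h \<in> borel_measurable borel"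
    and h: "\<And>\<xi>. (cmod (h \<xi>))\<^sup>2 \<le> (1 + \<xi>\<^sup>2) powr (s - 1)"
  shows "integrable lborel (\<lambda>\<xi>. h \<xi> * G \<xi>)"
    and "0 < \<theta> \<Longrightarrow> (LINT \<xi>|lborel. cmod (h \<xi> * G \<xi>)) \<le> (\<theta> * cauchy_mass + Hs_sq s G / \<theta>) / 2"
proof -
  have [measurable]: "G \<in> borel_measurable borel" and i: "integrable lborel (\<lambda>\<xi>. (1 + \<xi>\<^sup>2) powr s * (cmod (G \<xi>))\<^sup>2)"
    using G by (auto simp: Hs_def)
  have le: "cmod (h \<xi> * G \<xi>) \<le> (\<theta> * (1 / (1 + \<xi>\<^sup>2)) + (1 + \<xi>\<^sup>2) powr s * (cmod (G \<xi>))\<^sup>2 / \<theta>) / 2" if "0 < \<theta>" for \<theta> \<xi>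
  proof -
    define q where "q = 1 + \<xi>\<^sup>2"
    have q: "0 < q" by (simp add: q_def add_pos_nonneg)
    define x where "x = cmod (h \<xi> * G \<xi>)"
    have "x\<^sup>2 * q \<le> (q powr (s - 1) * (cmod (G \<xi>))\<^sup>2) * q"
      using mult_right_mono[OF h[of \<xi>], of "(cmod (G \<xi>))\<^sup>2"] q
      by (intro mult_right_mono) (auto simp: x_def q_def norm_mult power_mult_distrib)
    also have "\<dots> = q powr s * (cmod (G \<xi>))\<^sup>2" using q by (simp add: powr_diff)
    finally have 1: "x\<^sup>2 * q / \<theta> \<le> q powr s * (cmod (G \<xi>))\<^sup>2 / \<theta>" using that by (simp add: divide_right_mono)
    \<comment> \<open>The completed square behind
      \<open>2 x \<le> \<theta> / q + x^2 q / \<theta>\<close>.\<close>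
    have "0 \<le> (\<theta> / q - x)\<^sup>2 * (q / \<theta>)" using q that by simp
    also have "\<dots> = \<theta> / q - 2 * x + x\<^sup>2 * q / \<theta>" using q that by (simp add: power2_eq_square field_simps)
    finally show ?thesis using 1 unfolding x_def[symmetric] q_def[symmetric] by simp
  qed
  have iR: "integrable lborel (\<lambda>\<xi>. (\<theta> * (1 / (1 + \<xi>\<^sup>2)) + (1 + \<xi>\<^sup>2) powr s * (cmod (G \<xi>))\<^sup>2 / \<theta>) / 2)" for \<theta>
    using i integrable_inverse_1_plus_square' by (intro integrable_divide Bochner_Integration.integrable_add integrable_mult_right)
  show ih: "integrable lborel (\<lambda>\<xi>. h \<xi> * G \<xi>)"
    by (rule integrable_dominated[OF iR[of 1]]) (use le[of 1] in auto)
  assume t: "0 < \<theta>"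
  have "(LINT \<xi>|lborel. cmod (h \<xi> * G \<xi>)) \<le> (LINT \<xi>|lborel. (\<theta> * (1 / (1 + \<xi>\<^sup>2)) + (1 + \<xi>\<^sup>2) powr s * (cmod (G \<xi>))\<^sup>2 / \<theta>) / 2)"
    by (rule integral_mono[OF integrable_norm[OF ih] iR le[OF t]])
  also have "\<dots> = (\<theta> * cauchy_mass + Hs_sq s G / \<theta>) / 2"
    unfolding cauchy_mass_def Hs_sq_def integral_divide_zero
    using i integrable_inverse_1_plus_square'
    by (subst Bochner_Integration.integral_add) (auto simp del: times_divide_eq_right)
  finally show "(LINT \<xi>|lborel. cmod (h \<xi> * G \<xi>)) \<le> (\<theta> * cauchy_mass + Hs_sq s G / \<theta>) / 2" .
qed

lemma Hs_integrable:
  assumes G: "Hs s G" and s: "2 \<le> s"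
  shows "integrable lborel G" "integrable lborel (\<lambda>\<xi>. \<i> * complex_of_real \<xi> * G \<xi>)"
    and "0 < \<theta> \<Longrightarrow> (LINT \<xi>|lborel. \<bar>\<xi>\<bar> * cmod (G \<xi>)) \<le> (\<theta> * cauchy_mass + Hs_sq s G / \<theta>) / 2"
proof -
  have b1: "(cmod 1)\<^sup>2 \<le> (1 + \<xi>\<^sup>2) powr (s - 1)" for \<xi> :: real
    using one_plus_square_power_le[of 0 "s - 1" \<xi>] s by simp
  have b2: "(cmod (\<i> * complex_of_real \<xi>))\<^sup>2 \<le> (1 + \<xi>\<^sup>2) powr (s - 1)" for \<xi> :: real
    using one_plus_square_power_le[of 1 "s - 1" \<xi>] s by (simp add: norm_mult)
  show "integrable lborel G" using Hs_integrable_multiplier(1)[OF G s, of "\<lambda>_. 1"] b1 by simp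
  show "integrable lborel (\<lambda>\<xi>. \<i> * complex_of_real \<xi> * G \<xi>)" by (rule Hs_integrable_multiplier(1)[OF G s _ b2]) simp
  show "0 < \<theta> \<Longrightarrow> (LINT \<xi>|lborel. \<bar>\<xi>\<bar> * cmod (G \<xi>)) \<le> (\<theta> * cauchy_mass + Hs_sq s G / \<theta>) / 2"
    using Hs_integrable_multiplier(2)[OF G s _ b2] by (simp add: norm_mult)
qed

lemma Hs_diff:
  assumes "Hs s f" "Hs s g" shows "Hs s (\<lambda>\<xi>. f \<xi> - g \<xi>)"
    and "Hs_sq s (\<lambda>\<xi>. f \<xi> - g \<xi>) \<le> 2 * Hs_sq s f + 2 * Hs_sq s g"
proof -
  have [measurable]: "f \<in> borel_measurable borel" "g \<in> borel_measurable borel" using assms by (auto simp: Hs_def)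
  have le: "(1 + \<xi>\<^sup>2) powr s * (cmod (f \<xi> - g \<xi>))\<^sup>2 \<le> 2 * ((1 + \<xi>\<^sup>2) powr s * (cmod (f \<xi>))\<^sup>2) + 2 * ((1 + \<xi>\<^sup>2) powr s * (cmod (g \<xi>))\<^sup>2)" for \<xi>
    using mult_left_mono[OF norm_diff_square_le[of "f \<xi>" "g \<xi>"], of "(1 + \<xi>\<^sup>2) powr s"] by (simp add: algebra_simps)
  have i: "integrable lborel (\<lambda>\<xi>. 2 * ((1 + \<xi>\<^sup>2) powr s * (cmod (f \<xi>))\<^sup>2) + 2 * ((1 + \<xi>\<^sup>2) powr s * (cmod (g \<xi>))\<^sup>2))"
    using assms by (auto simp: Hs_def)
  have i2: "integrable lborel (\<lambda>\<xi>. (1 + \<xi>\<^sup>2) powr s * (cmod (f \<xi> - g \<xi>))\<^sup>2)"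
    by (rule integrable_dominated[OF i]) (use le in auto)
  show "Hs s (\<lambda>\<xi>. f \<xi> - g \<xi>)" using i2 by (simp add: Hs_def)
  have "Hs_sq s (\<lambda>\<xi>. f \<xi> - g \<xi>) \<le> (LINT \<xi>|lborel. 2 * ((1 + \<xi>\<^sup>2) powr s * (cmod (f \<xi>))\<^sup>2) + 2 * ((1 + \<xi>\<^sup>2) powr s * (cmod (g \<xi>))\<^sup>2))"
    unfolding Hs_sq_def by (rule integral_mono[OF i2 i le])
  then show "Hs_sq s (\<lambda>\<xi>. f \<xi> - g \<xi>) \<le> 2 * Hs_sq s f + 2 * Hs_sq s g"
    using assms by (simp add: Hs_def Hs_sq_def)
qed

lemma L2c_weighted_pairing:
  fixes p :: "real \<Rightarrow> real"
  assumes f: "L2c f" and g: "L2c g" and [measurable]: "p \<in> borel_measurable borel" and p: "\<And>\<xi>. 0 \<le> p \<xi>" "\<And>\<xi>. p \<xi> \<le> M"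
  shows "integrable lborel (\<lambda>\<xi>. complex_of_real (p \<xi>) * f \<xi> * cnj (g \<xi>))"
    and "\<bar>Re (LINT \<xi>|lborel. complex_of_real (p \<xi>) * f \<xi> * cnj (g \<xi>))\<bar>
      \<le> M * (sqrt (LINT \<xi>|lborel. (cmod (f \<xi>))\<^sup>2) * sqrt (LINT \<xi>|lborel. (cmod (g \<xi>))\<^sup>2))"
proof -
  have [measurable]: "f \<in> borel_measurable borel" "g \<in> borel_measurable borel" using f g by (auto simp: L2c_def)
  have i: "integrable lborel (\<lambda>\<xi>. f \<xi> * cnj (g \<xi>))" by (rule L2c_mult_integrable[OF f L2c_cnj[OF g]])
  show ip: "integrable lborel (\<lambda>\<xi>. complex_of_real (p \<xi>) * f \<xi> * cnj (g \<xi>))"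
    unfolding mult.assoc by (rule integrable_mult_bounded(2)[OF i]) (use p in auto)
  note CS = integral_Cauchy_Schwarz[of "\<lambda>\<xi>. cmod (f \<xi>)" lborel "\<lambda>\<xi>. cmod (g \<xi>)"]
  have c: "(LINT \<xi>|lborel. cmod (f \<xi>) * cmod (g \<xi>)) \<le> sqrt (LINT \<xi>|lborel. (cmod (f \<xi>))\<^sup>2) * sqrt (LINT \<xi>|lborel. (cmod (g \<xi>))\<^sup>2)"
    unfolding real_sqrt_mult[symmetric] by (rule real_le_rsqrt) (use CS(2) f g in \<open>auto simp: L2c_def\<close>)
  have ic: "integrable lborel (\<lambda>\<xi>. cmod (f \<xi>) * cmod (g \<xi>))" using CS(1) f g by (auto simp: L2c_def)
  have M0: "0 \<le> M" using p order_trans by blast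
  have "\<bar>Re (LINT \<xi>|lborel. complex_of_real (p \<xi>) * f \<xi> * cnj (g \<xi>))\<bar> \<le> cmod (LINT \<xi>|lborel. complex_of_real (p \<xi>) * f \<xi> * cnj (g \<xi>))"
    by (rule abs_Re_le_cmod)
  also have "\<dots> \<le> (LINT \<xi>|lborel. M * (cmod (f \<xi>) * cmod (g \<xi>)))"
  proof (rule order_trans[OF integral_norm_bound integral_mono])
    fix \<xi> show "norm (complex_of_real (p \<xi>) * f \<xi> * cnj (g \<xi>)) \<le> M * (cmod (f \<xi>) * cmod (g \<xi>))"
      using mult_right_mono[OF p(2)[of \<xi>], of "cmod (f \<xi>) * cmod (g \<xi>)"] p(1)[of \<xi>] by (simp add: norm_mult mult.assoc)
  qed (use ip ic in auto)
  also have "\<dots> \<le> M * (sqrt (LINT \<xi>|lborel. (cmod (f \<xi>))\<^sup>2) * sqrt (LINT \<xi>|lborel. (cmod (g \<xi>))\<^sup>2))"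
    using mult_left_mono[OF c M0] by simp
  finally show "\<bar>Re (LINT \<xi>|lborel. complex_of_real (p \<xi>) * f \<xi> * cnj (g \<xi>))\<bar>
      \<le> M * (sqrt (LINT \<xi>|lborel. (cmod (f \<xi>))\<^sup>2) * sqrt (LINT \<xi>|lborel. (cmod (g \<xi>))\<^sup>2))" .
qed

lemma L2c_weighted_integrable:
  fixes p :: "real \<Rightarrow> real"
  assumes g: "L2c g" and [measurable]: "p \<in> borel_measurable borel" and p: "\<And>\<xi>. 0 \<le> p \<xi>" "\<And>\<xi>. p \<xi> \<le> M"
  shows "integrable lborel (\<lambda>\<xi>. p \<xi> * (cmod (g \<xi>))\<^sup>2)"
    and "(LINT \<xi>|lborel. p \<xi> * (cmod (g \<xi>))\<^sup>2) \<le> M * (LINT \<xi>|lborel. (cmod (g \<xi>))\<^sup>2)"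
proof -
  have i: "integrable lborel (\<lambda>\<xi>. (cmod (g \<xi>))\<^sup>2)" using g by (simp add: L2c_def)
  show ip: "integrable lborel (\<lambda>\<xi>. p \<xi> * (cmod (g \<xi>))\<^sup>2)"
    by (rule integrable_mult_bounded(2)[OF i]) (use p in auto)
  have "(LINT \<xi>|lborel. p \<xi> * (cmod (g \<xi>))\<^sup>2) \<le> (LINT \<xi>|lborel. M * (cmod (g \<xi>))\<^sup>2)"
    by (rule integral_mono[OF ip]) (use i p in \<open>auto intro: mult_right_mono\<close>)
  then show "(LINT \<xi>|lborel. p \<xi> * (cmod (g \<xi>))\<^sup>2) \<le> M * (LINT \<xi>|lborel. (cmod (g \<xi>))\<^sup>2)" by simp
qed

text \<open>Writing \<open>g t'\<close> as \<open>g t\<close> plus \<open>t' - t\<close> times the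
  difference quotient expands the energy into a linear and a quadratic term in
  \<open>t' - t\<close>. Because the weight \<open>p\<close> is bounded, convergence of the quotient
  in \<open>L^2\<close> is enough for both.\<close>

lemma energy_derivative:
  fixes g :: "real \<Rightarrow> real \<Rightarrow> complex" and p :: "real \<Rightarrow> real"
  assumes g: "\<And>t'. t' \<in> S \<Longrightarrow> L2c (g t')" and t: "t \<in> S" and d: "L2c d"
    and [measurable]: "p \<in> borel_measurable borel" and p: "\<And>\<xi>. 0 \<le> p \<xi>" "\<And>\<xi>. p \<xi> \<le> M"
    and lim: "((\<lambda>t'. LINT \<xi>|lborel. (cmod ((g t' \<xi> - g t \<xi>) / complex_of_real (t' - t) - d \<xi>))\<^sup>2) \<longlongrightarrow> 0) (at t within S)"
  shows "((\<lambda>t'. LINT \<xi>|lborel. p \<xi> * (cmod (g t' \<xi>))\<^sup>2) has_real_derivative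
     2 * Re (LINT \<xi>|lborel. complex_of_real (p \<xi>) * d \<xi> * cnj (g t \<xi>))) (at t within S)"
proof -
  define E where "E t' = (LINT \<xi>|lborel. p \<xi> * (cmod (g t' \<xi>))\<^sup>2)" for t'
  define D where "D = 2 * Re (LINT \<xi>|lborel. complex_of_real (p \<xi>) * d \<xi> * cnj (g t \<xi>))"
  define \<delta> where "\<delta> t' = (LINT \<xi>|lborel. (cmod ((g t' \<xi> - g t \<xi>) / complex_of_real (t' - t) - d \<xi>))\<^sup>2)" for t'
  define G where "G = (LINT \<xi>|lborel. (cmod (g t \<xi>))\<^sup>2)"
  define N where "N = (LINT \<xi>|lborel. (cmod (d \<xi>))\<^sup>2)"
  have M0: "0 \<le> M" using p order_trans by blast
  \<comment> \<open>The first summand is Cauchy-Schwarz for the error \<open>\<delta> t'\<close> of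
    the difference quotient. The second is the quadratic remainder, with the squared norm of the
    quotient bounded by \<open>2 * \<delta> t' + 2 * N\<close>.\<close>
  have bd: "\<bar>(E t' - E t) / (t' - t) - D\<bar> \<le> 2 * (M * (sqrt (\<delta> t') * sqrt G)) + \<bar>t' - t\<bar> * (M * (2 * \<delta> t' + 2 * N))"
    if t': "t' \<in> S" "t' \<noteq> t" for t'
  proof -
    define h where "h = t' - t"
    have h: "h \<noteq> 0" using t' by (simp add: h_def)
    define q where "q \<xi> = (g t' \<xi> - g t \<xi>) / complex_of_real h" for \<xi>
    have q: "L2c q" unfolding q_def[abs_def]
      using L2c_cmult[OF L2c_diff[OF g[OF t'(1)] g[OF t]], of "1 / complex_of_real h"] by simp
    have qd: "L2c (\<lambda>\<xi>. q \<xi> - d \<xi>)" by (rule L2c_diff[OF q d])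
    have gq: "g t' \<xi> = g t \<xi> + complex_of_real h * q \<xi>" for \<xi> using h by (simp add: q_def)
    have e: "p \<xi> * (cmod (g t' \<xi>))\<^sup>2 - p \<xi> * (cmod (g t \<xi>))\<^sup>2
       = h * (2 * Re (complex_of_real (p \<xi>) * q \<xi> * cnj (g t \<xi>))) + h\<^sup>2 * (p \<xi> * (cmod (q \<xi>))\<^sup>2)" for \<xi>
      unfolding gq cmod_power2 by (simp add: power2_eq_square algebra_simps)
    note w = L2c_weighted_integrable[OF _ _ p]
    have iq: "integrable lborel (\<lambda>\<xi>. complex_of_real (p \<xi>) * q \<xi> * cnj (g t \<xi>))"
      by (rule L2c_weighted_pairing(1)[OF q g[OF t] _ p]) simp
    have id: "integrable lborel (\<lambda>\<xi>. complex_of_real (p \<xi>) * d \<xi> * cnj (g t \<xi>))"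
      by (rule L2c_weighted_pairing(1)[OF d g[OF t] _ p]) simp
    have "E t' - E t = (LINT \<xi>|lborel. p \<xi> * (cmod (g t' \<xi>))\<^sup>2 - p \<xi> * (cmod (g t \<xi>))\<^sup>2)"
      unfolding E_def using w(1)[OF g[OF t]] w(1)[OF g[OF t'(1)]] by simp
    also have "\<dots> = (LINT \<xi>|lborel. h * (2 * Re (complex_of_real (p \<xi>) * q \<xi> * cnj (g t \<xi>)))) + (LINT \<xi>|lborel. h\<^sup>2 * (p \<xi> * (cmod (q \<xi>))\<^sup>2))"
      unfolding e by (intro Bochner_Integration.integral_add integrable_mult_right integrable_Re iq w(1)[OF q]) simp
    also have "\<dots> = h * (2 * Re (LINT \<xi>|lborel. complex_of_real (p \<xi>) * q \<xi> * cnj (g t \<xi>))) + h\<^sup>2 * (LINT \<xi>|lborel. p \<xi> * (cmod (q \<xi>))\<^sup>2)"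
      by (simp only: integral_mult_right_zero integral_Re[OF iq])
    finally have E: "(E t' - E t) / (t' - t) = 2 * Re (LINT \<xi>|lborel. complex_of_real (p \<xi>) * q \<xi> * cnj (g t \<xi>)) + h * (LINT \<xi>|lborel. p \<xi> * (cmod (q \<xi>))\<^sup>2)"
      using h unfolding h_def[symmetric] by (simp add: field_simps power2_eq_square)
    have "Re (LINT \<xi>|lborel. complex_of_real (p \<xi>) * q \<xi> * cnj (g t \<xi>)) - Re (LINT \<xi>|lborel. complex_of_real (p \<xi>) * d \<xi> * cnj (g t \<xi>))
       = Re (LINT \<xi>|lborel. complex_of_real (p \<xi>) * (q \<xi> - d \<xi>) * cnj (g t \<xi>))"
    proof -
      have "(\<lambda>\<xi>. complex_of_real (p \<xi>) * (q \<xi> - d \<xi>) * cnj (g t \<xi>))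
          = (\<lambda>\<xi>. complex_of_real (p \<xi>) * q \<xi> * cnj (g t \<xi>) - complex_of_real (p \<xi>) * d \<xi> * cnj (g t \<xi>))"
        by (simp add: algebra_simps)
      then show ?thesis using Bochner_Integration.integral_diff[OF iq id] by simp
    qed
    moreover have "\<bar>Re (LINT \<xi>|lborel. complex_of_real (p \<xi>) * (q \<xi> - d \<xi>) * cnj (g t \<xi>))\<bar> \<le> M * (sqrt (\<delta> t') * sqrt G)"
      using L2c_weighted_pairing(2)[OF qd g[OF t] _ p] by (simp add: \<delta>_def G_def q_def h_def)
    moreover have "\<bar>h * (LINT \<xi>|lborel. p \<xi> * (cmod (q \<xi>))\<^sup>2)\<bar> \<le> \<bar>h\<bar> * (M * (2 * \<delta> t' + 2 * N))"
    proof -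
      have "(LINT \<xi>|lborel. (cmod (q \<xi>))\<^sup>2) \<le> (LINT \<xi>|lborel. 2 * (cmod (q \<xi> - d \<xi>))\<^sup>2 + 2 * (cmod (d \<xi>))\<^sup>2)"
      proof (rule integral_mono)
        fix \<xi> show "(cmod (q \<xi>))\<^sup>2 \<le> 2 * (cmod (q \<xi> - d \<xi>))\<^sup>2 + 2 * (cmod (d \<xi>))\<^sup>2"
          using norm_add_square_le[of "q \<xi> - d \<xi>" "d \<xi>"] by simp
      qed (use q qd d in \<open>auto simp: L2c_def\<close>)
      also have "\<dots> = 2 * \<delta> t' + 2 * N" using qd d by (simp add: L2c_def \<delta>_def N_def q_def h_def)
      finally have "M * (LINT \<xi>|lborel. (cmod (q \<xi>))\<^sup>2) \<le> M * (2 * \<delta> t' + 2 * N)"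
        by (rule mult_left_mono[OF _ M0])
      then have "(LINT \<xi>|lborel. p \<xi> * (cmod (q \<xi>))\<^sup>2) \<le> M * (2 * \<delta> t' + 2 * N)"
        by (rule order_trans[OF w(2)[OF q], rotated]) simp
      moreover have "0 \<le> (LINT \<xi>|lborel. p \<xi> * (cmod (q \<xi>))\<^sup>2)" using p by simp
      ultimately show ?thesis by (simp add: abs_mult mult_left_mono)
    qed
    ultimately show ?thesis unfolding D_def h_def[symmetric] E[folded h_def] by linarith
  qed
  have "((\<lambda>t'. 2 * (M * (sqrt (\<delta> t') * sqrt G)) + \<bar>t' - t\<bar> * (M * (2 * \<delta> t' + 2 * N))) \<longlongrightarrow> 2 * (M * (sqrt 0 * sqrt G)) + \<bar>t - t\<bar> * (M * (2 * 0 + 2 * N))) (at t within S)"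
    by (intro tendsto_intros lim[folded \<delta>_def])
  then have L: "((\<lambda>t'. 2 * (M * (sqrt (\<delta> t') * sqrt G)) + \<bar>t' - t\<bar> * (M * (2 * \<delta> t' + 2 * N))) \<longlongrightarrow> 0) (at t within S)" by simp
  have "((\<lambda>t'. (E t' - E t) / (t' - t) - D) \<longlongrightarrow> 0) (at t within S)"
    by (rule Lim_null_comparison[OF _ L]) (use bd in \<open>auto simp: eventually_at_filter\<close>)
  then have "((\<lambda>t'. (E t' - E t) / (t' - t)) \<longlongrightarrow> D) (at t within S)" by (simp add: LIM_zero_iff)
  then show ?thesis by (simp add: has_field_derivative_iff E_def D_def)
qed

text \<open>The function \<open>E t * exp (- c * t) - k * t\<close> is nonincreasing.
  Differentiability refers to \<open>T\<close> and the inequality to \<open>\<tau>\<close>, because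
  in the bootstrap the latter is known only up to an intermediate time.\<close>

lemma gronwall:
  fixes E :: "real \<Rightarrow> real"
  assumes E: "\<And>t. t \<in> {0..T} \<Longrightarrow> (E has_real_derivative E' t) (at t within {0..T})"
    and le: "\<And>t. t \<in> {0..\<tau>} \<Longrightarrow> E' t \<le> c * E t + k" and \<tau>: "\<tau> \<le> T" and k: "0 \<le> k" and c: "0 \<le> c" and t: "t \<in> {0..\<tau>}"
  shows "E t \<le> (E 0 + k * t) * exp (c * t)"
proof -
  have "E 0 * exp (- c * 0) - k * 0 \<ge> E t * exp (- c * t) - k * t"
  proof (rule DERIV_nonpos_imp_decreasing_open[of 0 t "\<lambda>t. E t * exp (- c * t) - k * t"])
    fix x assume x: "0 < x" "x < t"
    then have "(E has_real_derivative E' x) (at x)"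
      using E[of x] t \<tau> at_within_interior[of x "{0..T}"] by simp
    then have "((\<lambda>t. E t * exp (- c * t) - k * t) has_real_derivative (E' x - c * E x) * exp (- c * x) - k) (at x)"
      by (auto intro!: derivative_eq_intros simp: algebra_simps)
    moreover have "(E' x - c * E x) * exp (- c * x) \<le> k * 1"
    proof -
      have "(E' x - c * E x) * exp (- c * x) \<le> k * exp (- c * x)"
        using le[of x] x t by (intro mult_right_mono) auto
      also have "\<dots> \<le> k * 1" using x k c by (intro mult_left_mono) auto
      finally show ?thesis .
    qed
    ultimately show "\<exists>y. ((\<lambda>t. E t * exp (- c * t) - k * t) has_real_derivative y) (at x) \<and> y \<le> 0" by force
  next
    have "continuous_on {0..T} E" using E by (intro DERIV_continuous_on) blast
    then show "continuous_on {0..t} (\<lambda>t. E t * exp (- c * t) - k * t)"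
      using t \<tau> by (intro continuous_intros) (auto elim: continuous_on_subset)
  qed (use t in auto)
  then have "E t * exp (- c * t) \<le> E 0 + k * t" by simp
  then have "E t * exp (- c * t) * exp (c * t) \<le> (E 0 + k * t) * exp (c * t)" by (rule mult_right_mono) simp
  then show ?thesis by (simp add: mult.assoc flip: exp_add)
qed

section \<open>Growth of weighted energies and of differences\<close>

definition kdv_rhs :: "real \<Rightarrow> (real \<Rightarrow> complex) \<Rightarrow> real \<Rightarrow> complex" where
  "kdv_rhs \<epsilon> G \<xi> = conv G (\<lambda>\<eta>. \<i> * complex_of_real \<eta> * G \<eta>) \<xi> / complex_of_real (2 * pi)
      + complex_of_real \<epsilon> * ((\<i> * complex_of_real \<xi>) ^ 3 * G \<xi>)"

text \<open>What the energy method uses of a solution: exact Hermitian symmetry, continuity in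
  \<open>H^s\<close>, and the equation with a time derivative in \<open>L^2\<close>. Convergence in
  \<open>H^(s-3)\<close> implies the last since \<open>s \<ge> 3\<close>, and bounded weights ask
  for no more.\<close>

definition fourier_sol :: "real \<Rightarrow> real \<Rightarrow> real \<Rightarrow> (real \<Rightarrow> real \<Rightarrow> complex) \<Rightarrow> bool" where
  "fourier_sol s T \<epsilon> g \<longleftrightarrow>
     (\<forall>t\<in>{0..T}. Hs s (g t) \<and> (\<forall>\<xi>. g t (- \<xi>) = cnj (g t \<xi>))) \<and>
     (\<forall>t\<in>{0..T}. ((\<lambda>t'. Hs_sq s (\<lambda>\<xi>. g t' \<xi> - g t \<xi>)) \<longlongrightarrow> 0) (at t within {0..T})) \<and>
     (\<forall>t\<in>{0..T}. ((\<lambda>t'. LINT \<xi>|lborel. (cmod ((g t' \<xi> - g t \<xi>) / complex_of_real (t' - t) - kdv_rhs \<epsilon> (g t) \<xi>))\<^sup>2)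
        \<longlongrightarrow> 0) (at t within {0..T}))"

lemma Hs_transport_L2c:
  assumes a: "Hs s a" and b: "Hs s b" and s: "3 \<le> s"
  shows "L2c (conv a (\<lambda>\<eta>. \<i> * complex_of_real \<eta> * b \<eta>))"
  by (rule L2c_conv(1)) (use Hs_integrable(1)[OF a] Hs_deriv_L2c(1)[OF b, of 1] s in auto)

lemma Hs_deriv_1: "Hs s b \<Longrightarrow> 3 \<le> s \<Longrightarrow> L2c (\<lambda>\<eta>. \<i> * complex_of_real \<eta> * b \<eta>)"
  using Hs_deriv_L2c(1)[of s b 1] by simp

lemma kdv_rhs_L2c:
  assumes G: "Hs s G" and s: "3 \<le> s" shows "L2c (kdv_rhs \<epsilon> G)"
proof -
  have "L2c (\<lambda>\<xi>. (1 / complex_of_real (2 * pi)) * conv G (\<lambda>\<eta>. \<i> * complex_of_real \<eta> * G \<eta>) \<xi>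
     + complex_of_real \<epsilon> * ((\<i> * complex_of_real \<xi>) ^ 3 * G \<xi>))"
    by (intro L2c_add L2c_cmult Hs_transport_L2c[OF G G s] Hs_deriv_L2c(1)[OF G]) (use s in simp)
  then show ?thesis by (simp add: kdv_rhs_def[abs_def])
qed

text \<open>The cube of \<open>\<i> * \<xi>\<close> is imaginary and \<open>G\<close> times its
  conjugate is real, so the integrand is purely imaginary. Where it is not integrable the integral
  is 0 by convention, and the identity persists.\<close>

lemma Re_dispersive_pairing:
  "Re (LINT \<xi>|lborel. complex_of_real (p \<xi>) * ((\<i> * complex_of_real \<xi>) ^ 3 * G \<xi>) * cnj (G \<xi>)) = 0"
proof -
  define q where "q \<xi> = - p \<xi> * \<xi> ^ 3 * (cmod (G \<xi>))\<^sup>2" for \<xi>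
  have "complex_of_real (p \<xi>) * ((\<i> * complex_of_real \<xi>) ^ 3 * G \<xi>) * cnj (G \<xi>) = \<i> * complex_of_real (q \<xi>)" for \<xi>
  proof -
    have "(\<i> * complex_of_real \<xi>) ^ 3 = - \<i> * complex_of_real (\<xi> ^ 3)" by (simp add: power_mult_distrib power3_eq_cube[of \<i>])
    then show ?thesis using complex_norm_square[of "G \<xi>"] by (simp add: q_def mult_ac)
  qed
  then show ?thesis by (simp only: integral_mult_right_zero integral_complex_of_real) simp
qed

text \<open>Gronwall without source term; the factor \<open>1 / (2 * pi)\<close> is estimated by 1.
  The bound \<open>M\<close> is needed to differentiate the energy but is absent from the rate, so
  the cut-off can be removed later.\<close>

lemma weighted_growth:
  assumes sol: "fourier_sol s T \<epsilon> g" and s: "3 \<le> s"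
    and F: "slow_weight n F" and [measurable]: "F \<in> borel_measurable borel" and FM: "\<And>x. 0 \<le> x \<Longrightarrow> F x \<le> M"
    and \<tau>: "\<tau> \<le> T" and A: "\<And>t. t \<in> {0..\<tau>} \<Longrightarrow> (LINT \<xi>|lborel. \<bar>\<xi>\<bar> * cmod (g t \<xi>)) \<le> A" and t: "t \<in> {0..\<tau>}"
  shows "(LINT \<xi>|lborel. (F \<bar>\<xi>\<bar>)\<^sup>2 * (cmod (g t \<xi>))\<^sup>2) \<le> (LINT \<xi>|lborel. (F \<bar>\<xi>\<bar>)\<^sup>2 * (cmod (g 0 \<xi>))\<^sup>2) * exp (9 * comm_const n * A * t)"
proof -
  define p where "p \<xi> = (F \<bar>\<xi>\<bar>)\<^sup>2" for \<xi>
  have [measurable]: "p \<in> borel_measurable borel" unfolding p_def[abs_def] by measurable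
  have nn: "0 \<le> F \<bar>x\<bar>" for x using F by (simp add: slow_weight_def)
  have p: "0 \<le> p \<xi>" "p \<xi> \<le> M\<^sup>2" for \<xi>
    using FM[of "\<bar>\<xi>\<bar>"] nn[of \<xi>] by (auto simp: p_def intro: power_mono)
  have G: "Hs s (g t)" "\<And>\<xi>. g t (- \<xi>) = cnj (g t \<xi>)" if "t \<in> {0..T}" for t using sol that by (auto simp: fourier_sol_def)
  have A0: "0 \<le> A" using A[of 0] t by (intro order_trans[OF _ A[of 0]]) auto
  define E where "E t = (LINT \<xi>|lborel. p \<xi> * (cmod (g t \<xi>))\<^sup>2)" for t
  define c where "c = 9 * comm_const n * A"
  have c0: "0 \<le> c" using A0 comm_const_ge(1)[of n] by (simp add: c_def)
  have "E t \<le> (E 0 + 0 * t) * exp (c * t)"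
  proof (rule gronwall[of T E "\<lambda>t. 2 * Re (LINT \<xi>|lborel. complex_of_real (p \<xi>) * kdv_rhs \<epsilon> (g t) \<xi> * cnj (g t \<xi>))", OF _ _ \<tau> _ c0 t])
    fix t assume "t \<in> {0..T}"
    then show "(E has_real_derivative 2 * Re (LINT \<xi>|lborel. complex_of_real (p \<xi>) * kdv_rhs \<epsilon> (g t) \<xi> * cnj (g t \<xi>))) (at t within {0..T})"
      unfolding E_def[abs_def]
      by (intro energy_derivative[where M = "M\<^sup>2"] p kdv_rhs_L2c[OF G(1) s])
         (use Hs_L2c(1)[OF G(1)] s sol in \<open>auto simp: fourier_sol_def\<close>)
  next
    fix t assume t: "t \<in> {0..\<tau>}"
    then have tT: "t \<in> {0..T}" using \<tau> by auto
    note H = G(1)[OF tT]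
    let ?N = "conv (g t) (\<lambda>\<eta>. \<i> * complex_of_real \<eta> * g t \<eta>)" and ?Z = "\<lambda>\<xi>. (\<i> * complex_of_real \<xi>) ^ 3 * g t \<xi>"
    have L: "L2c (g t)" by (rule Hs_L2c(1)[OF H]) (use s in simp)
    have iN: "integrable lborel (\<lambda>\<xi>. complex_of_real (p \<xi>) * ?N \<xi> * cnj (g t \<xi>))"
      by (rule L2c_weighted_pairing(1)[OF Hs_transport_L2c[OF H H s] L _ p]) simp
    have iZ: "integrable lborel (\<lambda>\<xi>. complex_of_real (p \<xi>) * ?Z \<xi> * cnj (g t \<xi>))"
      by (rule L2c_weighted_pairing(1)[OF Hs_deriv_L2c(1)[OF H] L _ p]) (use s in simp_all)
    have "(LINT \<xi>|lborel. complex_of_real (p \<xi>) * kdv_rhs \<epsilon> (g t) \<xi> * cnj (g t \<xi>))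
       = (LINT \<xi>|lborel. complex_of_real (1 / (2 * pi)) * (complex_of_real (p \<xi>) * ?N \<xi> * cnj (g t \<xi>))
          + complex_of_real \<epsilon> * (complex_of_real (p \<xi>) * ?Z \<xi> * cnj (g t \<xi>)))"
      by (intro Bochner_Integration.integral_cong refl) (simp add: kdv_rhs_def field_simps)
    also have "\<dots> = complex_of_real (1 / (2 * pi)) * (LINT \<xi>|lborel. complex_of_real (p \<xi>) * ?N \<xi> * cnj (g t \<xi>))
         + complex_of_real \<epsilon> * (LINT \<xi>|lborel. complex_of_real (p \<xi>) * ?Z \<xi> * cnj (g t \<xi>))"
      unfolding integral_mult_right_zero[symmetric]
      by (intro Bochner_Integration.integral_add integrable_mult_right iN iZ)
    finally have "2 * Re (LINT \<xi>|lborel. complex_of_real (p \<xi>) * kdv_rhs \<epsilon> (g t) \<xi> * cnj (g t \<xi>))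
      = (1 / (2 * pi)) * (2 * Re (LINT \<xi>|lborel. complex_of_real (p \<xi>) * ?N \<xi> * cnj (g t \<xi>)))"
      using Re_dispersive_pairing[of p "g t"] by (simp del: of_real_divide of_real_mult)
    also have "\<dots> \<le> (1 / (2 * pi)) * (9 * comm_const n * (LINT \<xi>|lborel. \<bar>\<xi>\<bar> * cmod (g t \<xi>)) * E t)"
      unfolding E_def p_def
      by (intro mult_left_mono weighted_transport_energy[OF F _ FM G(2)[OF tT] Hs_integrable(1)[OF H] L Hs_integrable(2)[OF H] Hs_deriv_1[OF H s]])
         (use s in auto)
    also have "\<dots> \<le> (1 / (2 * pi)) * (9 * comm_const n * A * E t)"
    proof -
      have "0 \<le> E t" unfolding E_def using p by simp
      then show ?thesis using A[OF t] comm_const_ge(1)[of n] by (intro mult_left_mono mult_right_mono) auto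
    qed
    also have "\<dots> \<le> 1 * (9 * comm_const n * A * E t)"
    proof (rule mult_right_mono)
      show "1 / (2 * pi) \<le> 1" using pi_gt3 by simp
      have "0 \<le> E t" unfolding E_def using p by simp
      then show "0 \<le> 9 * comm_const n * A * E t" using c0 by (simp add: c_def)
    qed
    finally show "2 * Re (LINT \<xi>|lborel. complex_of_real (p \<xi>) * kdv_rhs \<epsilon> (g t) \<xi> * cnj (g t \<xi>)) \<le> c * E t + 0"
      by (simp add: c_def)
  qed simp
  then show ?thesis by (simp add: E_def p_def c_def)
qed

text \<open>The splitting is asymmetric on purpose: the term with
  \<open>\<epsilon> - \<epsilon>'\<close> has its third derivative on \<open>b\<close>, the
  reference solution, while the third derivative of the difference comes with the coefficient
  \<open>\<epsilon>\<close> and drops out of the energy.\<close>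

lemma kdv_rhs_diff:
  assumes a: "Hs s a" and b: "Hs s b" and s: "3 \<le> s"
  shows "kdv_rhs \<epsilon> a \<xi> - kdv_rhs \<epsilon>' b \<xi> =
     (conv a (\<lambda>\<eta>. \<i> * complex_of_real \<eta> * (a \<eta> - b \<eta>)) \<xi> + conv (\<lambda>\<eta>. a \<eta> - b \<eta>) (\<lambda>\<eta>. \<i> * complex_of_real \<eta> * b \<eta>) \<xi>) / complex_of_real (2 * pi)
     + complex_of_real \<epsilon> * ((\<i> * complex_of_real \<xi>) ^ 3 * (a \<xi> - b \<xi>)) + complex_of_real (\<epsilon> - \<epsilon>') * ((\<i> * complex_of_real \<xi>) ^ 3 * b \<xi>)"
proof -
  have L: "L2c a" "L2c b" using Hs_L2c(1) a b s by auto
  have D: "L2c (\<lambda>\<eta>. \<i> * complex_of_real \<eta> * a \<eta>)" "L2c (\<lambda>\<eta>. \<i> * complex_of_real \<eta> * b \<eta>)"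
    using Hs_deriv_1 a b s by auto
  have 1: "conv a (\<lambda>\<eta>. \<i> * complex_of_real \<eta> * (a \<eta> - b \<eta>)) \<xi>
     = conv a (\<lambda>\<eta>. \<i> * complex_of_real \<eta> * a \<eta>) \<xi> - conv a (\<lambda>\<eta>. \<i> * complex_of_real \<eta> * b \<eta>) \<xi>"
    unfolding right_diff_distrib by (rule conv_diff_right[OF L(1) D])
  have 2: "conv (\<lambda>\<eta>. a \<eta> - b \<eta>) (\<lambda>\<eta>. \<i> * complex_of_real \<eta> * b \<eta>) \<xi>
     = conv a (\<lambda>\<eta>. \<i> * complex_of_real \<eta> * b \<eta>) \<xi> - conv b (\<lambda>\<eta>. \<i> * complex_of_real \<eta> * b \<eta>) \<xi>"
    by (rule conv_diff_left[OF L D(2)])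
  show ?thesis unfolding 1 2 kdv_rhs_def by (simp add: add_divide_distrib diff_divide_distrib algebra_simps)
qed

lemma difference_growth:
  assumes sol: "fourier_sol s T \<epsilon> g" "fourier_sol s T \<epsilon>' g'" and s: "3 \<le> s"
    and init: "AE \<xi> in lborel. g 0 \<xi> = g' 0 \<xi>"
    and \<tau>: "\<tau> \<le> T" and A: "\<And>t. t \<in> {0..\<tau>} \<Longrightarrow> (LINT \<xi>|lborel. \<bar>\<xi>\<bar> * cmod (g t \<xi>)) \<le> A"
    and A': "\<And>t. t \<in> {0..\<tau>} \<Longrightarrow> (LINT \<xi>|lborel. \<bar>\<xi>\<bar> * cmod (g' t \<xi>)) \<le> A"
    and K: "\<And>t. t \<in> {0..\<tau>} \<Longrightarrow> Hs_sq s (g' t) \<le> K" and t: "t \<in> {0..\<tau>}"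
  shows "(LINT \<xi>|lborel. (cmod (g t \<xi> - g' t \<xi>))\<^sup>2) \<le> (\<epsilon> - \<epsilon>')\<^sup>2 * K * t * exp ((3 * A + 1) * t)"
proof -
  have G: "Hs s (g t)" "\<And>\<xi>. g t (- \<xi>) = cnj (g t \<xi>)" and G': "Hs s (g' t)" "\<And>\<xi>. g' t (- \<xi>) = cnj (g' t \<xi>)"
    if "t \<in> {0..T}" for t using sol that by (auto simp: fourier_sol_def)
  define w where "w t \<xi> = g t \<xi> - g' t \<xi>" for t \<xi>
  have W: "Hs s (w t)" "L2c (w t)" if "t \<in> {0..T}" for t
    unfolding w_def[abs_def] using Hs_diff(1)[OF G(1)[OF that] G'(1)[OF that]] Hs_L2c(1) s by auto
  have A0: "0 \<le> A" using t by (intro order_trans[OF _ A[of 0]]) auto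
  have K0: "0 \<le> K" using t by (intro order_trans[OF Hs_sq_nonneg K[of 0]]) auto
  define r where "r t \<xi> = kdv_rhs \<epsilon> (g t) \<xi> - kdv_rhs \<epsilon>' (g' t) \<xi>" for t \<xi>
  have R: "L2c (kdv_rhs \<epsilon> (g t))" "L2c (kdv_rhs \<epsilon>' (g' t))" "L2c (r t)" if "t \<in> {0..T}" for t
    unfolding r_def[abs_def] by (intro L2c_diff kdv_rhs_L2c[OF G(1)[OF that] s] kdv_rhs_L2c[OF G'(1)[OF that] s])+
  define E where "E t = (LINT \<xi>|lborel. 1 * (cmod (w t \<xi>))\<^sup>2)" for t
  have lim: "((\<lambda>t'. LINT \<xi>|lborel. (cmod ((w t' \<xi> - w t \<xi>) / complex_of_real (t' - t) - r t \<xi>))\<^sup>2) \<longlongrightarrow> 0) (at t within {0..T})"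
    if tT: "t \<in> {0..T}" for t
  proof -
    let ?q = "\<lambda>t' \<xi>. (g t' \<xi> - g t \<xi>) / complex_of_real (t' - t) - kdv_rhs \<epsilon> (g t) \<xi>"
    let ?q' = "\<lambda>t' \<xi>. (g' t' \<xi> - g' t \<xi>) / complex_of_real (t' - t) - kdv_rhs \<epsilon>' (g' t) \<xi>"
    have l: "((\<lambda>t'. LINT \<xi>|lborel. (cmod (?q t' \<xi>))\<^sup>2) \<longlongrightarrow> 0) (at t within {0..T})"
      "((\<lambda>t'. LINT \<xi>|lborel. (cmod (?q' t' \<xi>))\<^sup>2) \<longlongrightarrow> 0) (at t within {0..T})"
      using sol tT by (auto simp: fourier_sol_def)
    have l2: "((\<lambda>t'. 2 * (LINT \<xi>|lborel. (cmod (?q t' \<xi>))\<^sup>2) + 2 * (LINT \<xi>|lborel. (cmod (?q' t' \<xi>))\<^sup>2)) \<longlongrightarrow> 0) (at t within {0..T})"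
      by (rule tendsto_eq_intros l refl | simp)+
    have "(LINT \<xi>|lborel. (cmod ((w t' \<xi> - w t \<xi>) / complex_of_real (t' - t) - r t \<xi>))\<^sup>2)
       \<le> 2 * (LINT \<xi>|lborel. (cmod (?q t' \<xi>))\<^sup>2) + 2 * (LINT \<xi>|lborel. (cmod (?q' t' \<xi>))\<^sup>2)" if t': "t' \<in> {0..T}" for t'
    proof -
      have L: "L2c (?q t')" "L2c (?q' t')"
        using L2c_cmult[OF L2c_diff[OF Hs_L2c(1)[OF G(1)[OF t']] Hs_L2c(1)[OF G(1)[OF tT]]], of "1 / complex_of_real (t' - t)"]
          L2c_cmult[OF L2c_diff[OF Hs_L2c(1)[OF G'(1)[OF t']] Hs_L2c(1)[OF G'(1)[OF tT]]], of "1 / complex_of_real (t' - t)"] s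
        by (auto intro!: L2c_diff R[OF tT])
      have e: "(w t' \<xi> - w t \<xi>) / complex_of_real (t' - t) - r t \<xi> = ?q t' \<xi> - ?q' t' \<xi>" for \<xi>
        by (simp add: w_def r_def diff_divide_distrib)
      have "(LINT \<xi>|lborel. (cmod (?q t' \<xi> - ?q' t' \<xi>))\<^sup>2) \<le> (LINT \<xi>|lborel. 2 * (cmod (?q t' \<xi>))\<^sup>2 + 2 * (cmod (?q' t' \<xi>))\<^sup>2)"
        using L L2c_diff[OF L] by (intro integral_mono norm_diff_square_le) (auto simp: L2c_def)
      also have "\<dots> = 2 * (LINT \<xi>|lborel. (cmod (?q t' \<xi>))\<^sup>2) + 2 * (LINT \<xi>|lborel. (cmod (?q' t' \<xi>))\<^sup>2)"
        using L by (simp add: L2c_def)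
      finally show ?thesis unfolding e .
    qed
    then have "\<forall>\<^sub>F t' in at t within {0..T}. (LINT \<xi>|lborel. (cmod ((w t' \<xi> - w t \<xi>) / complex_of_real (t' - t) - r t \<xi>))\<^sup>2)
       \<le> 2 * (LINT \<xi>|lborel. (cmod (?q t' \<xi>))\<^sup>2) + 2 * (LINT \<xi>|lborel. (cmod (?q' t' \<xi>))\<^sup>2)"
      by (auto simp: eventually_at_filter)
    then show ?thesis by (rule tendsto_sandwich[OF _ _ tendsto_const l2, rotated]) simp
  qed
  \<comment> \<open>The rate collects \<open>A\<close> from the transport of the difference,
    \<open>2 * A\<close> from the term with the derivative on \<open>g'\<close>, and 1 from
    splitting the pairing with the source.\<close>
  have "E t \<le> (E 0 + (\<epsilon> - \<epsilon>')\<^sup>2 * K * t) * exp ((3 * A + 1) * t)"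
  proof (rule gronwall[of T E "\<lambda>t. 2 * Re (LINT \<xi>|lborel. complex_of_real 1 * r t \<xi> * cnj (w t \<xi>))" \<tau> "3 * A + 1" "(\<epsilon> - \<epsilon>')\<^sup>2 * K" t])
    fix t assume "t \<in> {0..T}"
    then show "(E has_real_derivative 2 * Re (LINT \<xi>|lborel. complex_of_real 1 * r t \<xi> * cnj (w t \<xi>))) (at t within {0..T})"
      unfolding E_def[abs_def]
      by (intro energy_derivative[where M = 1]) (use W R lim in auto)
  next
    fix t assume t: "t \<in> {0..\<tau>}"
    then have tT: "t \<in> {0..T}" using \<tau> by auto
    note H = G(1)[OF tT] and H' = G'(1)[OF tT] and Hw = W(1)[OF tT]
    let ?N1 = "conv (g t) (\<lambda>\<eta>. \<i> * complex_of_real \<eta> * w t \<eta>)" and ?N2 = "conv (w t) (\<lambda>\<eta>. \<i> * complex_of_real \<eta> * g' t \<eta>)"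
      and ?Z = "\<lambda>\<xi>. (\<i> * complex_of_real \<xi>) ^ 3 * w t \<xi>" and ?Z' = "\<lambda>\<xi>. (\<i> * complex_of_real \<xi>) ^ 3 * g' t \<xi>"
    have Z': "L2c ?Z'" "L2c ?Z" using Hs_deriv_L2c(1)[OF H', of 3] Hs_deriv_L2c(1)[OF Hw, of 3] s by auto
    have i: "integrable lborel (\<lambda>\<xi>. f \<xi> * cnj (w t \<xi>))" if "L2c f" for f
      by (rule L2c_mult_integrable[OF that L2c_cnj[OF W(2)[OF tT]]])
    define I where "I f = Re (LINT \<xi>|lborel. f \<xi> * cnj (w t \<xi>))" for f
    have E0: "0 \<le> E t" by (simp add: E_def)
    have "(LINT \<xi>|lborel. complex_of_real 1 * r t \<xi> * cnj (w t \<xi>)) =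
      (LINT \<xi>|lborel. complex_of_real (1 / (2 * pi)) * (?N1 \<xi> * cnj (w t \<xi>)) + complex_of_real (1 / (2 * pi)) * (?N2 \<xi> * cnj (w t \<xi>))
        + complex_of_real \<epsilon> * (?Z \<xi> * cnj (w t \<xi>)) + complex_of_real (\<epsilon> - \<epsilon>') * (?Z' \<xi> * cnj (w t \<xi>)))"
      unfolding r_def kdv_rhs_diff[OF H H' s] w_def[symmetric]
      by (intro Bochner_Integration.integral_cong refl) (simp add: add_divide_distrib algebra_simps)
    also have "\<dots> = complex_of_real (1 / (2 * pi)) * (LINT \<xi>|lborel. ?N1 \<xi> * cnj (w t \<xi>)) + complex_of_real (1 / (2 * pi)) * (LINT \<xi>|lborel. ?N2 \<xi> * cnj (w t \<xi>))
        + complex_of_real \<epsilon> * (LINT \<xi>|lborel. ?Z \<xi> * cnj (w t \<xi>)) + complex_of_real (\<epsilon> - \<epsilon>') * (LINT \<xi>|lborel. ?Z' \<xi> * cnj (w t \<xi>))"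
      unfolding integral_mult_right_zero[symmetric]
      by (subst Bochner_Integration.integral_add | intro Bochner_Integration.integrable_add integrable_mult_right i Z' Hs_transport_L2c[OF H Hw s] Hs_transport_L2c[OF Hw H' s] | rule refl)+
    finally have "2 * Re (LINT \<xi>|lborel. complex_of_real 1 * r t \<xi> * cnj (w t \<xi>))
      = (1 / (2 * pi)) * (2 * I ?N1 + 2 * I ?N2) + 2 * \<epsilon> * I ?Z + 2 * (\<epsilon> - \<epsilon>') * I ?Z'"
      by (simp add: I_def algebra_simps del: of_real_divide of_real_mult of_real_diff)
    also have "I ?Z = 0" using Re_dispersive_pairing[of "\<lambda>_. 1" "w t"] by (simp add: I_def)
    also have "(1 / (2 * pi)) * (2 * I ?N1 + 2 * I ?N2) \<le> 3 * A * E t"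
    proof -
      have "2 * I ?N1 \<le> (LINT \<xi>|lborel. \<bar>\<xi>\<bar> * cmod (g t \<xi>)) * E t"
        using difference_transport_energy[OF G(2)[OF tT] Hs_integrable(1,2)[OF H] W(2)[OF tT] Hs_deriv_1[OF Hw s]] s
        by (simp add: I_def E_def)
      also have "\<dots> \<le> A * E t" by (rule mult_right_mono[OF A[OF t] E0])
      finally have 1: "2 * I ?N1 \<le> A * E t" .
      have "I ?N2 \<le> (LINT \<xi>|lborel. \<bar>\<xi>\<bar> * cmod (g' t \<xi>)) * E t"
        using conv_pairing_bound[OF W(2)[OF tT] Hs_integrable(2)[OF H']] s
        by (simp add: I_def E_def norm_mult)
      also have "\<dots> \<le> A * E t" by (rule mult_right_mono[OF A'[OF t] E0])
      finally have 2: "2 * I ?N1 + 2 * I ?N2 \<le> 3 * A * E t" using 1 by simp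
      have AE: "0 \<le> 3 * A * E t" using A0 E0 by simp
      have "(1 / (2 * pi)) * (2 * I ?N1 + 2 * I ?N2) \<le> (1 / (2 * pi)) * (3 * A * E t)"
        by (rule mult_left_mono[OF 2]) simp
      also have "\<dots> \<le> 1 * (3 * A * E t)" by (rule mult_right_mono[OF _ AE]) (use pi_gt3 in simp)
      finally show ?thesis by simp
    qed
    \<comment> \<open>Since \<open>s \<ge> 3\<close>, the third derivative of \<open>g'\<close> has
      \<open>L^2\<close> norm at most \<open>sqrt K\<close>; then
      \<open>2 x y \<le> x^2 + y^2\<close> separates the source from the energy.\<close>
    also have "2 * (\<epsilon> - \<epsilon>') * I ?Z' \<le> (\<epsilon> - \<epsilon>')\<^sup>2 * K + E t"
    proof -
      have "\<bar>I ?Z'\<bar> \<le> sqrt (LINT \<xi>|lborel. (cmod (?Z' \<xi>))\<^sup>2) * sqrt (E t)"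
        using L2c_weighted_pairing(2)[OF Z'(1) W(2)[OF tT], of "\<lambda>_. 1" 1] by (simp add: I_def E_def)
      also have "\<dots> \<le> sqrt K * sqrt (E t)"
        using Hs_deriv_L2c(2)[OF H', of 3] K[OF t] s E0 by (intro mult_right_mono real_sqrt_le_mono) auto
      finally have *: "\<bar>I ?Z'\<bar> \<le> sqrt K * sqrt (E t)" .
      have "2 * (\<epsilon> - \<epsilon>') * I ?Z' \<le> 2 * (\<bar>\<epsilon> - \<epsilon>'\<bar> * \<bar>I ?Z'\<bar>)" unfolding mult.assoc abs_mult[symmetric] by (intro mult_left_mono) simp_all
      also have "\<dots> \<le> 2 * (\<bar>\<epsilon> - \<epsilon>'\<bar> * (sqrt K * sqrt (E t)))" using * by (intro mult_left_mono) auto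
      also have "\<dots> = 2 * (\<bar>\<epsilon> - \<epsilon>'\<bar> * sqrt K) * sqrt (E t)" by simp
      also have "\<dots> \<le> (\<bar>\<epsilon> - \<epsilon>'\<bar> * sqrt K)\<^sup>2 + (sqrt (E t))\<^sup>2" by (rule sum_squares_bound)
      also have "\<dots> = (\<epsilon> - \<epsilon>')\<^sup>2 * K + E t" using K0 E0 by (simp add: power_mult_distrib)
      finally show ?thesis .
    qed
    finally show "2 * Re (LINT \<xi>|lborel. complex_of_real 1 * r t \<xi> * cnj (w t \<xi>)) \<le> (3 * A + 1) * E t + (\<epsilon> - \<epsilon>')\<^sup>2 * K"
      by (simp add: algebra_simps)
  qed (use A0 K0 \<tau> t in auto)
  moreover have "E 0 = 0"
  proof -
    have "0 \<in> {0..T}" using t \<tau> by auto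
    then have [measurable]: "w 0 \<in> borel_measurable borel" using W(2) by (auto simp: L2c_def)
    have "AE \<xi> in lborel. w 0 \<xi> = 0" using init by (auto simp: w_def)
    then have "E 0 = (LINT \<xi>|(lborel :: real measure). 0)" unfolding E_def
      by (intro integral_cong_AE) (auto elim!: eventually_mono)
    then show ?thesis by simp
  qed
  ultimately show ?thesis by (simp add: E_def w_def)
qed

section \<open>Uniform control of high frequencies\<close>

text \<open>The cut-off at \<open>K\<close> keeps the weight bounded, because the time derivative is only known to lie in \<open>H\<^sup>s\<^sup>-\<^sup>3\<close>.
  The factor \<open>min 1 (x / R)\<close> makes the initial energy small for large \<open>R\<close>, which turns the energy estimate
  into a bound on the high frequencies that is uniform in \<open>\<epsilon>\<close>.\<close>

definition trunc_weight :: "real \<Rightarrow> real \<Rightarrow> real \<Rightarrow> real \<Rightarrow> real" where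
  "trunc_weight s R K x = min K ((1 + x\<^sup>2) powr (s / 2) * min 1 (x / R))"

text \<open>Scaling by \<open>l\<close> costs at most \<open>l powr s\<close> in the Sobolev factor
  and one more \<open>l\<close> in \<open>min 1 (x / R)\<close>, hence \<open>s + 1 \<le> n\<close>.
  The truncation respects this because \<open>K \<le> l ^ n * K\<close>.\<close>

lemma slow_weight_trunc:
  assumes s: "0 \<le> s" "s + 1 \<le> real n" and R: "0 < R" and K: "0 \<le> K"
  shows "slow_weight n (trunc_weight s R K)"
  unfolding slow_weight_def
proof (intro conjI allI impI)
  fix x :: real assume x: "0 \<le> x"
  show "0 \<le> trunc_weight s R K x" using x R K by (simp add: trunc_weight_def)
next
  fix x y :: real assume x: "0 \<le> x" "x \<le> y"
  have "(1 + x\<^sup>2) powr (s / 2) * min 1 (x / R) \<le> (1 + y\<^sup>2) powr (s / 2) * min 1 (y / R)"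
  proof (rule mult_mono)
    show "(1 + x\<^sup>2) powr (s / 2) \<le> (1 + y\<^sup>2) powr (s / 2)"
      using x s by (intro powr_mono2) (auto intro: power_mono)
    show "min 1 (x / R) \<le> min 1 (y / R)" using x R by (auto simp: divide_right_mono min_def dest: order_trans)
  qed (use x R in auto)
  then show "trunc_weight s R K x \<le> trunc_weight s R K y" unfolding trunc_weight_def by (rule min.mono[OF order_refl])
next
  fix x l :: real assume x: "0 \<le> x" and l: "1 \<le> l"
  define X where "X = (1 + x\<^sup>2) powr (s / 2) * min 1 (x / R)"
  have X0: "0 \<le> X" using x R by (simp add: X_def)
  have "(1 + (l * x)\<^sup>2) powr (s / 2) \<le> (l\<^sup>2 * (1 + x\<^sup>2)) powr (s / 2)"
    using l s one_le_power[OF l, of 2] by (intro powr_mono2) (auto simp: algebra_simps power_mult_distrib)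
  also have "\<dots> = (l\<^sup>2) powr (s / 2) * (1 + x\<^sup>2) powr (s / 2)" using l by (simp add: powr_mult)
  also have "(l\<^sup>2) powr (s / 2) = l powr s"
    using l by (simp add: powr_powr flip: powr_numeral)
  finally have 1: "(1 + (l * x)\<^sup>2) powr (s / 2) \<le> l powr s * (1 + x\<^sup>2) powr (s / 2)" .
  have "min 1 (l * x / R) \<le> min l (l * x / R)" using l by (intro min.mono) auto
  also have "\<dots> = l * min 1 (x / R)" using l by (simp add: min_mult_distrib_left)
  finally have 2: "min 1 (l * x / R) \<le> l * min 1 (x / R)" .
  have "(1 + (l * x)\<^sup>2) powr (s / 2) * min 1 (l * x / R) \<le> (l powr s * (1 + x\<^sup>2) powr (s / 2)) * (l * min 1 (x / R))"
    by (rule mult_mono[OF 1 2]) (use x l R in auto)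
  also have "\<dots> = l powr (s + 1) * X" using l by (simp add: X_def powr_add mult_ac)
  also have "\<dots> \<le> l ^ n * X"
  proof (rule mult_right_mono[OF _ X0])
    have "l powr (s + 1) \<le> l powr real n" using s l by (intro powr_mono) auto
    then show "l powr (s + 1) \<le> l ^ n" using l by (simp add: powr_realpow)
  qed
  finally have "(1 + (l * x)\<^sup>2) powr (s / 2) * min 1 (l * x / R) \<le> l ^ n * X" .
  moreover have "K \<le> l ^ n * K" using one_le_power[OF l, of n] K by (simp add: mult_le_cancel_right1)
  ultimately have "trunc_weight s R K (l * x) \<le> min (l ^ n * K) (l ^ n * X)"
    unfolding trunc_weight_def by (intro min.mono)
  also have "\<dots> = l ^ n * trunc_weight s R K x"
    using l by (simp add: trunc_weight_def X_def min_mult_distrib_left)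
  finally show "trunc_weight s R K (l * x) \<le> l ^ n * trunc_weight s R K x" .
qed

text \<open>A ramp rather than the indicator of the high frequencies, because a jump would violate
  the growth condition of \<open>slow_weight\<close>. Above \<open>R\<close> it still carries the
  full \<open>H^s\<close> weight.\<close>

definition tail_sq :: "real \<Rightarrow> real \<Rightarrow> (real \<Rightarrow> complex) \<Rightarrow> real" where
  "tail_sq s R G = (LINT \<xi>|lborel. (1 + \<xi>\<^sup>2) powr s * (min 1 (\<bar>\<xi>\<bar> / R))\<^sup>2 * (cmod (G \<xi>))\<^sup>2)"

lemma tail_weight_le: "0 < R \<Longrightarrow> (1 + \<xi>\<^sup>2) powr s * (min 1 (\<bar>\<xi>\<bar> / R))\<^sup>2 \<le> (1 + \<xi>\<^sup>2) powr s" for \<xi> :: real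
  by (rule mult_left_le) (auto intro!: power_le_one)

lemma tail_integrable:
  assumes "Hs s G" "0 < R"
  shows "integrable lborel (\<lambda>\<xi>. (1 + \<xi>\<^sup>2) powr s * (min 1 (\<bar>\<xi>\<bar> / R))\<^sup>2 * (cmod (G \<xi>))\<^sup>2)"
proof -
  have [measurable]: "G \<in> borel_measurable borel" using assms by (simp add: Hs_def)
  show ?thesis
  proof (rule integrable_dominated)
    show "integrable lborel (\<lambda>\<xi>. (1 + \<xi>\<^sup>2) powr s * (cmod (G \<xi>))\<^sup>2)" using assms by (simp add: Hs_def)
    show "norm ((1 + \<xi>\<^sup>2) powr s * (min 1 (\<bar>\<xi>\<bar> / R))\<^sup>2 * (cmod (G \<xi>))\<^sup>2) \<le> (1 + \<xi>\<^sup>2) powr s * (cmod (G \<xi>))\<^sup>2" for \<xi>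
      using mult_right_mono[OF tail_weight_le[OF assms(2), of \<xi> s], of "(cmod (G \<xi>))\<^sup>2"] by (simp add: abs_mult)
  qed measurable
qed

lemma trunc_weight_untruncated_square:
  "((1 + \<xi>\<^sup>2) powr (s / 2) * min 1 (\<bar>\<xi>\<bar> / R))\<^sup>2 = (1 + \<xi>\<^sup>2) powr s * (min 1 (\<bar>\<xi>\<bar> / R))\<^sup>2" for \<xi> :: real
  by (simp add: power_mult_distrib powr_powr flip: powr_numeral)

lemma trunc_weight_square:
  assumes "0 < R" "0 \<le> K"
  shows "(trunc_weight s R K \<bar>\<xi>\<bar>)\<^sup>2 \<le> (1 + \<xi>\<^sup>2) powr s * (min 1 (\<bar>\<xi>\<bar> / R))\<^sup>2"
  unfolding trunc_weight_untruncated_square[symmetric]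
  by (intro power_mono) (use assms in \<open>auto simp: trunc_weight_def\<close>)

lemma trunc_weight_square_eventually:
  "\<forall>\<^sub>F k in sequentially. (trunc_weight s R (real k) \<bar>\<xi>\<bar>)\<^sup>2 = (1 + \<xi>\<^sup>2) powr s * (min 1 (\<bar>\<xi>\<bar> / R))\<^sup>2"
proof -
  obtain N where "(1 + \<xi>\<^sup>2) powr (s / 2) * min 1 (\<bar>\<xi>\<bar> / R) \<le> real N" using real_arch_simple by blast
  then have "\<forall>k\<ge>N. trunc_weight s R (real k) \<bar>\<xi>\<bar> = (1 + \<xi>\<^sup>2) powr (s / 2) * min 1 (\<bar>\<xi>\<bar> / R)"
    by (simp add: trunc_weight_def min_absorb2)
  then show ?thesis
    unfolding trunc_weight_untruncated_square[symmetric] eventually_sequentially by metis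
qed

text \<open>Every truncated weight obeys the same bound, and the truncated energies of the initial
  value are at most the full tail. Dominated convergence then lets the truncation tend to
  infinity.\<close>

lemma tail_growth:
  assumes sol: "fourier_sol s T \<epsilon> g" and s: "3 \<le> s" "s + 1 \<le> real n" and R: "0 < R"
    and \<tau>: "\<tau> \<le> T" and A: "\<And>t. t \<in> {0..\<tau>} \<Longrightarrow> (LINT \<xi>|lborel. \<bar>\<xi>\<bar> * cmod (g t \<xi>)) \<le> A" and t: "t \<in> {0..\<tau>}"
  shows "tail_sq s R (g t) \<le> tail_sq s R (g 0) * exp (9 * comm_const n * A * t)"
proof -
  let ?F = "\<lambda>k \<xi>. (trunc_weight s R (real k) \<bar>\<xi>\<bar>)\<^sup>2"
  have mF[measurable]: "trunc_weight s R K \<in> borel_measurable borel" for K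
    unfolding trunc_weight_def[abs_def] by measurable
  have H: "Hs s (g t)" "Hs s (g 0)" using sol t \<tau> by (auto simp: fourier_sol_def)
  then have [measurable]: "g t \<in> borel_measurable borel" "g 0 \<in> borel_measurable borel" by (auto simp: Hs_def)
  have le: "?F k \<xi> * (cmod z)\<^sup>2 \<le> (1 + \<xi>\<^sup>2) powr s * (min 1 (\<bar>\<xi>\<bar> / R))\<^sup>2 * (cmod z)\<^sup>2" for k \<xi> z
    by (rule mult_right_mono[OF trunc_weight_square[OF R]]) auto
  have k: "(LINT \<xi>|lborel. ?F k \<xi> * (cmod (g t \<xi>))\<^sup>2) \<le> tail_sq s R (g 0) * exp (9 * comm_const n * A * t)" for k
  proof -
    have "(LINT \<xi>|lborel. ?F k \<xi> * (cmod (g t \<xi>))\<^sup>2) \<le> (LINT \<xi>|lborel. ?F k \<xi> * (cmod (g 0 \<xi>))\<^sup>2) * exp (9 * comm_const n * A * t)"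
      by (rule weighted_growth[OF sol s(1) slow_weight_trunc mF _ \<tau> A t, where M = "real k"])
         (use s R in \<open>auto simp: trunc_weight_def\<close>)
    also have "\<dots> \<le> tail_sq s R (g 0) * exp (9 * comm_const n * A * t)"
    proof (rule mult_right_mono)
      have i: "integrable lborel (\<lambda>\<xi>. ?F k \<xi> * (cmod (g 0 \<xi>))\<^sup>2)"
        by (rule Bochner_Integration.integrable_bound[OF tail_integrable[OF H(2) R]]) (use le in auto)
      show "(LINT \<xi>|lborel. ?F k \<xi> * (cmod (g 0 \<xi>))\<^sup>2) \<le> tail_sq s R (g 0)"
        unfolding tail_sq_def by (rule integral_mono[OF i tail_integrable[OF H(2) R] le])
    qed simp
    finally show ?thesis .
  qed
  have "(\<lambda>k. LINT \<xi>|lborel. ?F k \<xi> * (cmod (g t \<xi>))\<^sup>2) \<longlonglongrightarrow> tail_sq s R (g t)"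
    unfolding tail_sq_def
  proof (rule integral_dominated_convergence)
    show "integrable lborel (\<lambda>\<xi>. (1 + \<xi>\<^sup>2) powr s * (min 1 (\<bar>\<xi>\<bar> / R))\<^sup>2 * (cmod (g t \<xi>))\<^sup>2)" by (rule tail_integrable[OF H(1) R])
    show "AE \<xi> in lborel. (\<lambda>k. ?F k \<xi> * (cmod (g t \<xi>))\<^sup>2) \<longlonglongrightarrow> (1 + \<xi>\<^sup>2) powr s * (min 1 (\<bar>\<xi>\<bar> / R))\<^sup>2 * (cmod (g t \<xi>))\<^sup>2"
      by (intro AE_I2 tendsto_mult tendsto_const tendsto_eventually trunc_weight_square_eventually)
    show "AE \<xi> in lborel. norm (?F k \<xi> * (cmod (g t \<xi>))\<^sup>2) \<le> (1 + \<xi>\<^sup>2) powr s * (min 1 (\<bar>\<xi>\<bar> / R))\<^sup>2 * (cmod (g t \<xi>))\<^sup>2" for k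
      using le by (intro AE_I2) simp
  qed measurable
  then show ?thesis by (rule LIMSEQ_le_const2) (use k in auto)
qed

text \<open>Dominated convergence gives no rate: \<open>R\<close> depends on the function itself and
  not only on its norm. Accordingly the final result is continuity without a modulus.\<close>

lemma tail_small:
  assumes G: "Hs s G" and e: "0 < e" obtains R where "0 < R" "tail_sq s R G < e"
proof -
  have [measurable]: "G \<in> borel_measurable borel" using G by (simp add: Hs_def)
  have "(\<lambda>k. tail_sq s (real (Suc k)) G) \<longlonglongrightarrow> (LINT \<xi>|(lborel :: real measure). 0)"
    unfolding tail_sq_def
  proof (rule integral_dominated_convergence)
    show "integrable lborel (\<lambda>\<xi>. (1 + \<xi>\<^sup>2) powr s * (cmod (G \<xi>))\<^sup>2)" using G by (simp add: Hs_def)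
    show "AE \<xi> in lborel. norm ((1 + \<xi>\<^sup>2) powr s * (min 1 (\<bar>\<xi>\<bar> / real (Suc k)))\<^sup>2 * (cmod (G \<xi>))\<^sup>2) \<le> (1 + \<xi>\<^sup>2) powr s * (cmod (G \<xi>))\<^sup>2" for k
    proof (intro AE_I2)
      fix \<xi> show "norm ((1 + \<xi>\<^sup>2) powr s * (min 1 (\<bar>\<xi>\<bar> / real (Suc k)))\<^sup>2 * (cmod (G \<xi>))\<^sup>2) \<le> (1 + \<xi>\<^sup>2) powr s * (cmod (G \<xi>))\<^sup>2"
        using mult_right_mono[OF tail_weight_le[of "real (Suc k)" \<xi> s], of "(cmod (G \<xi>))\<^sup>2"] by (simp add: abs_mult)
    qed
    show "AE \<xi> in lborel. (\<lambda>k. (1 + \<xi>\<^sup>2) powr s * (min 1 (\<bar>\<xi>\<bar> / real (Suc k)))\<^sup>2 * (cmod (G \<xi>))\<^sup>2) \<longlonglongrightarrow> 0"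
    proof (intro AE_I2)
      fix \<xi> :: real
      have "(\<lambda>k. \<bar>\<xi>\<bar> / real (Suc k)) \<longlonglongrightarrow> 0" by real_asymp
      then have "(\<lambda>k. (1 + \<xi>\<^sup>2) powr s * (min 1 (\<bar>\<xi>\<bar> / real (Suc k)))\<^sup>2 * (cmod (G \<xi>))\<^sup>2) \<longlonglongrightarrow> (1 + \<xi>\<^sup>2) powr s * (min 1 0)\<^sup>2 * (cmod (G \<xi>))\<^sup>2"
        by (intro tendsto_intros tendsto_min)
      then show "(\<lambda>k. (1 + \<xi>\<^sup>2) powr s * (min 1 (\<bar>\<xi>\<bar> / real (Suc k)))\<^sup>2 * (cmod (G \<xi>))\<^sup>2) \<longlonglongrightarrow> 0" by simp
    qed
  qed measurable
  then have "(\<lambda>k. tail_sq s (real (Suc k)) G) \<longlonglongrightarrow> 0" by simp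
  then have "\<forall>\<^sub>F k in sequentially. tail_sq s (real (Suc k)) G < e" using e by (rule order_tendstoD)
  then obtain k where "tail_sq s (real (Suc k)) G < e" by (auto simp: eventually_sequentially)
  then show ?thesis by (intro that[of "real (Suc k)"]) auto
qed

text \<open>Below \<open>R\<close> the weight is at most its value at \<open>R\<close>, which leaves
  the \<open>L^2\<close> norm of the difference. Above \<open>R\<close> the ramp equals 1, and the
  two functions are estimated separately, without any cancellation.\<close>

lemma Hs_sq_split:
  assumes f: "Hs s f" and g: "Hs s g" and s: "0 \<le> s" and R: "0 < R"
  shows "Hs_sq s (\<lambda>\<xi>. f \<xi> - g \<xi>) \<le> (1 + R\<^sup>2) powr s * (LINT \<xi>|lborel. (cmod (f \<xi> - g \<xi>))\<^sup>2) + (2 * tail_sq s R f + 2 * tail_sq s R g)"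
proof -
  let ?W = "\<lambda>\<xi>. (1 + \<xi>\<^sup>2) powr s * (min 1 (\<bar>\<xi>\<bar> / R))\<^sup>2"
  have d: "Hs s (\<lambda>\<xi>. f \<xi> - g \<xi>)" by (rule Hs_diff[OF f g])
  have L: "integrable lborel (\<lambda>\<xi>. (cmod (f \<xi> - g \<xi>))\<^sup>2)" using Hs_L2c(1)[OF d s] by (simp add: L2c_def)
  note tf = tail_integrable[OF f R] and tg = tail_integrable[OF g R]
  have le: "(1 + \<xi>\<^sup>2) powr s * (cmod (f \<xi> - g \<xi>))\<^sup>2
     \<le> (1 + R\<^sup>2) powr s * (cmod (f \<xi> - g \<xi>))\<^sup>2 + (2 * (?W \<xi> * (cmod (f \<xi>))\<^sup>2) + 2 * (?W \<xi> * (cmod (g \<xi>))\<^sup>2))" for \<xi>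
  proof (cases "\<bar>\<xi>\<bar> \<le> R")
    case True
    then have "\<xi>\<^sup>2 \<le> R\<^sup>2" by (metis abs_ge_zero power2_abs power_mono)
    then have "(1 + \<xi>\<^sup>2) powr s * (cmod (f \<xi> - g \<xi>))\<^sup>2 \<le> (1 + R\<^sup>2) powr s * (cmod (f \<xi> - g \<xi>))\<^sup>2"
      using s by (intro mult_right_mono powr_mono2) auto
    moreover have "0 \<le> 2 * (?W \<xi> * (cmod (f \<xi>))\<^sup>2) + 2 * (?W \<xi> * (cmod (g \<xi>))\<^sup>2)" by simp
    ultimately show ?thesis by linarith
  next
    case False
    then have "min 1 (\<bar>\<xi>\<bar> / R) = 1" using R by (simp add: min_def)
    then have W: "?W \<xi> = (1 + \<xi>\<^sup>2) powr s" by simp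
    have "(1 + \<xi>\<^sup>2) powr s * (cmod (f \<xi> - g \<xi>))\<^sup>2 \<le> (1 + \<xi>\<^sup>2) powr s * (2 * (cmod (f \<xi>))\<^sup>2 + 2 * (cmod (g \<xi>))\<^sup>2)"
      by (intro mult_left_mono norm_diff_square_le) simp
    moreover have "0 \<le> (1 + R\<^sup>2) powr s * (cmod (f \<xi> - g \<xi>))\<^sup>2" by simp
    ultimately show ?thesis unfolding W distrib_left by linarith
  qed
  have "Hs_sq s (\<lambda>\<xi>. f \<xi> - g \<xi>) \<le> (LINT \<xi>|lborel. (1 + R\<^sup>2) powr s * (cmod (f \<xi> - g \<xi>))\<^sup>2 + (2 * (?W \<xi> * (cmod (f \<xi>))\<^sup>2) + 2 * (?W \<xi> * (cmod (g \<xi>))\<^sup>2)))"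
    unfolding Hs_sq_def
    by (rule integral_mono[OF _ _ le]) (use d L tf tg in \<open>auto simp: Hs_def\<close>)
  also have "\<dots> = (1 + R\<^sup>2) powr s * (LINT \<xi>|lborel. (cmod (f \<xi> - g \<xi>))\<^sup>2) + (2 * tail_sq s R f + 2 * tail_sq s R g)"
    using L tf tg by (simp add: tail_sq_def)
  finally show ?thesis .
qed

section \<open>Continuity of Sobolev norms in time and the bootstrap principle\<close>

lemma L2c_norm_triangle:
  assumes f: "L2c f" and g: "L2c g"
  shows "sqrt (LINT \<xi>|lborel. (cmod (f \<xi> + g \<xi>))\<^sup>2) \<le> sqrt (LINT \<xi>|lborel. (cmod (f \<xi>))\<^sup>2) + sqrt (LINT \<xi>|lborel. (cmod (g \<xi>))\<^sup>2)"
proof (rule real_le_lsqrt)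
  let ?F = "LINT \<xi>|lborel. (cmod (f \<xi>))\<^sup>2" and ?G = "LINT \<xi>|lborel. (cmod (g \<xi>))\<^sup>2"
  have i: "integrable lborel (\<lambda>\<xi>. f \<xi> * cnj (g \<xi>))" by (rule L2c_mult_integrable[OF f L2c_cnj[OF g]])
  have e: "(cmod (f \<xi> + g \<xi>))\<^sup>2 = (cmod (f \<xi>))\<^sup>2 + (2 * Re (f \<xi> * cnj (g \<xi>)) + (cmod (g \<xi>))\<^sup>2)" for \<xi>
    unfolding cmod_power2 by (simp add: power2_eq_square algebra_simps)
  have "(LINT \<xi>|lborel. (cmod (f \<xi> + g \<xi>))\<^sup>2) = ?F + (2 * (LINT \<xi>|lborel. Re (f \<xi> * cnj (g \<xi>))) + ?G)"
    unfolding e using f g integrable_Re[OF i] by (simp add: L2c_def del: times_complex.simps)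
  also have "(LINT \<xi>|lborel. Re (f \<xi> * cnj (g \<xi>))) = Re (LINT \<xi>|lborel. f \<xi> * cnj (g \<xi>))" by (rule integral_Re[OF i])
  also have "\<dots> \<le> sqrt ?F * sqrt ?G" using L2c_weighted_pairing(2)[OF f g, of "\<lambda>_. 1" 1] by simp
  also have "?F + (2 * (sqrt ?F * sqrt ?G) + ?G) = (sqrt ?F + sqrt ?G)\<^sup>2" by (simp add: power2_sum)
  finally show "(LINT \<xi>|lborel. (cmod (f \<xi> + g \<xi>))\<^sup>2) \<le> (sqrt ?F + sqrt ?G)\<^sup>2" by simp
qed simp_all

text \<open>Multiplication by the square root of the weight turns the Sobolev norm into an
  \<open>L^2\<close> norm, whose triangle inequality is used in both orders.\<close>

lemma Hs_norm_diff:
  assumes f: "Hs s f" and g: "Hs s g"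
  shows "\<bar>sqrt (Hs_sq s f) - sqrt (Hs_sq s g)\<bar> \<le> sqrt (Hs_sq s (\<lambda>\<xi>. f \<xi> - g \<xi>))"
proof -
  define h where "h \<xi> = complex_of_real ((1 + \<xi>\<^sup>2) powr (s / 2))" for \<xi> :: real
  have [measurable]: "h \<in> borel_measurable borel" unfolding h_def[abs_def] by measurable
  have h: "(cmod (h \<xi>))\<^sup>2 = (1 + \<xi>\<^sup>2) powr s" for \<xi>
    by (simp add: h_def powr_powr flip: powr_numeral)
  have L: "L2c (\<lambda>\<xi>. h \<xi> * G \<xi>)" if "Hs s G" for G by (rule Hs_multiplier(1)[OF that]) (simp_all add: h)
  have n: "Hs_sq s G = (LINT \<xi>|lborel. (cmod (h \<xi> * G \<xi>))\<^sup>2)" for G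
    by (simp add: Hs_sq_def norm_mult power_mult_distrib h)
  have "sqrt (Hs_sq s a) \<le> sqrt (Hs_sq s (\<lambda>\<xi>. a \<xi> - b \<xi>)) + sqrt (Hs_sq s b)" if "Hs s a" "Hs s b" for a b
    using L2c_norm_triangle[OF L[OF Hs_diff(1)[OF that]] L[OF that(2)]] by (simp add: n algebra_simps)
  from this[OF f g] this[OF g f] show ?thesis
    by (simp add: Hs_sq_def norm_minus_commute)
qed

lemma Hs_norm_continuous:
  assumes G: "\<And>t. t \<in> S \<Longrightarrow> Hs s (G t)"
    and lim: "\<And>t. t \<in> S \<Longrightarrow> ((\<lambda>t'. Hs_sq s (\<lambda>\<xi>. G t' \<xi> - G t \<xi>)) \<longlongrightarrow> 0) (at t within S)"
  shows "continuous_on S (\<lambda>t. sqrt (Hs_sq s (G t)))"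
  unfolding continuous_on_def
proof
  fix t assume t: "t \<in> S"
  have l: "((\<lambda>t'. sqrt (Hs_sq s (\<lambda>\<xi>. G t' \<xi> - G t \<xi>))) \<longlongrightarrow> 0) (at t within S)"
    using tendsto_real_sqrt[OF lim[OF t]] by simp
  have "((\<lambda>t'. sqrt (Hs_sq s (G t')) - sqrt (Hs_sq s (G t))) \<longlongrightarrow> 0) (at t within S)"
    by (rule Lim_null_comparison[OF _ l]) (use Hs_norm_diff[OF G G[OF t]] in \<open>auto simp: eventually_at_filter\<close>)
  then show "((\<lambda>t'. sqrt (Hs_sq s (G t'))) \<longlongrightarrow> sqrt (Hs_sq s (G t))) (at t within S)"
    by (simp add: LIM_zero_iff)
qed

text \<open>At the first time \<open>\<tau>\<close> with \<open>1 \<le> n \<tau>\<close> the value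
  is exactly 1 and all earlier values are below 1, so the weak bound holds up to
  \<open>\<tau>\<close>; the step then gives \<open>n \<tau> < 1\<close>, a contradiction.\<close>

lemma continuity_bootstrap:
  fixes n :: "real \<Rightarrow> real"
  assumes c: "continuous_on {0..T} n" and 0: "n 0 < 1"
    and step: "\<And>\<tau> t. \<tau> \<in> {0..T} \<Longrightarrow> (\<And>t. t \<in> {0..\<tau>} \<Longrightarrow> n t \<le> 1) \<Longrightarrow> t \<in> {0..\<tau>} \<Longrightarrow> n t < 1"
    and t: "t \<in> {0..T}"
  shows "n t < 1"
proof (rule ccontr)
  assume "\<not> n t < 1"
  define S where "S = {x \<in> {0..T}. 1 \<le> n x}"
  have "S = {0..T} \<inter> n -` {1..}" by (auto simp: S_def)
  then have "closed S" using continuous_closed_preimage[OF c, of "{1..}"] by simp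
  then have "compact S" unfolding compact_eq_bounded_closed S_def by (auto intro: bounded_subset[of "{0..T}"])
  moreover have "S \<noteq> {}" using t \<open>\<not> n t < 1\<close> by (auto simp: S_def)
  ultimately obtain \<tau> where \<tau>: "\<tau> \<in> S" "\<And>x. x \<in> S \<Longrightarrow> \<tau> \<le> x" using compact_attains_inf[of S] by blast
  have \<tau>T: "0 \<le> \<tau>" "\<tau> \<le> T" "1 \<le> n \<tau>" using \<tau> by (auto simp: S_def)
  \<comment> \<open>The value 1 is attained at or before \<open>\<tau>\<close>; minimality of
    \<open>\<tau>\<close> forces the two times to coincide, which excludes
    \<open>n \<tau> > 1\<close>.\<close>
  obtain x where x: "0 \<le> x" "x \<le> \<tau>" "n x = 1"
    using IVT'[of n 0 1 \<tau>] 0 \<tau>T continuous_on_subset[OF c, of "{0..\<tau>}"] by auto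
  then have "x \<in> S" using \<tau>T by (simp add: S_def)
  with x \<tau>(2)[of x] have "n \<tau> = 1" by simp
  have "n y \<le> 1" if "y \<in> {0..\<tau>}" for y
  proof (rule ccontr)
    assume "\<not> n y \<le> 1"
    then have "y \<in> S" using that \<tau>T by (auto simp: S_def)
    with \<tau>(2)[of y] that have "y = \<tau>" by auto
    with \<open>n \<tau> = 1\<close> \<open>\<not> n y \<le> 1\<close> show False by simp
  qed
  then have "n \<tau> < 1" using step[of \<tau> \<tau>] \<tau>T by auto
  with \<open>n \<tau> = 1\<close> show False by simp
qed

section \<open>The nonlinearity in the weaker norm\<close>

text \<open>The Japanese bracket of \<open>\<xi>\<close> to the power \<open>r\<close>. The exponent
  is halved since the factor multiplies a transform and not its square.\<close>

definition bracket :: "real \<Rightarrow> real \<Rightarrow> real" where "bracket r \<xi> = (1 + \<xi>\<^sup>2) powr (r / 2)"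

lemma bracket_measurable[measurable]: "bracket r \<in> borel_measurable borel"
  unfolding bracket_def[abs_def] by measurable

lemma bracket_nonneg: "0 \<le> bracket r \<xi>" by (simp add: bracket_def)

lemma bracket_square: "(bracket r \<xi>)\<^sup>2 = (1 + \<xi>\<^sup>2) powr r"
  by (simp add: bracket_def powr_powr flip: powr_numeral)

lemma Hs_sq_bracket: "Hs_sq r f = (LINT \<xi>|lborel. (cmod (complex_of_real (bracket r \<xi>) * f \<xi>))\<^sup>2)"
  by (simp add: Hs_sq_def norm_mult power_mult_distrib bracket_square)

text \<open>With \<open>m\<close> the larger of the two quantities,
  \<open>1 + \<xi>^2 \<le> 4 * m\<close>; the constant is 4 to the power \<open>r / 2\<close>. The
  additive form lets each weight fall on a single factor of a convolution.\<close>

lemma bracket_peetre: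
  assumes r: "0 \<le> r" shows "bracket r \<xi> \<le> 2 powr r * (bracket r (\<xi> - \<eta>) + bracket r \<eta>)"
proof -
  define m where "m = max (1 + (\<xi> - \<eta>)\<^sup>2) (1 + \<eta>\<^sup>2)"
  have m: "1 \<le> m" by (simp add: m_def le_max_iff_disj)
  have "\<xi>\<^sup>2 \<le> 2 * (\<xi> - \<eta>)\<^sup>2 + 2 * \<eta>\<^sup>2" using norm_add_square_le[of "\<xi> - \<eta>" \<eta>] by simp
  moreover have "1 + (\<xi> - \<eta>)\<^sup>2 \<le> m" "1 + \<eta>\<^sup>2 \<le> m" by (auto simp: m_def)
  ultimately have "1 + \<xi>\<^sup>2 \<le> 4 * m" by linarith
  then have "bracket r \<xi> \<le> (4 * m) powr (r / 2)" unfolding bracket_def using r by (intro powr_mono2) auto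
  also have "\<dots> = (2 powr 2) powr (r / 2) * m powr (r / 2)" using m by (simp add: powr_mult)
  also have "\<dots> = 2 powr r * m powr (r / 2)" unfolding powr_powr by simp
  also have "m powr (r / 2) \<le> bracket r (\<xi> - \<eta>) + bracket r \<eta>"
    using bracket_nonneg[of r "\<xi> - \<eta>"] bracket_nonneg[of r \<eta>] by (auto simp: m_def bracket_def max_def)
  finally show ?thesis by simp
qed

text \<open>The weight is passed to one factor at a time, and Young's inequality takes the other one
  in \<open>L^1\<close>. The factors are replaced by their moduli because a convolution of
  nonnegative functions is its own modulus, so the pointwise bound is again in terms of
  convolutions.\<close>

lemma conv_weighted_bound:
  assumes r: "0 \<le> r" and a: "integrable lborel a" "L2c a" "L2c (\<lambda>\<xi>. complex_of_real (bracket r \<xi>) * a \<xi>)"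
    and b: "integrable lborel b" "L2c b" "L2c (\<lambda>\<xi>. complex_of_real (bracket r \<xi>) * b \<xi>)"
  shows "L2c (\<lambda>\<xi>. complex_of_real (bracket r \<xi>) * conv a b \<xi>)"
    and "Hs_sq r (conv a b) \<le> (2 powr r)\<^sup>2 * (2 * ((LINT \<xi>|lborel. cmod (b \<xi>))\<^sup>2 * Hs_sq r a + (LINT \<xi>|lborel. cmod (a \<xi>))\<^sup>2 * Hs_sq r b))"
proof -
  have [measurable]: "a \<in> borel_measurable borel" "b \<in> borel_measurable borel" using a b by auto
  define na where "na \<xi> = complex_of_real (cmod (a \<xi>))" for \<xi>
  define nb where "nb \<xi> = complex_of_real (cmod (b \<xi>))" for \<xi>
  define wa where "wa \<xi> = complex_of_real (bracket r \<xi> * cmod (a \<xi>))" for \<xi>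
  define wb where "wb \<xi> = complex_of_real (bracket r \<xi> * cmod (b \<xi>))" for \<xi>
  have n: "cmod (na \<xi>) = cmod (a \<xi>)" "cmod (nb \<xi>) = cmod (b \<xi>)" "cmod (wa \<xi>) = cmod (complex_of_real (bracket r \<xi>) * a \<xi>)"
    "cmod (wb \<xi>) = cmod (complex_of_real (bracket r \<xi>) * b \<xi>)" for \<xi>
    by (simp_all add: na_def nb_def wa_def wb_def norm_mult)
  have [measurable]: "na \<in> borel_measurable borel" "nb \<in> borel_measurable borel" "wa \<in> borel_measurable borel" "wb \<in> borel_measurable borel"
    unfolding na_def[abs_def] nb_def[abs_def] wa_def[abs_def] wb_def[abs_def] by measurable
  have L: "L2c na" "L2c nb" "L2c wa" "L2c wb" using a b by (simp_all add: L2c_def n)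
  have i: "integrable lborel na" "integrable lborel nb" using a b by (simp_all add: na_def[abs_def] nb_def[abs_def])
  have mc[measurable]: "conv f g \<in> borel_measurable borel" if "f \<in> borel_measurable borel" "g \<in> borel_measurable borel" for f g
    using that by measurable
  have C1: "L2c (conv wa nb)" "(LINT \<xi>|lborel. (cmod (conv wa nb \<xi>))\<^sup>2) \<le> (LINT \<xi>|lborel. cmod (b \<xi>))\<^sup>2 * Hs_sq r a"
    using L2c_conv[OF i(2) L(3)] unfolding conv_commute[of wa] by (simp_all add: n Hs_sq_bracket)
  have C2: "L2c (conv na wb)" "(LINT \<xi>|lborel. (cmod (conv na wb \<xi>))\<^sup>2) \<le> (LINT \<xi>|lborel. cmod (a \<xi>))\<^sup>2 * Hs_sq r b"
    using L2c_conv[OF i(1) L(4)] by (simp_all add: n Hs_sq_bracket)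
  have pos: "cmod (conv wa nb \<xi>) = (LINT \<eta>|lborel. bracket r (\<xi> - \<eta>) * cmod (a (\<xi> - \<eta>)) * cmod (b \<eta>))"
     "cmod (conv na wb \<xi>) = (LINT \<eta>|lborel. cmod (a (\<xi> - \<eta>)) * (bracket r \<eta> * cmod (b \<eta>)))" for \<xi>
    unfolding conv_def na_def nb_def wa_def wb_def of_real_mult[symmetric] integral_complex_of_real norm_of_real
    by (intro abs_of_nonneg integral_nonneg_AE AE_I2; simp add: bracket_nonneg)+
  have ir: "integrable lborel (\<lambda>\<eta>. bracket r (\<xi> - \<eta>) * cmod (a (\<xi> - \<eta>)) * cmod (b \<eta>))"
    "integrable lborel (\<lambda>\<eta>. cmod (a (\<xi> - \<eta>)) * (bracket r \<eta> * cmod (b \<eta>)))" for \<xi>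
    using integrable_norm[OF conv_integrand[OF L(3) L(2), of \<xi>]] integrable_norm[OF conv_integrand[OF L(1) L(4), of \<xi>]]
    by (simp_all add: n norm_mult bracket_nonneg)
  have bd: "cmod (complex_of_real (bracket r \<xi>) * conv a b \<xi>) \<le> 2 powr r * (cmod (conv wa nb \<xi>) + cmod (conv na wb \<xi>))" for \<xi>
  proof -
    have "cmod (complex_of_real (bracket r \<xi>) * conv a b \<xi>) = bracket r \<xi> * cmod (conv a b \<xi>)"
      by (simp add: norm_mult bracket_nonneg)
    also have "\<dots> \<le> bracket r \<xi> * (LINT \<eta>|lborel. cmod (a (\<xi> - \<eta>)) * cmod (b \<eta>))"
      unfolding conv_def by (intro mult_left_mono bracket_nonneg order_trans[OF integral_norm_bound]) (simp add: norm_mult)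
    also have "\<dots> = (LINT \<eta>|lborel. bracket r \<xi> * (cmod (a (\<xi> - \<eta>)) * cmod (b \<eta>)))" by simp
    also have "\<dots> \<le> (LINT \<eta>|lborel. 2 powr r * (bracket r (\<xi> - \<eta>) * cmod (a (\<xi> - \<eta>)) * cmod (b \<eta>) + cmod (a (\<xi> - \<eta>)) * (bracket r \<eta> * cmod (b \<eta>))))"
    proof (rule integral_mono)
      show "integrable lborel (\<lambda>\<eta>. bracket r \<xi> * (cmod (a (\<xi> - \<eta>)) * cmod (b \<eta>)))"
        using integrable_norm[OF conv_integrand[OF a(2) b(2), of \<xi>]] by (simp add: norm_mult)
      show "integrable lborel (\<lambda>\<eta>. 2 powr r * (bracket r (\<xi> - \<eta>) * cmod (a (\<xi> - \<eta>)) * cmod (b \<eta>) + cmod (a (\<xi> - \<eta>)) * (bracket r \<eta> * cmod (b \<eta>))))"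
        by (intro integrable_mult_right Bochner_Integration.integrable_add ir)
      fix \<eta>
      have "bracket r \<xi> * (cmod (a (\<xi> - \<eta>)) * cmod (b \<eta>)) \<le> (2 powr r * (bracket r (\<xi> - \<eta>) + bracket r \<eta>)) * (cmod (a (\<xi> - \<eta>)) * cmod (b \<eta>))"
        by (rule mult_right_mono[OF bracket_peetre[OF r]]) simp
      then show "bracket r \<xi> * (cmod (a (\<xi> - \<eta>)) * cmod (b \<eta>))
         \<le> 2 powr r * (bracket r (\<xi> - \<eta>) * cmod (a (\<xi> - \<eta>)) * cmod (b \<eta>) + cmod (a (\<xi> - \<eta>)) * (bracket r \<eta> * cmod (b \<eta>)))"
        by (simp add: algebra_simps)
    qed
    also have "\<dots> = 2 powr r * (cmod (conv wa nb \<xi>) + cmod (conv na wb \<xi>))"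
      unfolding pos integral_mult_right_zero by (subst Bochner_Integration.integral_add[OF ir]) simp
    finally show ?thesis .
  qed
  have bd2: "(cmod (complex_of_real (bracket r \<xi>) * conv a b \<xi>))\<^sup>2 \<le> (2 powr r)\<^sup>2 * (2 * (cmod (conv wa nb \<xi>))\<^sup>2 + 2 * (cmod (conv na wb \<xi>))\<^sup>2)" for \<xi>
  proof -
    have "(cmod (complex_of_real (bracket r \<xi>) * conv a b \<xi>))\<^sup>2 \<le> (2 powr r * (cmod (conv wa nb \<xi>) + cmod (conv na wb \<xi>)))\<^sup>2"
      by (rule power_mono[OF bd]) simp
    also have "\<dots> \<le> (2 powr r)\<^sup>2 * (2 * (cmod (conv wa nb \<xi>))\<^sup>2 + 2 * (cmod (conv na wb \<xi>))\<^sup>2)"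
      unfolding power_mult_distrib
      using norm_add_square_le[of "cmod (conv wa nb \<xi>)" "cmod (conv na wb \<xi>)"] by (intro mult_left_mono) auto
    finally show ?thesis .
  qed
  have iR: "integrable lborel (\<lambda>\<xi>. (2 powr r)\<^sup>2 * (2 * (cmod (conv wa nb \<xi>))\<^sup>2 + 2 * (cmod (conv na wb \<xi>))\<^sup>2))"
    using C1(1) C2(1) by (simp add: L2c_def)
  have iL: "integrable lborel (\<lambda>\<xi>. (cmod (complex_of_real (bracket r \<xi>) * conv a b \<xi>))\<^sup>2)"
    by (rule integrable_dominated[OF iR]) (use bd2 in \<open>simp_all only: real_norm_def abs_of_nonneg[OF zero_le_power2], measurable\<close>)
  then show "L2c (\<lambda>\<xi>. complex_of_real (bracket r \<xi>) * conv a b \<xi>)" by (simp add: L2c_def)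
  have "Hs_sq r (conv a b) \<le> (LINT \<xi>|lborel. (2 powr r)\<^sup>2 * (2 * (cmod (conv wa nb \<xi>))\<^sup>2 + 2 * (cmod (conv na wb \<xi>))\<^sup>2))"
    unfolding Hs_sq_bracket by (rule integral_mono[OF iL iR bd2])
  also have "\<dots> = (2 powr r)\<^sup>2 * (2 * ((LINT \<xi>|lborel. (cmod (conv wa nb \<xi>))\<^sup>2) + (LINT \<xi>|lborel. (cmod (conv na wb \<xi>))\<^sup>2)))"
    using C1(1) C2(1) by (simp add: L2c_def)
  also have "\<dots> \<le> (2 powr r)\<^sup>2 * (2 * ((LINT \<xi>|lborel. cmod (b \<xi>))\<^sup>2 * Hs_sq r a + (LINT \<xi>|lborel. cmod (a \<xi>))\<^sup>2 * Hs_sq r b))"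
    using C1(2) C2(2) by (intro mult_left_mono add_mono) auto
  finally show "Hs_sq r (conv a b) \<le> (2 powr r)\<^sup>2 * (2 * ((LINT \<xi>|lborel. cmod (b \<xi>))\<^sup>2 * Hs_sq r a + (LINT \<xi>|lborel. cmod (a \<xi>))\<^sup>2 * Hs_sq r b))" .
qed

text \<open>The first factor comes from distributing the weight. The second is
  \<open>4 * ((cauchy_mass + 1) / 2)^2\<close>: twice two equal terms, each with a squared
  \<open>L^1\<close> bound.\<close>

definition transport_const :: "real \<Rightarrow> real" where
  "transport_const s = (2 powr (s - 3))\<^sup>2 * (cauchy_mass + 1)\<^sup>2"

lemma bracket_Hs_multiplier:
  assumes G: "Hs s G" and k: "k \<le> 3" and s: "3 \<le> s"
  shows "L2c (\<lambda>\<xi>. complex_of_real (bracket (s - 3) \<xi>) * ((\<i> * complex_of_real \<xi>) ^ k * G \<xi>))"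
    and "Hs_sq (s - 3) (\<lambda>\<xi>. (\<i> * complex_of_real \<xi>) ^ k * G \<xi>) \<le> Hs_sq s G"
proof -
  have b: "(cmod (complex_of_real (bracket (s - 3) \<xi>) * (\<i> * complex_of_real \<xi>) ^ k))\<^sup>2 \<le> (1 + \<xi>\<^sup>2) powr s" for \<xi>
  proof -
    have "(cmod (complex_of_real (bracket (s - 3) \<xi>) * (\<i> * complex_of_real \<xi>) ^ k))\<^sup>2 = (1 + \<xi>\<^sup>2) powr (s - 3) * (\<bar>\<xi>\<bar> ^ k)\<^sup>2"
      by (simp add: norm_mult norm_power power_mult_distrib bracket_square)
    also have "\<dots> \<le> (1 + \<xi>\<^sup>2) powr (s - 3) * (1 + \<xi>\<^sup>2) powr 3"
      using power_abs_le_one_plus_square[OF k, of \<xi>] by (intro mult_left_mono) (auto simp: add_pos_nonneg)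
    also have "\<dots> = (1 + \<xi>\<^sup>2) powr ((s - 3) + 3)" by (rule powr_add[symmetric])
    also have "\<dots> = (1 + \<xi>\<^sup>2) powr s" by simp
    finally show ?thesis .
  qed
  show "L2c (\<lambda>\<xi>. complex_of_real (bracket (s - 3) \<xi>) * ((\<i> * complex_of_real \<xi>) ^ k * G \<xi>))"
    using Hs_multiplier(1)[OF G _ b] by (simp add: mult.assoc)
  show "Hs_sq (s - 3) (\<lambda>\<xi>. (\<i> * complex_of_real \<xi>) ^ k * G \<xi>) \<le> Hs_sq s G"
    using Hs_multiplier(2)[OF G _ b] by (simp add: mult.assoc Hs_sq_bracket)
qed

text \<open>Positive bounds \<open>\<alpha>\<close> and \<open>\<beta>\<close> stand in for the
  norms, since they also serve as the parameter \<open>\<theta>\<close> of the \<open>L^1\<close>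
  estimates. This keeps the result homogeneous, so that a small factor yields a small
  product.\<close>

lemma transport_Hs_bound:
  assumes a: "Hs s a" and b: "Hs s b" and s: "3 \<le> s" and \<alpha>: "0 < \<alpha>" "Hs_sq s a \<le> \<alpha>\<^sup>2" and \<beta>: "0 < \<beta>" "Hs_sq s b \<le> \<beta>\<^sup>2"
  shows "L2c (\<lambda>\<xi>. complex_of_real (bracket (s - 3) \<xi>) * conv a (\<lambda>\<eta>. \<i> * complex_of_real \<eta> * b \<eta>) \<xi>)"
    and "Hs_sq (s - 3) (conv a (\<lambda>\<eta>. \<i> * complex_of_real \<eta> * b \<eta>)) \<le> transport_const s * (\<alpha>\<^sup>2 * \<beta>\<^sup>2)"
proof -
  let ?b = "\<lambda>\<eta>. \<i> * complex_of_real \<eta> * b \<eta>"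
  have s2: "2 \<le> s" using s by simp
  have L: "L2c a" by (rule Hs_L2c(1)[OF a]) (use s in simp)
  note B = conv_weighted_bound[of "s - 3" a ?b, OF _ Hs_integrable(1)[OF a s2] L _ Hs_integrable(2)[OF b s2] Hs_deriv_1[OF b s]]
  have w: "L2c (\<lambda>\<xi>. complex_of_real (bracket (s - 3) \<xi>) * a \<xi>)" "L2c (\<lambda>\<xi>. complex_of_real (bracket (s - 3) \<xi>) * ?b \<xi>)"
    using bracket_Hs_multiplier(1)[OF a, of 0] bracket_Hs_multiplier(1)[OF b, of 1] s by simp_all
  show "L2c (\<lambda>\<xi>. complex_of_real (bracket (s - 3) \<xi>) * conv a ?b \<xi>)" by (rule B(1)) (use s w in auto)
  have ha: "Hs_sq (s - 3) a \<le> \<alpha>\<^sup>2" and hb: "Hs_sq (s - 3) ?b \<le> \<beta>\<^sup>2"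
    using bracket_Hs_multiplier(2)[OF a, of 0] bracket_Hs_multiplier(2)[OF b, of 1] s \<alpha> \<beta> by simp_all
  have half: "(x * cauchy_mass + y / x) / 2 \<le> x * ((cauchy_mass + 1) / 2)" if "0 < x" "y \<le> x\<^sup>2" for x y
  proof -
    have "y / x \<le> x" using that by (simp add: divide_le_eq power2_eq_square)
    then have "(x * cauchy_mass + y / x) / 2 \<le> (x * cauchy_mass + x) / 2" by (intro divide_right_mono add_left_mono) auto
    then show ?thesis by (simp add: algebra_simps)
  qed
  have b1: "(cmod 1)\<^sup>2 \<le> (1 + \<xi>\<^sup>2) powr (s - 1)" for \<xi> :: real
    using one_plus_square_power_le[of 0 "s - 1" \<xi>] s by simp
  have "(LINT \<xi>|lborel. cmod (a \<xi>)) \<le> (\<alpha> * cauchy_mass + Hs_sq s a / \<alpha>) / 2"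
    using Hs_integrable_multiplier(2)[OF a s2, of "\<lambda>_. 1" \<alpha>] b1 \<alpha> by simp
  also note half[OF \<alpha>]
  finally have "(LINT \<xi>|lborel. cmod (a \<xi>))\<^sup>2 \<le> (\<alpha> * ((cauchy_mass + 1) / 2))\<^sup>2" by (rule power_mono) simp
  then have na: "(LINT \<xi>|lborel. cmod (a \<xi>))\<^sup>2 \<le> \<alpha>\<^sup>2 * ((cauchy_mass + 1) / 2)\<^sup>2" by (simp only: power_mult_distrib)
  have "(LINT \<xi>|lborel. cmod (?b \<xi>)) \<le> (\<beta> * cauchy_mass + Hs_sq s b / \<beta>) / 2"
    using Hs_integrable(3)[OF b s2 \<beta>(1)] by (simp add: norm_mult)
  also note half[OF \<beta>]
  finally have "(LINT \<xi>|lborel. cmod (?b \<xi>))\<^sup>2 \<le> (\<beta> * ((cauchy_mass + 1) / 2))\<^sup>2" by (rule power_mono) simp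
  then have nb: "(LINT \<xi>|lborel. cmod (?b \<xi>))\<^sup>2 \<le> \<beta>\<^sup>2 * ((cauchy_mass + 1) / 2)\<^sup>2" by (simp only: power_mult_distrib)
  have "Hs_sq (s - 3) (conv a ?b) \<le> (2 powr (s - 3))\<^sup>2 * (2 * ((LINT \<xi>|lborel. cmod (?b \<xi>))\<^sup>2 * Hs_sq (s - 3) a + (LINT \<xi>|lborel. cmod (a \<xi>))\<^sup>2 * Hs_sq (s - 3) ?b))"
    by (rule B(2)) (use s w in auto)
  also have "\<dots> \<le> (2 powr (s - 3))\<^sup>2 * (2 * ((\<beta>\<^sup>2 * ((cauchy_mass + 1) / 2)\<^sup>2) * \<alpha>\<^sup>2 + (\<alpha>\<^sup>2 * ((cauchy_mass + 1) / 2)\<^sup>2) * \<beta>\<^sup>2))"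
    by (intro mult_left_mono add_mono mult_mono na nb ha hb) (auto simp: Hs_sq_nonneg)
  also have "\<dots> = transport_const s * (\<alpha>\<^sup>2 * \<beta>\<^sup>2)"
    by (simp add: transport_const_def power_divide algebra_simps)
  finally show "Hs_sq (s - 3) (conv a ?b) \<le> transport_const s * (\<alpha>\<^sup>2 * \<beta>\<^sup>2)" .
qed

lemma norm_sum4_square_le: "(cmod (x + y + z + v))\<^sup>2 \<le> 4 * ((cmod x)\<^sup>2 + (cmod y)\<^sup>2 + (cmod z)\<^sup>2 + (cmod v)\<^sup>2)"
  using norm_add_square_le[of "x + y" "z + v"] norm_add_square_le[of x y] norm_add_square_le[of z v] by (simp add: add.assoc)

text \<open>The right-hand side is the transform of the time derivative, so this bound turns
  closeness in \<open>H^s\<close> into closeness of the time derivatives in \<open>H^(s-3)\<close>.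
  Each of the four terms of \<open>kdv_rhs_diff\<close> loses at most three derivatives.\<close>

lemma kdv_rhs_diff_bound:
  assumes a: "Hs s a" and b: "Hs s b" and s: "3 \<le> s"
    and \<alpha>: "0 < \<alpha>" "Hs_sq s a \<le> \<alpha>\<^sup>2" and \<beta>: "0 < \<beta>" "Hs_sq s b \<le> \<beta>\<^sup>2" and \<theta>: "0 < \<theta>" "Hs_sq s (\<lambda>\<xi>. a \<xi> - b \<xi>) \<le> \<theta>\<^sup>2"
  shows "Hs_sq (s - 3) (\<lambda>\<xi>. kdv_rhs \<epsilon> a \<xi> - kdv_rhs \<epsilon>' b \<xi>)
     \<le> 4 * (transport_const s * (\<alpha>\<^sup>2 * \<theta>\<^sup>2) + transport_const s * (\<theta>\<^sup>2 * \<beta>\<^sup>2) + \<epsilon>\<^sup>2 * \<theta>\<^sup>2 + (\<epsilon> - \<epsilon>')\<^sup>2 * \<beta>\<^sup>2)"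
proof -
  define w where "w \<xi> = a \<xi> - b \<xi>" for \<xi>
  have W: "Hs s w" unfolding w_def[abs_def] by (rule Hs_diff(1)[OF a b])
  have \<theta>': "Hs_sq s w \<le> \<theta>\<^sup>2" using \<theta>(2) by (simp add: w_def[abs_def])
  let ?B = "\<lambda>\<xi>. complex_of_real (bracket (s - 3) \<xi>)"
  let ?N1 = "conv a (\<lambda>\<eta>. \<i> * complex_of_real \<eta> * w \<eta>)" and ?N2 = "conv w (\<lambda>\<eta>. \<i> * complex_of_real \<eta> * b \<eta>)"
  let ?Z = "\<lambda>\<xi>. (\<i> * complex_of_real \<xi>) ^ 3 * w \<xi>" and ?Z' = "\<lambda>\<xi>. (\<i> * complex_of_real \<xi>) ^ 3 * b \<xi>"
  note N1 = transport_Hs_bound[OF a W s \<alpha> \<theta>(1) \<theta>'] and N2 = transport_Hs_bound[OF W b s \<theta>(1) \<theta>' \<beta>]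
  note Z = bracket_Hs_multiplier[OF W order_refl s] and Z' = bracket_Hs_multiplier[OF b order_refl s]
  define f where "f \<xi> = 4 * ((cmod (?B \<xi> * ?N1 \<xi>))\<^sup>2 + (cmod (?B \<xi> * ?N2 \<xi>))\<^sup>2 + \<epsilon>\<^sup>2 * (cmod (?B \<xi> * ?Z \<xi>))\<^sup>2 + (\<epsilon> - \<epsilon>')\<^sup>2 * (cmod (?B \<xi> * ?Z' \<xi>))\<^sup>2)" for \<xi>
  have if': "integrable lborel f" unfolding f_def using N1(1) N2(1) Z(1) Z'(1)
    by (intro integrable_mult_right Bochner_Integration.integrable_add) (auto simp only: L2c_def)
  have le: "(cmod (?B \<xi> * (kdv_rhs \<epsilon> a \<xi> - kdv_rhs \<epsilon>' b \<xi>)))\<^sup>2 \<le> f \<xi>" for \<xi>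
  proof -
    let ?c = "1 / complex_of_real (2 * pi)"
    \<comment> \<open>The normalisation of the convolution only helps and is dropped from the two
      nonlinear terms.\<close>
    have c: "(cmod ?c)\<^sup>2 \<le> 1" using pi_gt3 by (intro power_le_one) (auto simp: norm_divide norm_mult)
    have s1: "(cmod (?c * x))\<^sup>2 \<le> (cmod x)\<^sup>2" for x
      unfolding norm_mult[of ?c] power_mult_distrib[of "cmod ?c"]
      using mult_right_mono[OF c zero_le_power2[of "cmod x"]] by (simp only: mult_1_left)
    have "?B \<xi> * (kdv_rhs \<epsilon> a \<xi> - kdv_rhs \<epsilon>' b \<xi>) = ?c * (?B \<xi> * ?N1 \<xi>) + ?c * (?B \<xi> * ?N2 \<xi>)
       + complex_of_real \<epsilon> * (?B \<xi> * ?Z \<xi>) + complex_of_real (\<epsilon> - \<epsilon>') * (?B \<xi> * ?Z' \<xi>)"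
      unfolding kdv_rhs_diff[OF a b s] w_def[symmetric] by (simp add: add_divide_distrib algebra_simps)
    then have "(cmod (?B \<xi> * (kdv_rhs \<epsilon> a \<xi> - kdv_rhs \<epsilon>' b \<xi>)))\<^sup>2 \<le> 4 * ((cmod (?c * (?B \<xi> * ?N1 \<xi>)))\<^sup>2 + (cmod (?c * (?B \<xi> * ?N2 \<xi>)))\<^sup>2
       + (cmod (complex_of_real \<epsilon> * (?B \<xi> * ?Z \<xi>)))\<^sup>2 + (cmod (complex_of_real (\<epsilon> - \<epsilon>') * (?B \<xi> * ?Z' \<xi>)))\<^sup>2)"
      by (simp only: norm_sum4_square_le)
    also have "\<dots> \<le> 4 * ((cmod (?B \<xi> * ?N1 \<xi>))\<^sup>2 + (cmod (?B \<xi> * ?N2 \<xi>))\<^sup>2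
       + (cmod (complex_of_real \<epsilon> * (?B \<xi> * ?Z \<xi>)))\<^sup>2 + (cmod (complex_of_real (\<epsilon> - \<epsilon>') * (?B \<xi> * ?Z' \<xi>)))\<^sup>2)"
      by (intro mult_left_mono add_mono s1 order_refl) simp
    also have "\<dots> = f \<xi>"
      unfolding f_def norm_mult[of "complex_of_real \<epsilon>"] norm_mult[of "complex_of_real (\<epsilon> - \<epsilon>')"] norm_of_real power_mult_distrib[of "\<bar>_\<bar>"] power2_abs ..
    finally show ?thesis .
  qed
  have "L2c (\<lambda>\<xi>. kdv_rhs \<epsilon> a \<xi> - kdv_rhs \<epsilon>' b \<xi>)" by (intro L2c_diff kdv_rhs_L2c[OF a s] kdv_rhs_L2c[OF b s])
  then have [measurable]: "(\<lambda>\<xi>. kdv_rhs \<epsilon> a \<xi> - kdv_rhs \<epsilon>' b \<xi>) \<in> borel_measurable borel" by (simp add: L2c_def)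
  have il: "integrable lborel (\<lambda>\<xi>. (cmod (?B \<xi> * (kdv_rhs \<epsilon> a \<xi> - kdv_rhs \<epsilon>' b \<xi>)))\<^sup>2)"
    by (rule integrable_dominated[OF if']) (use le in \<open>simp_all only: real_norm_def abs_of_nonneg[OF zero_le_power2], measurable\<close>)
  have "Hs_sq (s - 3) (\<lambda>\<xi>. kdv_rhs \<epsilon> a \<xi> - kdv_rhs \<epsilon>' b \<xi>) \<le> (LINT \<xi>|lborel. f \<xi>)"
    unfolding Hs_sq_bracket by (rule integral_mono[OF il if' le])
  also have "\<dots> = 4 * (Hs_sq (s - 3) ?N1 + Hs_sq (s - 3) ?N2 + \<epsilon>\<^sup>2 * Hs_sq (s - 3) ?Z + (\<epsilon> - \<epsilon>')\<^sup>2 * Hs_sq (s - 3) ?Z')"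
  proof -
    define F1 where "F1 \<xi> = (cmod (?B \<xi> * ?N1 \<xi>))\<^sup>2" for \<xi>
    define F2 where "F2 \<xi> = (cmod (?B \<xi> * ?N2 \<xi>))\<^sup>2" for \<xi>
    define F3 where "F3 \<xi> = (cmod (?B \<xi> * ?Z \<xi>))\<^sup>2" for \<xi>
    define F4 where "F4 \<xi> = (cmod (?B \<xi> * ?Z' \<xi>))\<^sup>2" for \<xi>
    have i: "integrable lborel F1" "integrable lborel F2" "integrable lborel F3" "integrable lborel F4"
      unfolding F1_def F2_def F3_def F4_def using N1(1) N2(1) Z(1) Z'(1) by (simp_all only: L2c_def)
    show ?thesis
      unfolding f_def Hs_sq_bracket F1_def[symmetric] F2_def[symmetric] F3_def[symmetric] F4_def[symmetric]
      using i by simp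
  qed
  also have "\<dots> \<le> 4 * (transport_const s * (\<alpha>\<^sup>2 * \<theta>\<^sup>2) + transport_const s * (\<theta>\<^sup>2 * \<beta>\<^sup>2) + \<epsilon>\<^sup>2 * \<theta>\<^sup>2 + (\<epsilon> - \<epsilon>')\<^sup>2 * \<beta>\<^sup>2)"
    by (intro mult_left_mono add_mono N1(2) N2(2) order_trans[OF Z(2) \<theta>'] order_trans[OF Z'(2) \<beta>(2)]) auto
  finally show ?thesis .
qed

section \<open>Continuous dependence\<close>

lemma fourier_sol_Hs_bounded:
  assumes "fourier_sol s T \<epsilon> g"
  obtains K where "\<And>t. t \<in> {0..T} \<Longrightarrow> sqrt (Hs_sq s (g t)) \<le> K" "0 \<le> K"
proof -
  have "continuous_on {0..T} (\<lambda>t. sqrt (Hs_sq s (g t)))"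
    by (rule Hs_norm_continuous) (use assms in \<open>auto simp: fourier_sol_def\<close>)
  then have "bounded ((\<lambda>t. sqrt (Hs_sq s (g t))) ` {0..T})"
    by (intro compact_imp_bounded compact_continuous_image) auto
  then obtain K where K: "\<forall>t\<in>{0..T}. \<bar>sqrt (Hs_sq s (g t))\<bar> \<le> K" by (auto simp: bounded_iff)
  show ?thesis
  proof (rule that[of "\<bar>K\<bar>"])
    fix t assume "t \<in> {0..T}"
    with K have "\<bar>sqrt (Hs_sq s (g t))\<bar> \<le> K" by blast
    then show "sqrt (Hs_sq s (g t)) \<le> \<bar>K\<bar>" by linarith
  qed simp
qed

text \<open>The threshold of the bootstrap is 1, hence \<open>e \<le> 1\<close>: a bound by
  \<open>e\<close> then reproduces the a priori assumption with a strict inequality.\<close>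

lemma fourier_sol_Hs_close:
  assumes sol': "fourier_sol s T \<epsilon>' g'" and s: "3 \<le> s" and T: "0 < T" and e: "0 < e" "e \<le> 1"
  obtains \<delta> where "0 < \<delta>"
    "\<And>\<epsilon> g t. \<lbrakk>\<bar>\<epsilon> - \<epsilon>'\<bar> < \<delta>; fourier_sol s T \<epsilon> g; AE \<xi> in lborel. g 0 \<xi> = g' 0 \<xi>; t \<in> {0..T}\<rbrakk>
       \<Longrightarrow> Hs_sq s (\<lambda>\<xi>. g t \<xi> - g' t \<xi>) < e"
proof -
  have s2: "2 \<le> s" and s0: "0 \<le> s" using s by auto
  have G': "Hs s (g' t)" if "t \<in> {0..T}" for t using sol' that by (simp add: fourier_sol_def)
  obtain K0 where K0: "\<And>t. t \<in> {0..T} \<Longrightarrow> sqrt (Hs_sq s (g' t)) \<le> K0"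
    using fourier_sol_Hs_bounded[OF sol'] by blast
  define K where "K = K0\<^sup>2"
  have K: "Hs_sq s (g' t) \<le> K" if "t \<in> {0..T}" for t
    using power_mono[OF K0[OF that], of 2] by (simp add: K_def Hs_sq_nonneg)
  have Kn: "0 \<le> K" by (simp add: K_def)
  \<comment> \<open>While the difference is at most 1 in \<open>H^s\<close>, the squared norm of the
    perturbed solution is at most \<open>2 * K + 2\<close>; the \<open>L^1\<close> estimate with
    \<open>\<theta> = 1\<close> then gives \<open>A\<close> for both solutions.\<close>
  define A where "A = (cauchy_mass + (2 * K + 2)) / 2"
  have A0: "0 \<le> A" using cauchy_mass_nonneg Kn by (simp add: A_def)
  have A: "(LINT \<xi>|lborel. \<bar>\<xi>\<bar> * cmod (h \<xi>)) \<le> A" if "Hs s h" "Hs_sq s h \<le> 2 * K + 2" for h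
    using Hs_integrable(3)[OF that(1) s2, of 1] that(2) by (simp add: A_def)
  define n where "n = nat \<lceil>s + 1\<rceil>"
  have n: "s + 1 \<le> real n" unfolding n_def by linarith
  define X where "X = exp (9 * comm_const n * A * T)"
  have X: "0 < X" "\<And>t. t \<in> {0..T} \<Longrightarrow> exp (9 * comm_const n * A * t) \<le> X"
    using A0 comm_const_ge(1)[of n] by (auto simp: X_def intro!: mult_left_mono)
  \<comment> \<open>Energies grow by at most the factor \<open>X\<close>, so each tail stays below
    \<open>e / 16\<close>. With the factors 2 in \<open>Hs_sq_split\<close> the two tails contribute
    \<open>e / 4\<close>, the low frequencies another \<open>e / 4\<close>.\<close>
  obtain R where R: "0 < R" "tail_sq s R (g' 0) < e / (16 * X)"
    using tail_small[OF G'[of 0], of "e / (16 * X)"] T e X by auto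
  \<comment> \<open>The added 1 keeps \<open>Q\<close> positive even if \<open>K\<close> is 0, so
    that \<open>\<delta>\<close> can be defined by \<open>\<delta>^2 * Q = e / 4\<close>.\<close>
  define Q where "Q = (1 + R\<^sup>2) powr s * (K * T * exp ((3 * A + 1) * T)) + 1"
  have Q: "0 < Q" unfolding Q_def using Kn T by (intro add_nonneg_pos) auto
  define \<delta> where "\<delta> = sqrt (e / (4 * Q))"
  have \<delta>: "0 < \<delta>" using e Q by (simp add: \<delta>_def)
  \<comment> \<open>The estimate under the a priori bound up to \<open>\<tau>\<close>. It is used
    twice: as the step of the bootstrap, and with \<open>\<tau> = T\<close> once the bound has been
    secured.\<close>
  have main: "Hs_sq s (\<lambda>\<xi>. g t \<xi> - g' t \<xi>) < e"
    if \<epsilon>: "\<bar>\<epsilon> - \<epsilon>'\<bar> < \<delta>" and sol: "fourier_sol s T \<epsilon> g" and init: "AE \<xi> in lborel. g 0 \<xi> = g' 0 \<xi>"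
      and \<tau>: "\<tau> \<in> {0..T}" and small: "\<And>t. t \<in> {0..\<tau>} \<Longrightarrow> sqrt (Hs_sq s (\<lambda>\<xi>. g t \<xi> - g' t \<xi>)) \<le> 1"
      and t: "t \<in> {0..\<tau>}" for \<epsilon> g \<tau> t
  proof -
    have \<tau>T: "\<tau> \<le> T" and tT: "t \<in> {0..T}" using \<tau> t by auto
    have G: "Hs s (g t)" if "t \<in> {0..T}" for t using sol that by (simp add: fourier_sol_def)
    have A1: "(LINT \<xi>|lborel. \<bar>\<xi>\<bar> * cmod (g t \<xi>)) \<le> A" if t: "t \<in> {0..\<tau>}" for t
    proof (rule A)
      have tT: "t \<in> {0..T}" using t \<tau> by auto
      show "Hs s (g t)" by (rule G[OF tT])
      have "Hs_sq s (\<lambda>\<xi>. g' t \<xi> - g t \<xi>) = Hs_sq s (\<lambda>\<xi>. g t \<xi> - g' t \<xi>)" by (simp add: Hs_sq_def norm_minus_commute)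
      then have "Hs_sq s (\<lambda>\<xi>. g' t \<xi> - g t \<xi>) \<le> 1" using small[OF t] by (simp add: real_sqrt_le_1_iff)
      then show "Hs_sq s (g t) \<le> 2 * K + 2"
        using Hs_diff(2)[OF G'[OF tT] Hs_diff(1)[OF G'[OF tT] G[OF tT]]] K[OF tT] by simp
    qed
    have A2: "(LINT \<xi>|lborel. \<bar>\<xi>\<bar> * cmod (g' t \<xi>)) \<le> A" if t: "t \<in> {0..\<tau>}" for t
    proof (rule A)
      have tT: "t \<in> {0..T}" using t \<tau> by auto
      show "Hs s (g' t)" by (rule G'[OF tT])
      show "Hs_sq s (g' t) \<le> 2 * K + 2" using K[OF tT] Kn by linarith
    qed
    have Kt: "Hs_sq s (g' t) \<le> K" if "t \<in> {0..\<tau>}" for t using K that \<tau> by auto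
    have [measurable]: "g 0 \<in> borel_measurable borel" "g' 0 \<in> borel_measurable borel"
      using G[of 0] G'[of 0] T by (auto simp: Hs_def)
    have tail0: "tail_sq s R (g 0) = tail_sq s R (g' 0)"
      unfolding tail_sq_def by (rule integral_cong_AE) (use init in \<open>auto elim!: eventually_mono\<close>)
    have tail_nn: "0 \<le> tail_sq s R (g' 0)" by (simp add: tail_sq_def)
    have tl: "y \<le> e / 16" if "y \<le> tail_sq s R (g' 0) * exp (9 * comm_const n * A * t)" for y
    proof -
      have "y \<le> tail_sq s R (g' 0) * X" using that mult_left_mono[OF X(2)[OF tT] tail_nn] by linarith
      also have "\<dots> \<le> e / (16 * X) * X" using R X by (intro mult_right_mono) auto
      also have "\<dots> = e / 16" using X by simp
      finally show ?thesis .
    qed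
    have "Hs_sq s (\<lambda>\<xi>. g t \<xi> - g' t \<xi>)
       \<le> (1 + R\<^sup>2) powr s * (LINT \<xi>|lborel. (cmod (g t \<xi> - g' t \<xi>))\<^sup>2) + (2 * tail_sq s R (g t) + 2 * tail_sq s R (g' t))"
      by (rule Hs_sq_split[OF G[OF tT] G'[OF tT] s0 R(1)])
    also have "(1 + R\<^sup>2) powr s * (LINT \<xi>|lborel. (cmod (g t \<xi> - g' t \<xi>))\<^sup>2) \<le> (\<epsilon> - \<epsilon>')\<^sup>2 * Q"
    proof -
      have "(LINT \<xi>|lborel. (cmod (g t \<xi> - g' t \<xi>))\<^sup>2) \<le> (\<epsilon> - \<epsilon>')\<^sup>2 * K * t * exp ((3 * A + 1) * t)"
        by (rule difference_growth[OF sol sol' s init \<tau>T A1 A2 Kt t])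
      also have "\<dots> \<le> (\<epsilon> - \<epsilon>')\<^sup>2 * K * T * exp ((3 * A + 1) * T)"
        using tT Kn A0 by (intro mult_mono) (auto intro!: mult_left_mono)
      finally have "(1 + R\<^sup>2) powr s * (LINT \<xi>|lborel. (cmod (g t \<xi> - g' t \<xi>))\<^sup>2)
         \<le> (1 + R\<^sup>2) powr s * ((\<epsilon> - \<epsilon>')\<^sup>2 * K * T * exp ((3 * A + 1) * T))" by (rule mult_left_mono) simp
      also have "\<dots> = (\<epsilon> - \<epsilon>')\<^sup>2 * (Q - 1)" by (simp add: Q_def mult_ac)
      also have "\<dots> \<le> (\<epsilon> - \<epsilon>')\<^sup>2 * Q" by (rule mult_left_mono) auto
      finally show ?thesis .
    qed
    also have "(\<epsilon> - \<epsilon>')\<^sup>2 * Q \<le> e / 4"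
    proof -
      have "(\<epsilon> - \<epsilon>')\<^sup>2 \<le> \<delta>\<^sup>2" using \<epsilon> by (metis abs_ge_zero less_imp_le power2_abs power_mono)
      also have "\<delta>\<^sup>2 = e / (4 * Q)" using e Q by (simp add: \<delta>_def)
      finally have "(\<epsilon> - \<epsilon>')\<^sup>2 * Q \<le> e / (4 * Q) * Q" using Q by (intro mult_right_mono) auto
      then show ?thesis using Q by simp
    qed
    also have "tail_sq s R (g t) \<le> e / 16"
      by (rule tl) (use tail_growth[OF sol s n R(1) \<tau>T A1 t] tail0 in simp)
    also have "tail_sq s R (g' t) \<le> e / 16"
      by (rule tl) (rule tail_growth[OF sol' s n R(1) \<tau>T A2 t])
    finally show ?thesis using e by simp
  qed
  show ?thesis
  proof (rule that[OF \<delta>])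
    fix \<epsilon> g t assume \<epsilon>: "\<bar>\<epsilon> - \<epsilon>'\<bar> < \<delta>" and sol: "fourier_sol s T \<epsilon> g" and init: "AE \<xi> in lborel. g 0 \<xi> = g' 0 \<xi>" and t: "t \<in> {0..T}"
    define w where "w t \<xi> = g t \<xi> - g' t \<xi>" for t \<xi>
    have G: "Hs s (g t)" if "t \<in> {0..T}" for t using sol that by (simp add: fourier_sol_def)
    have W: "Hs s (w t)" if "t \<in> {0..T}" for t unfolding w_def[abs_def] by (rule Hs_diff(1)[OF G[OF that] G'[OF that]])
    have lim: "((\<lambda>t'. Hs_sq s (\<lambda>\<xi>. w t' \<xi> - w t \<xi>)) \<longlongrightarrow> 0) (at t within {0..T})" if t: "t \<in> {0..T}" for t
    proof -
      have l: "((\<lambda>t'. 2 * Hs_sq s (\<lambda>\<xi>. g t' \<xi> - g t \<xi>) + 2 * Hs_sq s (\<lambda>\<xi>. g' t' \<xi> - g' t \<xi>)) \<longlongrightarrow> 2 * 0 + 2 * 0) (at t within {0..T})"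
        using sol sol' t by (intro tendsto_intros) (auto simp: fourier_sol_def)
      have "Hs_sq s (\<lambda>\<xi>. w t' \<xi> - w t \<xi>) \<le> 2 * Hs_sq s (\<lambda>\<xi>. g t' \<xi> - g t \<xi>) + 2 * Hs_sq s (\<lambda>\<xi>. g' t' \<xi> - g' t \<xi>)" if t': "t' \<in> {0..T}" for t'
        using Hs_diff(2)[OF Hs_diff(1)[OF G[OF t'] G[OF t]] Hs_diff(1)[OF G'[OF t'] G'[OF t]]] by (simp add: w_def algebra_simps)
      then have ev: "\<forall>\<^sub>F t' in at t within {0..T}. Hs_sq s (\<lambda>\<xi>. w t' \<xi> - w t \<xi>) \<le> 2 * Hs_sq s (\<lambda>\<xi>. g t' \<xi> - g t \<xi>) + 2 * Hs_sq s (\<lambda>\<xi>. g' t' \<xi> - g' t \<xi>)"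
        by (auto simp: eventually_at_filter)
      show ?thesis
        by (rule tendsto_sandwich[OF _ ev tendsto_const l[simplified]]) (simp add: Hs_sq_nonneg)
    qed
    have "sqrt (Hs_sq s (w t)) < 1"
      if "t \<in> {0..T}" for t
    proof (rule continuity_bootstrap[OF Hs_norm_continuous[OF W lim] _ _ that])
      have "AE \<xi> in lborel. w 0 \<xi> = 0" using init by (auto simp: w_def)
      moreover have [measurable]: "w 0 \<in> borel_measurable borel" using W[of 0] T by (auto simp: Hs_def)
      ultimately have "Hs_sq s (w 0) = (LINT \<xi>|(lborel :: real measure). 0)"
        unfolding Hs_sq_def by (intro integral_cong_AE) (auto elim!: eventually_mono)
      then show "sqrt (Hs_sq s (w 0)) < 1" by simp
    next
      fix \<tau> t assume "\<tau> \<in> {0..T}" "\<And>t. t \<in> {0..\<tau>} \<Longrightarrow> sqrt (Hs_sq s (w t)) \<le> 1" "t \<in> {0..\<tau>}"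
      then have "Hs_sq s (w t) < e" using main[OF \<epsilon> sol init, of \<tau> t] by (simp add: w_def[abs_def])
      then show "sqrt (Hs_sq s (w t)) < 1" using e by (simp add: real_sqrt_lt_1_iff)
    qed
    then have "sqrt (Hs_sq s (\<lambda>\<xi>. g t \<xi> - g' t \<xi>)) \<le> 1" if "t \<in> {0..T}" for t
      using that by (simp add: w_def[abs_def] less_imp_le)
    then show "Hs_sq s (\<lambda>\<xi>. g t \<xi> - g' t \<xi>) < e"
      using main[OF \<epsilon> sol init, of T t] t T by auto
  qed
qed

text \<open>The \<open>H^s\<close> part is requested with the smaller tolerance \<open>e1\<close>,
  and every term of \<open>kdv_rhs_diff_bound\<close> is then at most a fixed constant times
  \<open>e1\<close>.\<close>

lemma fourier_sol_close:
  assumes sol': "fourier_sol s T \<epsilon>' g'" and s: "3 \<le> s" and T: "0 < T" and e: "0 < e"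
  obtains \<delta> where "0 < \<delta>"
    "\<And>\<epsilon> g t. \<lbrakk>\<bar>\<epsilon> - \<epsilon>'\<bar> < \<delta>; fourier_sol s T \<epsilon> g; AE \<xi> in lborel. g 0 \<xi> = g' 0 \<xi>; t \<in> {0..T}\<rbrakk>
       \<Longrightarrow> Hs_sq s (\<lambda>\<xi>. g t \<xi> - g' t \<xi>) < e \<and> Hs_sq (s - 3) (\<lambda>\<xi>. kdv_rhs \<epsilon> (g t) \<xi> - kdv_rhs \<epsilon>' (g' t) \<xi>) < e"
proof -
  have G': "Hs s (g' t)" if "t \<in> {0..T}" for t using sol' that by (simp add: fourier_sol_def)
  obtain K where K: "\<And>t. t \<in> {0..T} \<Longrightarrow> sqrt (Hs_sq s (g' t)) \<le> K" and K0: "0 \<le> K"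
    using fourier_sol_Hs_bounded[OF sol'] by blast
  define \<beta> where "\<beta> = K + 1"
  define \<alpha> where "\<alpha> = K + 2"
  define C where "C = transport_const s"
  have C0: "0 \<le> C" by (simp add: C_def transport_const_def)
  \<comment> \<open>The sum of the coefficients of \<open>e1\<close> in that bound, with
    \<open>\<bar>\<epsilon>\<bar>\<close> replaced by \<open>\<bar>\<epsilon>'\<bar> + 1\<close>, as
    \<open>\<epsilon>\<close> will lie within distance 1 of \<open>\<epsilon>'\<close>. The
    denominator \<open>8 * B\<close> below makes the total \<open>e / 2\<close>.\<close>
  define B where "B = C * \<alpha>\<^sup>2 + C * \<beta>\<^sup>2 + (\<bar>\<epsilon>'\<bar> + 1)\<^sup>2 + \<beta>\<^sup>2"
  have B: "0 < B" unfolding B_def using C0 K0 by (intro add_nonneg_pos add_nonneg_nonneg) (auto simp: \<beta>_def)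
  define e1 where "e1 = min (min e 1) (e / (8 * B))"
  have e1: "0 < e1" "e1 \<le> 1" "e1 \<le> e" "e1 \<le> e / (8 * B)" using e B by (auto simp: e1_def)
  obtain \<delta>1 where \<delta>1: "0 < \<delta>1" and close: "\<And>\<epsilon> g t. \<lbrakk>\<bar>\<epsilon> - \<epsilon>'\<bar> < \<delta>1; fourier_sol s T \<epsilon> g; AE \<xi> in lborel. g 0 \<xi> = g' 0 \<xi>; t \<in> {0..T}\<rbrakk>
       \<Longrightarrow> Hs_sq s (\<lambda>\<xi>. g t \<xi> - g' t \<xi>) < e1"
    using fourier_sol_Hs_close[OF sol' s T e1(1,2)] by blast
  show ?thesis
  proof (rule that[of "min \<delta>1 e1"])
    show "0 < min \<delta>1 e1" using \<delta>1 e1 by simp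
    fix \<epsilon> g t assume \<epsilon>: "\<bar>\<epsilon> - \<epsilon>'\<bar> < min \<delta>1 e1" and sol: "fourier_sol s T \<epsilon> g" and init: "AE \<xi> in lborel. g 0 \<xi> = g' 0 \<xi>" and t: "t \<in> {0..T}"
    have G: "Hs s (g t)" using sol t by (simp add: fourier_sol_def)
    have w: "Hs_sq s (\<lambda>\<xi>. g t \<xi> - g' t \<xi>) < e1" using close[OF _ sol init t] \<epsilon> by simp
    have nb: "sqrt (Hs_sq s (g' t)) \<le> K" by (rule K[OF t])
    have "sqrt (Hs_sq s (\<lambda>\<xi>. g t \<xi> - g' t \<xi>)) \<le> 1" using w e1 by simp
    then have na: "sqrt (Hs_sq s (g t)) \<le> \<alpha>" using Hs_norm_diff[OF G G'[OF t]] nb unfolding \<alpha>_def by linarith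
    have a: "Hs_sq s (g t) \<le> \<alpha>\<^sup>2" using na by (rule sqrt_le_D)
    have b: "Hs_sq s (g' t) \<le> \<beta>\<^sup>2" using nb by (intro sqrt_le_D) (simp add: \<beta>_def)
    have th: "Hs_sq s (\<lambda>\<xi>. g t \<xi> - g' t \<xi>) \<le> (sqrt e1)\<^sup>2" using w e1 by simp
    have "Hs_sq (s - 3) (\<lambda>\<xi>. kdv_rhs \<epsilon> (g t) \<xi> - kdv_rhs \<epsilon>' (g' t) \<xi>)
       \<le> 4 * (C * (\<alpha>\<^sup>2 * (sqrt e1)\<^sup>2) + C * ((sqrt e1)\<^sup>2 * \<beta>\<^sup>2) + \<epsilon>\<^sup>2 * (sqrt e1)\<^sup>2 + (\<epsilon> - \<epsilon>')\<^sup>2 * \<beta>\<^sup>2)"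
      unfolding C_def by (rule kdv_rhs_diff_bound[OF G G'[OF t] s _ a _ b _ th]) (use K0 e1 in \<open>auto simp: \<alpha>_def \<beta>_def\<close>)
    also have "\<dots> = 4 * (C * \<alpha>\<^sup>2 * e1 + C * \<beta>\<^sup>2 * e1 + \<epsilon>\<^sup>2 * e1 + (\<epsilon> - \<epsilon>')\<^sup>2 * \<beta>\<^sup>2)" using e1 by (simp add: mult_ac)
    also have "\<dots> \<le> 4 * (C * \<alpha>\<^sup>2 * e1 + C * \<beta>\<^sup>2 * e1 + (\<bar>\<epsilon>'\<bar> + 1)\<^sup>2 * e1 + e1 * \<beta>\<^sup>2)"
    proof -
      have "\<bar>\<epsilon>\<bar> \<le> \<bar>\<epsilon>'\<bar> + 1" using \<epsilon> e1 by linarith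
      then have "\<epsilon>\<^sup>2 \<le> (\<bar>\<epsilon>'\<bar> + 1)\<^sup>2" by (metis abs_ge_zero power2_abs power_mono)
      moreover have "(\<epsilon> - \<epsilon>')\<^sup>2 \<le> e1"
      proof -
        have "(\<epsilon> - \<epsilon>')\<^sup>2 = \<bar>\<epsilon> - \<epsilon>'\<bar> * \<bar>\<epsilon> - \<epsilon>'\<bar>" by (simp add: power2_eq_square)
        also have "\<dots> \<le> e1 * 1" using \<epsilon> e1 by (intro mult_mono) auto
        finally show ?thesis by simp
      qed
      ultimately show ?thesis using e1 by (intro mult_left_mono add_mono mult_right_mono order_refl) auto
    qed
    also have "\<dots> = 4 * B * e1" by (simp add: B_def algebra_simps)
    also have "\<dots> \<le> 4 * B * (e / (8 * B))" using e1 B by (intro mult_left_mono) auto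
    also have "\<dots> = e / 2" using B by simp
    finally show "Hs_sq s (\<lambda>\<xi>. g t \<xi> - g' t \<xi>) < e \<and> Hs_sq (s - 3) (\<lambda>\<xi>. kdv_rhs \<epsilon> (g t) \<xi> - kdv_rhs \<epsilon>' (g' t) \<xi>) < e"
      using w e1 e by auto
  qed
qed

section \<open>From Sobolev solutions to their transforms, and the theorem\<close>

lemma fourier_L2_Hs: "fourier_L2 f g \<Longrightarrow> in_Hs s f \<Longrightarrow> Hs s g"
  using in_Hs_integrable by (auto simp: Hs_def fourier_L2_def)

lemma hs_norm_Hs_sq: "fourier_L2 f g \<Longrightarrow> hs_norm s f = sqrt (Hs_sq s g)"
  by (simp add: hs_norm_eq Hs_sq_def)

text \<open>The Fourier transform is only determined almost everywhere; this representative is Hermitian at every frequency.\<close>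

definition hermitian_transform :: "(real \<Rightarrow> real) \<Rightarrow> real \<Rightarrow> complex" where
  "hermitian_transform f = (\<lambda>\<xi>. ((SOME g. fourier_L2 f g) \<xi> + cnj ((SOME g. fourier_L2 f g) (- \<xi>))) / 2)"

lemma hermitian_transform:
  assumes "in_Hs s f"
  shows "fourier_L2 f (hermitian_transform f)" "Hs s (hermitian_transform f)"
proof -
  have "fourier_L2 f (SOME g. fourier_L2 f g)" using assms unfolding in_Hs_def by (metis someI)
  then show "fourier_L2 f (hermitian_transform f)" unfolding hermitian_transform_def by (rule fourier_L2_hermitian)
  then show "Hs s (hermitian_transform f)" using assms by (rule fourier_L2_Hs)
qed

lemma hermitian_transform_uminus: "hermitian_transform f (- \<xi>) = cnj (hermitian_transform f \<xi>)"
  by (simp add: hermitian_transform_def add.commute)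

lemma pde_sol_kdv_rhs:
  assumes sol: "pde_sol s (s - 3) T \<phi> \<epsilon> u du" and s: "3 \<le> s" and t: "t \<in> {0..T}"
  shows "fourier_L2 (du t) (kdv_rhs \<epsilon> (hermitian_transform (u t)))"
proof -
  have "in_Hs s (u t)" using sol t by (simp add: pde_sol_def cont_Hs_def)
  note H = hermitian_transform[OF this]
  obtain w1 w3 where w: "weak_deriv 1 (u t) w1" "weak_deriv 3 (u t) w3" "AE x in lborel. du t x = u t x * w1 x + \<epsilon> * w3 x"
    using sol t unfolding pde_sol_def by blast
  have "in_Hs (s - 3) (du t)" using sol t by (simp add: pde_sol_def C1_Hs_def cont_Hs_def)
  then have L: "L2 (du t)" by (auto simp: in_Hs_def fourier_L2_def)
  show ?thesis unfolding kdv_rhs_def[abs_def]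
    by (rule kdv_fourier[OF H(1) Hs_integrable(1,2)[OF H(2)] Hs_deriv_1[OF H(2) s] Hs_deriv_L2c(1)[OF H(2)] w(1,2) L w(3)])
       (use s in auto)
qed

text \<open>Weak derivatives become multipliers and products become convolutions. The
  \<open>L^2\<close> limit of the difference quotients is dominated by the \<open>H^(s-3)\<close>
  limit contained in \<open>C1_Hs\<close>, since the weight is at least 1 for
  \<open>s \<ge> 3\<close>.\<close>

lemma pde_sol_fourier_sol:
  assumes sol: "pde_sol s (s - 3) T \<phi> \<epsilon> u du" and s: "3 \<le> s"
  shows "fourier_sol s T \<epsilon> (\<lambda>t. hermitian_transform (u t))"
  unfolding fourier_sol_def
proof (intro conjI ballI allI)
  let ?g = "\<lambda>t. hermitian_transform (u t)"
  have I: "in_Hs s (u t)" if "t \<in> {0..T}" for t using sol that by (simp add: pde_sol_def cont_Hs_def)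
  note H = hermitian_transform[OF I]
  fix t assume t: "t \<in> {0..T}"
  show "Hs s (?g t)" by (rule H(2)[OF t])
  show "?g t (- \<xi>) = cnj (?g t \<xi>)" for \<xi> by (rule hermitian_transform_uminus)
  have n: "hs_norm s (\<lambda>x. u t' x - u t x) = sqrt (Hs_sq s (\<lambda>\<xi>. ?g t' \<xi> - ?g t \<xi>))" if "t' \<in> {0..T}" for t'
    by (rule hs_norm_Hs_sq[OF fourier_L2_diff[OF H(1)[OF that] H(1)[OF t]]])
  show "((\<lambda>t'. Hs_sq s (\<lambda>\<xi>. ?g t' \<xi> - ?g t \<xi>)) \<longlongrightarrow> 0) (at t within {0..T})"
    unfolding tendsto_iff
  proof (intro allI impI)
    fix e :: real assume e: "0 < e"
    then obtain d where d: "0 < d" "\<forall>t'\<in>{0..T}. \<bar>t' - t\<bar> < d \<longrightarrow> hs_norm s (\<lambda>x. u t' x - u t x) < sqrt e"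
      using sol t unfolding pde_sol_def cont_Hs_def by (meson real_sqrt_gt_zero)
    show "\<forall>\<^sub>F t' in at t within {0..T}. dist (Hs_sq s (\<lambda>\<xi>. ?g t' \<xi> - ?g t \<xi>)) 0 < e"
      unfolding eventually_at
      by (rule exI[of _ d]) (use d n in \<open>auto simp: dist_real_def Hs_sq_nonneg\<close>)
  qed
  let ?q = "\<lambda>t' \<xi>. (?g t' \<xi> - ?g t \<xi>) / complex_of_real (t' - t) - kdv_rhs \<epsilon> (?g t) \<xi>"
  have lim: "((\<lambda>t'. hs_norm (s - 3) (\<lambda>x. (u t' x - u t x) / (t' - t) - du t x)) \<longlongrightarrow> 0) (at t within {0..T})"
    using sol t by (simp add: pde_sol_def C1_Hs_def)
  have le: "(LINT \<xi>|lborel. (cmod (?q t' \<xi>))\<^sup>2) \<le> (hs_norm (s - 3) (\<lambda>x. (u t' x - u t x) / (t' - t) - du t x))\<^sup>2" if t': "t' \<in> {0..T}" for t'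
  proof -
    have D: "fourier_L2 (du t) (kdv_rhs \<epsilon> (?g t))" by (rule pde_sol_kdv_rhs[OF sol s t])
    have D2: "Hs (s - 3) (kdv_rhs \<epsilon> (?g t))"
      by (rule fourier_L2_Hs[OF D]) (use sol t in \<open>simp add: pde_sol_def C1_Hs_def cont_Hs_def\<close>)
    have I3: "in_Hs (s - 3) (u t)" if "t \<in> {0..T}" for t using sol that by (simp add: pde_sol_def C1_Hs_def cont_Hs_def)
    \<comment> \<open>The quotient is written as a multiple so that linearity applies. For
      \<open>t' = t\<close> both sides use the convention that division by 0 gives 0.\<close>
    have "fourier_L2 (\<lambda>x. (1 / (t' - t)) * (u t' x - u t x) - du t x) (\<lambda>\<xi>. complex_of_real (1 / (t' - t)) * (?g t' \<xi> - ?g t \<xi>) - kdv_rhs \<epsilon> (?g t) \<xi>)"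
      by (intro fourier_L2_diff fourier_L2_cmult H(1) t t' D)
    then have F: "fourier_L2 (\<lambda>x. (u t' x - u t x) / (t' - t) - du t x) (?q t')" by simp
    have "Hs (s - 3) (\<lambda>\<xi>. ?g t' \<xi> - ?g t \<xi>)" by (intro Hs_diff(1) fourier_L2_Hs[OF H(1) I3] t t')
    then have "Hs (s - 3) (\<lambda>\<xi>. (?g t' \<xi> - ?g t \<xi>) / complex_of_real (t' - t))"
      unfolding Hs_def by (auto simp: norm_divide power_divide)
    then have Q: "Hs (s - 3) (?q t')" by (intro Hs_diff(1) D2)
    have "(LINT \<xi>|lborel. (cmod (?q t' \<xi>))\<^sup>2) \<le> Hs_sq (s - 3) (?q t')"
      by (rule Hs_L2c(2)[OF Q]) (use s in simp)
    then show ?thesis unfolding hs_norm_Hs_sq[OF F] by (simp add: Hs_sq_nonneg)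
  qed
  have l2: "((\<lambda>t'. (hs_norm (s - 3) (\<lambda>x. (u t' x - u t x) / (t' - t) - du t x))\<^sup>2) \<longlongrightarrow> 0) (at t within {0..T})"
    using tendsto_power[OF lim, of 2] by simp
  have "\<forall>\<^sub>F t' in at t within {0..T}. (LINT \<xi>|lborel. (cmod (?q t' \<xi>))\<^sup>2) \<le> (hs_norm (s - 3) (\<lambda>x. (u t' x - u t x) / (t' - t) - du t x))\<^sup>2"
    using le by (auto simp: eventually_at_filter)
  then show "((\<lambda>t'. LINT \<xi>|lborel. (cmod (?q t' \<xi>))\<^sup>2) \<longlongrightarrow> 0) (at t within {0..T})"
    by (rule tendsto_sandwich[OF _ _ tendsto_const l2, rotated]) simp
qed

theorem mainTheorem2:
  fixes s T :: real and \<phi> :: "real \<Rightarrow> real"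
    and u du :: "real \<Rightarrow> real \<Rightarrow> real \<Rightarrow> real"
  assumes "s \<ge> 3" and "in_Hs s \<phi>"
    and "0 < T" and "ereal T < crit_time s \<phi>"
    and "\<forall>\<epsilon>. pde_sol s (s - 3) T \<phi> \<epsilon> (u \<epsilon>) (du \<epsilon>)"
  shows "\<forall>\<epsilon>0. \<forall>e>0. \<exists>\<delta>>0. \<forall>\<epsilon>. \<bar>\<epsilon> - \<epsilon>0\<bar> < \<delta> \<longrightarrow>
           (SUP t\<in>{0..T}. hs_norm s (\<lambda>x. u \<epsilon> t x - u \<epsilon>0 t x))
         + (SUP t\<in>{0..T}. hs_norm (s - 3) (\<lambda>x. du \<epsilon> t x - du \<epsilon>0 t x)) < e"
proof (intro allI impI)
  fix \<epsilon>0 e :: real assume e: "0 < e"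
  note sol = assms(5)[rule_format]
  let ?g = "\<lambda>\<epsilon> t. hermitian_transform (u \<epsilon> t)"
  have F: "fourier_L2 (u \<epsilon> t) (?g \<epsilon> t)" if "t \<in> {0..T}" for \<epsilon> t
  proof (rule hermitian_transform(1))
    show "in_Hs s (u \<epsilon> t)" using sol[of \<epsilon>] that by (simp add: pde_sol_def cont_Hs_def)
  qed
  have init: "AE \<xi> in lborel. ?g \<epsilon> 0 \<xi> = ?g \<epsilon>0 0 \<xi>" for \<epsilon>
  proof -
    have 0: "(0::real) \<in> {0..T}" using assms(3) by simp
    have ae: "AE x in lborel. u \<epsilon> 0 x = u \<epsilon>0 0 x"
      using sol[of \<epsilon>] sol[of \<epsilon>0] by (auto simp: pde_sol_def)
    \<comment> \<open>The chosen transforms belong to initial values that agree only almost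
      everywhere. Recognising one as a transform of the other function makes uniqueness
      applicable.\<close>
    have "fourier_L2 (u \<epsilon>0 0) (?g \<epsilon> 0)"
      by (rule fourier_L2_cong[OF F[OF 0, of \<epsilon>] _ _ ae]) (use F[OF 0] in \<open>auto simp: fourier_L2_iff\<close>)
    then show ?thesis by (rule fourier_L2_unique[OF _ F[OF 0]])
  qed
  obtain \<delta> where \<delta>: "0 < \<delta>" and close: "\<And>\<epsilon> g t. \<lbrakk>\<bar>\<epsilon> - \<epsilon>0\<bar> < \<delta>; fourier_sol s T \<epsilon> g; AE \<xi> in lborel. g 0 \<xi> = ?g \<epsilon>0 0 \<xi>; t \<in> {0..T}\<rbrakk>
       \<Longrightarrow> Hs_sq s (\<lambda>\<xi>. g t \<xi> - ?g \<epsilon>0 t \<xi>) < (e / 4)\<^sup>2 \<and> Hs_sq (s - 3) (\<lambda>\<xi>. kdv_rhs \<epsilon> (g t) \<xi> - kdv_rhs \<epsilon>0 (?g \<epsilon>0 t) \<xi>) < (e / 4)\<^sup>2"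
    using fourier_sol_close[OF pde_sol_fourier_sol[OF sol assms(1)] assms(1,3), of "(e / 4)\<^sup>2" \<epsilon>0] e by auto
  have "(SUP t\<in>{0..T}. hs_norm s (\<lambda>x. u \<epsilon> t x - u \<epsilon>0 t x)) + (SUP t\<in>{0..T}. hs_norm (s - 3) (\<lambda>x. du \<epsilon> t x - du \<epsilon>0 t x)) < e"
    if \<epsilon>: "\<bar>\<epsilon> - \<epsilon>0\<bar> < \<delta>" for \<epsilon>
  proof -
    note cl = close[OF \<epsilon> pde_sol_fourier_sol[OF sol assms(1)] init]
    have sq: "sqrt y \<le> e / 4" if "y < (e / 4)\<^sup>2" for y using that e by (intro real_le_lsqrt) auto
    \<comment> \<open>The supremum is bounded by a bound for every \<open>t\<close>, for which
      \<open>0 < T\<close> provides a nonempty interval. The strict pointwise bounds become weak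
      ones, and \<open>e / 4 + e / 4\<close> leaves room for the strict conclusion.\<close>
    have "(SUP t\<in>{0..T}. hs_norm s (\<lambda>x. u \<epsilon> t x - u \<epsilon>0 t x)) \<le> e / 4"
    proof (rule cSUP_least)
      fix t assume t: "t \<in> {0..T}"
      show "hs_norm s (\<lambda>x. u \<epsilon> t x - u \<epsilon>0 t x) \<le> e / 4"
        unfolding hs_norm_Hs_sq[OF fourier_L2_diff[OF F[OF t] F[OF t]]] using cl[OF t] by (intro sq) blast
    qed (use assms(3) in simp)
    moreover have "(SUP t\<in>{0..T}. hs_norm (s - 3) (\<lambda>x. du \<epsilon> t x - du \<epsilon>0 t x)) \<le> e / 4"
    proof (rule cSUP_least)
      fix t assume t: "t \<in> {0..T}"
      show "hs_norm (s - 3) (\<lambda>x. du \<epsilon> t x - du \<epsilon>0 t x) \<le> e / 4"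
        unfolding hs_norm_Hs_sq[OF fourier_L2_diff[OF pde_sol_kdv_rhs[OF sol assms(1) t] pde_sol_kdv_rhs[OF sol assms(1) t]]]
        using cl[OF t] by (intro sq) blast
    qed (use assms(3) in simp)
    ultimately show ?thesis using e by linarith
  qed
  then show "\<exists>\<delta>>0. \<forall>\<epsilon>. \<bar>\<epsilon> - \<epsilon>0\<bar> < \<delta> \<longrightarrow>
           (SUP t\<in>{0..T}. hs_norm s (\<lambda>x. u \<epsilon> t x - u \<epsilon>0 t x))
         + (SUP t\<in>{0..T}. hs_norm (s - 3) (\<lambda>x. du \<epsilon> t x - du \<epsilon>0 t x)) < e"
    using \<delta> by blast
qed

end
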